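(* Let $(\Omega_1,\mathcal{A},\mathbb{P}_1)$ and $(\Omega_2,\mathcal{B},\mathbb{P}_2)$ be probability spaces with filtrations $(\mathcal{A}_s)_{s\geq0}$ of $\mathcal{A}$ and $(\mathcal{B}_s)_{s\geq0}$ of $\mathcal{B}$, and on the product probability space $(\Omega_1\times\Omega_2,\mathcal{A}\otimes\mathcal{B},\mathbb{P}_1\times\mathbb{P}_2)$ put $\mathcal{F}_s:=\mathcal{A}_s\otimes\mathcal{B}$ and $\mathcal{G}_s:=\mathcal{A}\otimes\mathcal{B}_s$ for $s\geq 0$. Let $(X_s)_{s\geq0}$ be a real-valued martingale with respect to $(\mathcal{F}_s)_{s\geq0}$ and $(Y_s)_{s\geq0}$ a real-valued martingale with respect to $(\mathcal{G}_s)_{s\geq0}$. Fix $t>0$ and assume $X_t,Y_t\in\mathrm{L}^4$. Then the set of random variables $$\bigg\{\int_0^tH_s\,d(X_sY_s)\,:\,(H_s)_{s\geq0}\text{ is elementary }(\mathcal{F}_s\cap\mathcal{G}_s)_{s\geq0}\text{-predictable},\ \sup_{0\leq s\leq t}\|H_s\|_{\mathrm{L}^\infty}\leq1\bigg\}$$ is bounded in $\mathrm{L}^{4/3}$, and thus also bounded in probability.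
   Context: An elementary $(\mathcal{F}_s\cap\mathcal{G}_s)_{s\geq0}$-predictable process (relative to the fixed $t$) is a real-valued process $H=(H_s)_{s\geq0}$ of the form $H_0=K_{-1}$, $H_s=K_{k-1}$ for $t_{k-1}<s\leq t_k$, $k=1,\ldots,n$, and $H_s=0$ for $s>t$, where $0=t_0<t_1<\cdots<t_n=t$ is a partition of $[0,t]$, $K_{-1}$ is $(\mathcal{F}_0\cap\mathcal{G}_0)$-measurable, and each $K_k$, $0\leq k\leq n-1$, is $(\mathcal{F}_{t_k}\cap\mathcal{G}_{t_k})$-measurable. For such $H$ one defines $$\int_0^tH_s\,d(X_sY_s):=\sum_{k=1}^nK_{k-1}\,(X_{t_k}Y_{t_k}-X_{t_{k-1}}Y_{t_{k-1}}),$$ which does not depend on the representation of $H$. All norms are with respect to $\mathbb{P}=\mathbb{P}_1\times\mathbb{P}_2$; $\|\cdot\|_{\mathrm{L}^\infty}$ is the essential supremum norm. A set $\mathcal{S}$ of random variables is bounded in probability if $\lim_{\lambda\to\infty}\sup_{S\in\mathcal{S}}\mathbb{P}(|S|>\lambda)=0$. *)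

theory Defs
  imports "HOL-Probability.Probability"
begin

text \<open>Time is modelled by real numbers; all processes and filtrations are only constrained at
  times \<open>s \<ge> 0\<close>, and random variables only on the space of the underlying measure.
  A sub-sigma-algebra is represented, as in the library, by a measure of which only the space
  and the measurable sets are relevant.\<close>

definition filtration_of :: "'a measure \<Rightarrow> (real \<Rightarrow> 'a measure) \<Rightarrow> bool" where
  "filtration_of M F \<longleftrightarrow>
     (\<forall>s\<ge>0. subalgebra M (F s)) \<and>
     (\<forall>s u. 0 \<le> s \<longrightarrow> s \<le> u \<longrightarrow> sets (F s) \<subseteq> sets (F u))"

definition martingale_wrt :: "'a measure \<Rightarrow> (real \<Rightarrow> 'a measure) \<Rightarrow> (real \<Rightarrow> 'a \<Rightarrow> real) \<Rightarrow> bool" where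
  "martingale_wrt M F X \<longleftrightarrow>
     (\<forall>s\<ge>0. X s \<in> borel_measurable (F s)) \<and>
     (\<forall>s\<ge>0. integrable M (X s)) \<and>
     (\<forall>s u. 0 \<le> s \<longrightarrow> s \<le> u \<longrightarrow> (AE \<omega> in M. real_cond_exp M (F s) (X u) \<omega> = X s \<omega>))"

definition Int_algebra :: "'a measure \<Rightarrow> 'a measure \<Rightarrow> 'a measure" where
  "Int_algebra F G = sigma (space F \<inter> space G) (sets F \<inter> sets G)"

lemma space_Int_algebra: "space (Int_algebra F G) = space F \<inter> space G"
  unfolding Int_algebra_def by (rule space_measure_of) (use sets.sets_into_space in blast)

lemma sets_Int_algebra:
  assumes "space F = space G"
  shows "sets (Int_algebra F G) = sets F \<inter> sets G"
proof -
  have *: "sets F \<inter> sets G \<subseteq> Pow (space F)"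
    using sets.sets_into_space by blast
  have "sigma_sets (space F) (sets F \<inter> sets G) \<subseteq> sets F"
    by (rule sets.sigma_sets_subset) blast
  moreover have "sigma_sets (space F) (sets F \<inter> sets G) \<subseteq> sets G"
    unfolding assms by (rule sets.sigma_sets_subset) blast
  ultimately have "sigma_sets (space F) (sets F \<inter> sets G) = sets F \<inter> sets G"
    by blast
  then show ?thesis
    using * by (simp add: Int_algebra_def assms[symmetric] sets_measure_of)
qed

text \<open>In \<open>elementary_repr \<Omega> F t n \<tau> K0 K H\<close> the partition of \<open>[0,t]\<close> is
  \<open>\<tau> 0 < \<dots> < \<tau> n\<close>. The initial value, usually indexed by \<open>-1\<close>, is the separate argument
  \<open>K0\<close>, and \<open>K k\<close> is the value of \<open>H\<close> on the interval from \<open>\<tau> k\<close> (exclusive) to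
  \<open>\<tau> (Suc k)\<close> (inclusive).\<close>

definition elementary_repr ::
  "'a set \<Rightarrow> (real \<Rightarrow> 'a measure) \<Rightarrow> real \<Rightarrow> nat \<Rightarrow> (nat \<Rightarrow> real) \<Rightarrow> ('a \<Rightarrow> real) \<Rightarrow>
   (nat \<Rightarrow> 'a \<Rightarrow> real) \<Rightarrow> (real \<Rightarrow> 'a \<Rightarrow> real) \<Rightarrow> bool" where
  "elementary_repr \<Omega> F t n \<tau> K0 K H \<longleftrightarrow>
     \<tau> 0 = 0 \<and> \<tau> n = t \<and> (\<forall>k<n. \<tau> k < \<tau> (Suc k)) \<and>
     K0 \<in> borel_measurable (F 0) \<and>
     (\<forall>k<n. K k \<in> borel_measurable (F (\<tau> k))) \<and>
     (\<forall>\<omega>\<in>\<Omega>. H 0 \<omega> = K0 \<omega>) \<and>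
     (\<forall>k<n. \<forall>s. \<tau> k < s \<longrightarrow> s \<le> \<tau> (Suc k) \<longrightarrow> (\<forall>\<omega>\<in>\<Omega>. H s \<omega> = K k \<omega>)) \<and>
     (\<forall>s>t. \<forall>\<omega>\<in>\<Omega>. H s \<omega> = 0)"

definition elementary_predictable ::
  "'a set \<Rightarrow> (real \<Rightarrow> 'a measure) \<Rightarrow> real \<Rightarrow> (real \<Rightarrow> 'a \<Rightarrow> real) \<Rightarrow> bool" where
  "elementary_predictable \<Omega> F t H \<longleftrightarrow> (\<exists>n \<tau> K0 K. elementary_repr \<Omega> F t n \<tau> K0 K H)"

definition elementary_sum ::
  "nat \<Rightarrow> (nat \<Rightarrow> real) \<Rightarrow> (nat \<Rightarrow> 'a \<Rightarrow> real) \<Rightarrow> (real \<Rightarrow> 'a \<Rightarrow> real) \<Rightarrow> 'a \<Rightarrow> real" where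
  "elementary_sum n \<tau> K Z \<omega> = (\<Sum>k<n. K k \<omega> * (Z (\<tau> (Suc k)) \<omega> - Z (\<tau> k) \<omega>))"

text \<open>The integral of \<open>H\<close> against \<open>Z\<close> over \<open>[0,t]\<close>, computed from an arbitrary representation;
  \<open>elementary_integral_eq\<close> below shows that the choice does not matter.\<close>

definition elementary_integral ::
  "'a set \<Rightarrow> (real \<Rightarrow> 'a measure) \<Rightarrow> real \<Rightarrow> (real \<Rightarrow> 'a \<Rightarrow> real) \<Rightarrow> (real \<Rightarrow> 'a \<Rightarrow> real) \<Rightarrow>
   'a \<Rightarrow> real" where
  "elementary_integral \<Omega> F t H Z =
     (SOME I. \<exists>n \<tau> K0 K. elementary_repr \<Omega> F t n \<tau> K0 K H \<and> I = elementary_sum n \<tau> K Z)"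

text \<open>The sum, rewritten by summation by parts in terms of the jumps of the step function.\<close>

lemma step_function_sum:
  fixes h z :: "real \<Rightarrow> real" and \<tau> c :: "nat \<Rightarrow> real"
  assumes t0: "\<tau> 0 = 0" and tn: "\<tau> n = t" and inc: "\<And>k. k < n \<Longrightarrow> \<tau> k < \<tau> (Suc k)"
    and h: "\<And>k s. k < n \<Longrightarrow> \<tau> k < s \<Longrightarrow> s \<le> \<tau> (Suc k) \<Longrightarrow> h s = c k"
  defines "J \<equiv> \<lambda>s. (if 0 < s then h s else 0) - (if s < t then Lim (at_right s) h else 0)"
  shows "(\<Sum>k<n. c k * (z (\<tau> (Suc k)) - z (\<tau> k))) = (\<Sum>s | s \<in> {0..t} \<and> J s \<noteq> 0. J s * z s)"
proof -
  have less: "\<tau> i < \<tau> j" if "i < j" "j \<le> n" for i j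
    using that
  proof (induction j)
    case (Suc j)
    then show ?case
      using inc[of j] by (cases "i = j") force+
  qed simp
  have inj: "inj_on \<tau> {..n}"
    by (rule linorder_inj_onI) (use less in fastforce)+
  have r: "Lim (at_right s) h = c k" if "k < n" "\<tau> k \<le> s" "s < \<tau> (Suc k)" for k s
  proof -
    have "eventually (\<lambda>u. c k = h u) (at_right s)"
      using that h[OF \<open>k < n\<close>] unfolding eventually_at_right_field
      by (intro exI[of _ "\<tau> (Suc k)"]) auto
    then have "(h \<longlongrightarrow> c k) (at_right s)"
      by (rule Lim_transform_eventually[OF tendsto_const])
    then show ?thesis
      by (intro tendsto_Lim) auto
  qed
  have loc: "s \<in> \<tau> ` {..n} \<or> (\<exists>k<n. \<tau> k < s \<and> s < \<tau> (Suc k))" if "0 \<le> s" "s \<le> t" for s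
  proof -
    have "s \<in> \<tau> ` {..m} \<or> (\<exists>k<m. \<tau> k < s \<and> s < \<tau> (Suc k))" if "m \<le> n" "s \<le> \<tau> m" for m
      using that
    proof (induction m)
      case 0
      then show ?case using \<open>0 \<le> s\<close> t0 by auto
    next
      case (Suc m)
      show ?case
      proof (cases "s \<le> \<tau> m")
        case True
        with Suc show ?thesis by (auto simp: less_Suc_eq)
      next
        case False
        with Suc.prems show ?thesis by (cases "s = \<tau> (Suc m)") auto
      qed
    qed
    from this[of n] that show ?thesis by (simp add: tn)
  qed
  have J0: "J s = 0" if "k < n" "\<tau> k < s" "s < \<tau> (Suc k)" for k s
  proof -
    have "0 \<le> \<tau> k"
      using less[of 0 k] that t0 by (cases "k = 0") auto
    moreover have "\<tau> (Suc k) \<le> t"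
      using less[of "Suc k" n] that tn by (cases "Suc k = n") auto
    ultimately have "0 < s" "s < t"
      using that by linarith+
    then show ?thesis
      using r[of k s] h[of k s] that by (simp add: J_def)
  qed
  have Jk: "J (\<tau> k) = (if 0 < k then c (k - 1) else 0) - (if k < n then c k else 0)" if "k \<le> n" for k
  proof -
    have 1: "0 < \<tau> k \<longleftrightarrow> 0 < k"
      using less[of 0 k] t0 that by (cases "k = 0") auto
    have 2: "\<tau> k < t \<longleftrightarrow> k < n"
      using less[of k n] tn that by (cases "k = n") auto
    have 3: "h (\<tau> k) = c (k - 1)" if "0 < k"
      using h[of "k - 1" "\<tau> k"] inc[of "k - 1"] that \<open>k \<le> n\<close> by auto
    have 4: "Lim (at_right (\<tau> k)) h = c k" if "k < n"
      using r[of k "\<tau> k"] inc[of k] that by simp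
    show ?thesis unfolding J_def using 1 2 3 4 by auto
  qed
  have range: "\<tau> ` {..n} \<subseteq> {0..t}"
  proof safe
    fix k assume "k \<le> n"
    then show "\<tau> k \<in> {0..t}"
      using less[of 0 k] less[of k n] t0 tn by (cases "k = 0"; cases "k = n") force+
  qed
  have "(\<Sum>s | s \<in> {0..t} \<and> J s \<noteq> 0. J s * z s) = (\<Sum>s\<in>\<tau> ` {..n}. J s * z s)"
  proof (rule sum.mono_neutral_left)
    show "{s. s \<in> {0..t} \<and> J s \<noteq> 0} \<subseteq> \<tau> ` {..n}"
      using loc J0 by fastforce
    show "\<forall>s\<in>\<tau> ` {..n} - {s. s \<in> {0..t} \<and> J s \<noteq> 0}. J s * z s = 0"
      using range by auto
  qed simp
  also have "\<dots> = (\<Sum>k\<le>n. J (\<tau> k) * z (\<tau> k))"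
    using inj by (simp add: sum.reindex)
  also have "\<dots> = (\<Sum>k\<le>n. (if 0 < k then c (k - 1) else 0) * z (\<tau> k))
                  - (\<Sum>k\<le>n. (if k < n then c k else 0) * z (\<tau> k))"
    unfolding sum_subtractf[symmetric]
    by (intro sum.cong) (simp_all add: Jk left_diff_distrib)
  also have "(\<Sum>k\<le>n. (if 0 < k then c (k - 1) else 0) * z (\<tau> k)) = (\<Sum>k<n. c k * z (\<tau> (Suc k)))"
    by (simp add: sum.atMost_shift)
  also have "(\<Sum>k\<le>n. (if k < n then c k else 0) * z (\<tau> k)) = (\<Sum>k<n. c k * z (\<tau> k))"
    by (simp flip: lessThan_Suc_atMost)
  finally show ?thesis
    by (simp add: right_diff_distrib sum_subtractf)
qed

lemma elementary_sum_unique: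
  assumes "elementary_repr \<Omega> F t n \<tau> K0 K H" and "elementary_repr \<Omega> F t m \<sigma> L0 L H"
    and "\<omega> \<in> \<Omega>"
  shows "elementary_sum n \<tau> K Z \<omega> = elementary_sum m \<sigma> L Z \<omega>"
proof -
  have "elementary_sum n \<tau> K Z \<omega> =
      (let J = \<lambda>s. (if 0 < s then H s \<omega> else 0) - (if s < t then Lim (at_right s) (\<lambda>u. H u \<omega>) else 0)
       in \<Sum>s | s \<in> {0..t} \<and> J s \<noteq> 0. J s * Z s \<omega>)"
    if "elementary_repr \<Omega> F t n \<tau> K0 K H" for n \<tau> K0 K
    unfolding elementary_sum_def Let_def
    by (rule step_function_sum[where h = "\<lambda>s. H s \<omega>" and z = "\<lambda>s. Z s \<omega>" and c = "\<lambda>k. K k \<omega>"])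
       (use that \<open>\<omega> \<in> \<Omega>\<close> in \<open>auto simp: elementary_repr_def\<close>)
  from this[OF assms(1)] this[OF assms(2)] show ?thesis by simp
qed

lemma elementary_integral_eq:
  assumes "elementary_repr \<Omega> F t n \<tau> K0 K H" and "\<omega> \<in> \<Omega>"
  shows "elementary_integral \<Omega> F t H Z \<omega> = elementary_sum n \<tau> K Z \<omega>"
proof -
  have "\<exists>I m \<sigma> L0 L. elementary_repr \<Omega> F t m \<sigma> L0 L H \<and> I = elementary_sum m \<sigma> L Z"
    using assms(1) by blast
  from someI_ex[OF this]
  have "\<exists>m \<sigma> L0 L. elementary_repr \<Omega> F t m \<sigma> L0 L H \<and>
      elementary_integral \<Omega> F t H Z = elementary_sum m \<sigma> L Z"
    unfolding elementary_integral_def .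
  then show ?thesis
    using elementary_sum_unique[OF assms(1) _ assms(2)] by metis
qed

definition in_Lp :: "'a measure \<Rightarrow> real \<Rightarrow> ('a \<Rightarrow> real) \<Rightarrow> bool" where
  "in_Lp M p f \<longleftrightarrow> f \<in> borel_measurable M \<and> integrable M (\<lambda>\<omega>. \<bar>f \<omega>\<bar> powr p)"

definition Lp_norm :: "'a measure \<Rightarrow> real \<Rightarrow> ('a \<Rightarrow> real) \<Rightarrow> real" where
  "Lp_norm M p f = (\<integral>\<omega>. \<bar>f \<omega>\<bar> powr p \<partial>M) powr (1 / p)"

definition Linf_norm :: "'a measure \<Rightarrow> ('a \<Rightarrow> real) \<Rightarrow> ennreal" where
  "Linf_norm M f = esssup M (\<lambda>\<omega>. ennreal \<bar>f \<omega>\<bar>)"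

definition bounded_in_Lp :: "'a measure \<Rightarrow> real \<Rightarrow> ('a \<Rightarrow> real) set \<Rightarrow> bool" where
  "bounded_in_Lp M p S \<longleftrightarrow> (\<exists>C. \<forall>f\<in>S. in_Lp M p f \<and> Lp_norm M p f \<le> C)"

definition bounded_in_probability :: "'a measure \<Rightarrow> ('a \<Rightarrow> real) set \<Rightarrow> bool" where
  "bounded_in_probability M S \<longleftrightarrow>
     S \<subseteq> borel_measurable M \<and>
     ((\<lambda>l::real. SUP f\<in>S. emeasure M {\<omega> \<in> space M. \<bar>f \<omega>\<bar> > l}) \<longlongrightarrow> 0) at_top"

end

theory Submission
  imports Defs
begin

text \<open>Since \<open>X' Y' - X Y = X (Y' - Y) + Y' (X' - X)\<close>, the integral splits into two sums of the same
  shape with the roles of the coordinates exchanged. In the first sum \<open>\<Sum> K X\<^sub>k (Y\<^sub>k\<^sub>+\<^sub>1 - Y\<^sub>k)\<close> the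
  integrand \<open>X\<^sub>k\<close> is not adapted to the filtration of \<open>Y\<close>. Pairing it with \<open>Z\<close> and using
  Cauchy-Schwarz against the increments of \<open>Y\<close>, one has to bound
  \<open>\<Sum> \<parallel>E(X\<^sub>k Z | G\<^sub>k\<^sub>+\<^sub>1) - E(X\<^sub>k Z | G\<^sub>k)\<parallel>\<^sup>2\<close> (squared L2-norms) by fourth moments of \<open>X\<close> and \<open>Z\<close>.
  By density \<open>X\<close> and \<open>Z\<close> may be taken to be functions of finitely valued labels \<open>\<phi>\<close> and \<open>\<psi>\<close> of the two
  coordinates. Let \<open>g\<^sub>k\<close> and \<open>h\<^sub>k\<close> be their conditional distributions given \<open>F\<^sub>k\<close> and \<open>G\<^sub>k\<close>; these are
  martingales of probability vectors. The k-th summand is the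
  expected increment of a function \<open>\<Phi>\<^sub>1 g\<^sub>k h\<close> from \<open>h\<^sub>k\<close> to \<open>h\<^sub>k\<^sub>+\<^sub>1\<close>. The function \<open>\<Phi>\<^sub>1\<close> alone may decrease when
  \<open>g\<^sub>k\<close> moves to \<open>g\<^sub>k\<^sub>+\<^sub>1\<close>, but adding multiples of a square and of a box form in \<open>Z\<close> gives a function
  \<open>\<Phi>\<close> with \<open>E \<Phi>\<close> nondecreasing in both arguments, so the sum telescopes.
  Finally \<open>Z = sgn W |W|\<^sup>1\<^sup>/\<^sup>3\<close> for the integral \<open>W\<close>, and the fourth moment of \<open>Z\<close> is absorbed.\<close>

section \<open>The Bellman function\<close>

text \<open>Why \<open>\<Phi>\<^sub>1\<close> needs help: when \<open>g\<close> moves by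
  \<open>d\<close>, its second-order part contains the term
  \<open>2 * (\<Sum>i\<in>I. d i * L g h i * L d h i)\<close>, which has no sign. Summing over
  \<open>i\<close> first turns it into a sum over pairs \<open>j\<close>, \<open>j'\<close> of
  \<open>V g j * V d j'\<close> times \<open>W d j j'\<close>. Young's inequality splits this
  product into two squares, and these are matched by second-order gains of
  \<open>(Q g h)\<^sup>2\<close> and of \<open>box g h\<close>; the two correctors are found in this
  way. They are convex in \<open>h\<close> as well, so they do no harm when \<open>h\<close> moves,
  and there the increment of \<open>\<Phi>\<^sub>1\<close> is kept in full. First-order terms vanish
  in the mean because \<open>g k\<close> is a function of the first coordinate and hence known to
  every \<open>G l\<close>, and \<open>h l\<close> is known to every \<open>F k\<close>: at each
  step all coefficients of the moving vector are already known to its own filtration. Budget for the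
  fourth moment of \<open>Z\<close>: 2 / \<lambda> from the bound of \<open>\<Phi>\<close>, a factor
  1/2 from Cauchy-Schwarz, 8 from the passage to step functions, 2 for the two sums. Absorption
  needs 16 / \<lambda> < 1, and \<lambda> = 32 gives 1/2.\<close>

lemma convex_combination_power:
  fixes h v :: "'j \<Rightarrow> real"
  assumes "finite J" and h: "\<And>j. j \<in> J \<Longrightarrow> 0 \<le> h j" and h1: "(\<Sum>j\<in>J. h j) = 1" and "even m"
  shows "(\<Sum>j\<in>J. h j * v j) ^ m \<le> (\<Sum>j\<in>J. h j * v j ^ m)"
proof -
  have "J \<noteq> {}" using h1 by auto
  have "convex_on UNIV (\<lambda>x::real. x ^ m)" using \<open>even m\<close> by (rule convex_power_even)
  then show ?thesis
    using convex_on_sum[OF \<open>finite J\<close> \<open>J \<noteq> {}\<close> _ h1, of UNIV "\<lambda>x. x ^ m" v] h by simp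
qed

lemma sum_rotate3:
  "(\<Sum>a\<in>A. \<Sum>b\<in>B. \<Sum>c\<in>C. f a b c) = (\<Sum>b\<in>B. \<Sum>c\<in>C. \<Sum>a\<in>A. f a b c)"
  by (subst sum.swap) (intro sum.cong refl sum.swap)

lemma sum_mult_linear:
  fixes d a b e f :: "'i \<Rightarrow> real"
  shows "(\<Sum>i\<in>I. d i * (a i + 2 * b i + c * e i + f i / 16)) =
    (\<Sum>i\<in>I. d i * a i) + 2 * (\<Sum>i\<in>I. d i * b i) + c * (\<Sum>i\<in>I. d i * e i) + (\<Sum>i\<in>I. d i * f i) / 16"
  by (simp add: distrib_left sum.distrib sum_distrib_left sum_divide_distrib mult_ac)

text \<open>\<open>\<xi>\<close> and \<open>\<zeta>\<close> hold the values of \<open>X\<close> and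
  \<open>Z\<close> as functions of the two labels; \<open>g\<close> and \<open>h\<close> stand for
  laws of the first and the second label.\<close>

locale bellman =
  fixes I :: "'i set" and J :: "'j set" and \<xi> \<zeta> :: "'i \<Rightarrow> 'j \<Rightarrow> real"
  assumes fin: "finite I" "finite J"
begin

text \<open>For the conditional law \<open>g\<close> given \<open>F k\<close> this is E(X | F k)
  where the second label equals \<open>j\<close>; see \<open>cond_exp_label\<close>.\<close>

definition V :: "('i \<Rightarrow> real) \<Rightarrow> 'j \<Rightarrow> real" where
  "V g j = (\<Sum>i\<in>I. g i * \<xi> i j)"

text \<open>For conditional laws given \<open>F k\<close> and \<open>G l\<close> this is E(X' Z | G
  l) with X' = E(X | F k), where the first label equals \<open>i\<close>.\<close>

definition L :: "('i \<Rightarrow> real) \<Rightarrow> ('j \<Rightarrow> real) \<Rightarrow> 'i \<Rightarrow> real" where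
  "L g h i = (\<Sum>j\<in>J. h j * (\<zeta> i j * V g j))"

definition Q :: "('i \<Rightarrow> real) \<Rightarrow> ('j \<Rightarrow> real) \<Rightarrow> real" where
  "Q g h = (\<Sum>j\<in>J. h j * (V g j)\<^sup>2)"

definition W :: "('i \<Rightarrow> real) \<Rightarrow> 'j \<Rightarrow> 'j \<Rightarrow> real" where
  "W g j j' = (\<Sum>i\<in>I. g i * (\<zeta> i j * \<zeta> i j'))"

definition \<Phi>\<^sub>1 :: "('i \<Rightarrow> real) \<Rightarrow> ('j \<Rightarrow> real) \<Rightarrow> real" where
  "\<Phi>\<^sub>1 g h = (\<Sum>i\<in>I. g i * (L g h i)\<^sup>2)"

text \<open>The fourth power of a weighted Gowers box norm of the matrix \<open>\<zeta>\<close>: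
  expanding the square sums the product of \<open>\<zeta>\<close> over the four corners of all
  rectangles.\<close>

definition box :: "('i \<Rightarrow> real) \<Rightarrow> ('j \<Rightarrow> real) \<Rightarrow> real" where
  "box g h = (\<Sum>j\<in>J. \<Sum>j'\<in>J. h j * h j' * (W g j j')\<^sup>2)"

text \<open>The weights \<open>16 = \<lambda> / 2\<close> and \<open>1 / 32 = 1 / \<lambda>\<close> come from \<open>2 x y \<le> \<lambda> x\<^sup>2 + y\<^sup>2 / \<lambda>\<close>. Any \<open>\<lambda>\<close> works for
  monotonicity; \<open>\<lambda> = 32\<close> makes the coefficient of the fourth moment of \<open>Z\<close> small enough to be
  absorbed at the end.\<close>

definition \<Phi> :: "('i \<Rightarrow> real) \<Rightarrow> ('j \<Rightarrow> real) \<Rightarrow> real" where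
  "\<Phi> g h = \<Phi>\<^sub>1 g h + 16 * (Q g h)\<^sup>2 + box g h / 32"

text \<open>The partial derivative of \<open>\<Phi>\<close> with respect to
  \<open>g i\<close>.\<close>

definition R :: "('i \<Rightarrow> real) \<Rightarrow> ('j \<Rightarrow> real) \<Rightarrow> 'i \<Rightarrow> real" where
  "R g h i = (L g h i)\<^sup>2 + 2 * (\<Sum>k\<in>I. g k * L g h k * (\<Sum>j\<in>J. h j * (\<zeta> k j * \<xi> i j)))
     + 64 * Q g h * (\<Sum>j\<in>J. h j * V g j * \<xi> i j)
     + (\<Sum>j\<in>J. \<Sum>j'\<in>J. h j * h j' * W g j j' * (\<zeta> i j * \<zeta> i j')) / 16"

text \<open>The partial derivative with respect to \<open>h j\<close> of the correctors only. The
  increment of \<open>\<Phi>\<^sub>1\<close> in \<open>h\<close> is the quantity to be summed and is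
  therefore not linearised.\<close>

definition T :: "('i \<Rightarrow> real) \<Rightarrow> ('j \<Rightarrow> real) \<Rightarrow> 'j \<Rightarrow> real" where
  "T g h j = 32 * Q g h * (V g j)\<^sup>2
     + (\<Sum>i\<in>I. \<Sum>k\<in>I. g i * g k * (\<Sum>j'\<in>J. h j' * (\<zeta> i j' * \<zeta> k j')) * (\<zeta> i j * \<zeta> k j)) / 16"

lemma V_add: "V (\<lambda>i. g i + d i) j = V g j + V d j"
  by (simp add: V_def distrib_right sum.distrib)

lemma W_add: "W (\<lambda>i. g i + d i) j j' = W g j j' + W d j j'"
  by (simp add: W_def distrib_right sum.distrib)

lemma L_add: "L (\<lambda>i. g i + d i) h i = L g h i + L d h i"
  by (simp add: L_def V_add distrib_left distrib_right sum.distrib)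

text \<open>The derivative of \<open>\<Phi>\<close> in direction \<open>d\<close>, arranged so that
  each term meets the expansion of one of the three parts of \<open>\<Phi>\<close>.\<close>

lemma R_sum:
  "(\<Sum>i\<in>I. d i * R g h i) = (\<Sum>i\<in>I. d i * (L g h i)\<^sup>2) + 2 * (\<Sum>k\<in>I. g k * L g h k * L d h k)
     + 64 * Q g h * (\<Sum>j\<in>J. h j * V g j * V d j)
     + (\<Sum>j\<in>J. \<Sum>j'\<in>J. h j * h j' * W g j j' * W d j j') / 16"
proof -
  have 1: "(\<Sum>i\<in>I. d i * (\<Sum>k\<in>I. g k * L g h k * (\<Sum>j\<in>J. h j * (\<zeta> k j * \<xi> i j))))
      = (\<Sum>k\<in>I. g k * L g h k * L d h k)"
  proof -
    have "L d h k = (\<Sum>i\<in>I. d i * (\<Sum>j\<in>J. h j * (\<zeta> k j * \<xi> i j)))" for k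
      unfolding L_def V_def sum_distrib_left
      by (subst sum.swap) (intro sum.cong refl, simp add: mult_ac)
    then show ?thesis
      unfolding sum_distrib_left
      by (subst sum.swap) (simp add: sum_distrib_left mult_ac)
  qed
  have 2: "(\<Sum>i\<in>I. d i * (\<Sum>j\<in>J. h j * V g j * \<xi> i j)) = (\<Sum>j\<in>J. h j * V g j * V d j)"
    unfolding V_def[of d] sum_distrib_left by (subst sum.swap) (simp add: mult_ac)
  have 3: "(\<Sum>i\<in>I. d i * (\<Sum>j\<in>J. \<Sum>j'\<in>J. h j * h j' * W g j j' * (\<zeta> i j * \<zeta> i j')))
     = (\<Sum>j\<in>J. \<Sum>j'\<in>J. h j * h j' * W g j j' * W d j j')"
    unfolding W_def[of d] sum_distrib_left by (subst sum_rotate3) (simp add: mult_ac)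
  have "(\<Sum>i\<in>I. d i * R g h i) = (\<Sum>i\<in>I. d i * (L g h i)\<^sup>2)
     + 2 * (\<Sum>i\<in>I. d i * (\<Sum>k\<in>I. g k * L g h k * (\<Sum>j\<in>J. h j * (\<zeta> k j * \<xi> i j))))
     + 64 * Q g h * (\<Sum>i\<in>I. d i * (\<Sum>j\<in>J. h j * V g j * \<xi> i j))
     + (\<Sum>i\<in>I. d i * (\<Sum>j\<in>J. \<Sum>j'\<in>J. h j * h j' * W g j j' * (\<zeta> i j * \<zeta> i j'))) / 16"
    unfolding R_def by (rule sum_mult_linear)
  then show ?thesis
    unfolding 1 2 3 .
qed

text \<open>A tangent inequality. What exceeds the tangent is at least
  \<open>2 * D + 32 * (Q g h * q) + w / 32\<close>, which Young's inequality shows to be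
  nonnegative. Nonnegativity is asked of \<open>g i + d i\<close> because this is the weight of the
  squares \<open>(L d h i)\<^sup>2\<close> that are dropped.\<close>

lemma \<Phi>_step_g:
  assumes g: "\<And>i. i \<in> I \<Longrightarrow> 0 \<le> g i + d i" and h: "\<And>j. j \<in> J \<Longrightarrow> 0 \<le> h j"
  shows "\<Phi> g h + (\<Sum>i\<in>I. d i * R g h i) \<le> \<Phi> (\<lambda>i. g i + d i) h"
proof -
  let ?g = "\<lambda>i. g i + d i"
  define D where "D = (\<Sum>i\<in>I. d i * L g h i * L d h i)"
  define q where "q = (\<Sum>j\<in>J. h j * (V d j)\<^sup>2)"
  define w where "w = (\<Sum>j\<in>J. \<Sum>j'\<in>J. h j * h j' * (W d j j')\<^sup>2)"
  have "(\<Sum>i\<in>I. g i * (L g h i)\<^sup>2) + (\<Sum>i\<in>I. d i * (L g h i)\<^sup>2)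
      + 2 * (\<Sum>i\<in>I. g i * L g h i * L d h i) + 2 * D
      = (\<Sum>i\<in>I. (g i + d i) * ((L g h i)\<^sup>2 + 2 * L g h i * L d h i))"
    unfolding D_def sum_distrib_left sum.distrib[symmetric]
    by (intro sum.cong refl) (simp add: algebra_simps)
  also have "\<dots> \<le> (\<Sum>i\<in>I. (g i + d i) * (L ?g h i)\<^sup>2)"
    unfolding L_add by (intro sum_mono mult_left_mono g) (simp_all add: power2_sum)
  finally have a: "\<Phi>\<^sub>1 g h + (\<Sum>i\<in>I. d i * (L g h i)\<^sup>2)
      + 2 * (\<Sum>i\<in>I. g i * L g h i * L d h i) + 2 * D \<le> \<Phi>\<^sub>1 ?g h"
    unfolding \<Phi>\<^sub>1_def .
  \<comment> \<open>The sum over \<open>i\<close> collapses to \<open>W d j j'\<close>; this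
    converts an expression in \<open>L\<close> into one that \<open>Q\<close> and \<open>box\<close>
    control.\<close>
  have "D = (\<Sum>i\<in>I. \<Sum>j\<in>J. \<Sum>j'\<in>J. d i * (h j * (\<zeta> i j * V g j)) * (h j' * (\<zeta> i j' * V d j')))"
    unfolding D_def L_def mult.assoc
    by (simp add: sum_product sum_distrib_left mult_ac)
  also have "\<dots> = (\<Sum>j\<in>J. \<Sum>j'\<in>J. h j * h j' * (V g j * V d j' * W d j j'))"
    by (subst sum_rotate3) (simp add: W_def sum_distrib_left mult_ac)
  finally have D: "D = (\<Sum>j\<in>J. \<Sum>j'\<in>J. h j * h j' * (V g j * V d j' * W d j j'))" .
  have "- (32 * (Q g h * q) + w / 32)
      = (\<Sum>j\<in>J. \<Sum>j'\<in>J. h j * h j' * - (32 * ((V g j)\<^sup>2 * (V d j')\<^sup>2) + (W d j j')\<^sup>2 / 32))"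
  proof -
    have "Q g h * q = (\<Sum>j\<in>J. \<Sum>j'\<in>J. h j * h j' * ((V g j)\<^sup>2 * (V d j')\<^sup>2))"
      unfolding Q_def q_def sum_product by (simp add: mult_ac)
    moreover have "(\<Sum>j\<in>J. \<Sum>j'\<in>J. h j * h j' * - (32 * a j j' + b j j' / 32)) =
        - (32 * (\<Sum>j\<in>J. \<Sum>j'\<in>J. h j * h j' * a j j') + (\<Sum>j\<in>J. \<Sum>j'\<in>J. h j * h j' * b j j') / 32)"
      for a b :: "'j \<Rightarrow> 'j \<Rightarrow> real"
      by (simp add: sum_distrib_left sum_divide_distrib sum_negf[symmetric] sum.distrib[symmetric] algebra_simps)
    ultimately show ?thesis
      unfolding w_def by simp
  qed
  also have "\<dots> \<le> (\<Sum>j\<in>J. \<Sum>j'\<in>J. h j * h j' * (2 * (V g j * V d j' * W d j j')))"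
  proof (intro sum_mono mult_left_mono)
    fix j j'
    \<comment> \<open>Divided by 32, this square is Young's inequality with \<lambda> = 32.\<close>
    have "0 \<le> (32 * (V g j * V d j') + W d j j')\<^sup>2" by simp
    then show "- (32 * ((V g j)\<^sup>2 * (V d j')\<^sup>2) + (W d j j')\<^sup>2 / 32) \<le> 2 * (V g j * V d j' * W d j j')"
      by (simp add: power2_sum power_mult_distrib)
  qed (simp add: h)
  also have "\<dots> = 2 * D"
    unfolding D sum_distrib_left by (simp add: mult_ac)
  finally have d: "- (32 * (Q g h * q) + w / 32) \<le> 2 * D" .
  have Qg: "Q ?g h = Q g h + (2 * (\<Sum>j\<in>J. h j * V g j * V d j) + q)"
    unfolding Q_def q_def V_add sum_distrib_left sum.distrib[symmetric]
    by (intro sum.cong refl) (simp add: power2_sum algebra_simps)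
  \<comment> \<open>The square of the increment of \<open>Q\<close> is dropped; the product of
    \<open>Q g h\<close> and \<open>q\<close> that survives is what pays for
    \<open>D\<close>.\<close>
  have "(Q g h)\<^sup>2 + 2 * Q g h * (2 * (\<Sum>j\<in>J. h j * V g j * V d j) + q) \<le> (Q ?g h)\<^sup>2"
    unfolding Qg by (subst power2_sum) simp
  then have c: "16 * (Q g h)\<^sup>2 + 64 * Q g h * (\<Sum>j\<in>J. h j * V g j * V d j) + 32 * (Q g h * q) \<le> 16 * (Q ?g h)\<^sup>2"
    by (simp add: algebra_simps)
  have b: "box ?g h = box g h + 2 * (\<Sum>j\<in>J. \<Sum>j'\<in>J. h j * h j' * W g j j' * W d j j') + w"
    unfolding box_def w_def W_add sum_distrib_left sum.distrib[symmetric]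
    by (intro sum.cong refl) (simp add: power2_sum algebra_simps)
  show ?thesis
    unfolding R_sum \<Phi>_def using a c d b by linarith
qed

text \<open>The box form treats both coordinates alike. The definition shows squares of functions
  linear in \<open>g\<close>, this form shows squares of functions linear in \<open>h\<close>; each
  gives convexity in one argument.\<close>

lemma box_altdef: "box g h = (\<Sum>i\<in>I. \<Sum>k\<in>I. g i * g k * (\<Sum>j\<in>J. h j * (\<zeta> i j * \<zeta> k j))\<^sup>2)"
proof -
  have "box g h = (\<Sum>j\<in>J. \<Sum>j'\<in>J. \<Sum>i\<in>I. \<Sum>k\<in>I. h j * h j' * (g i * g k * (\<zeta> i j * \<zeta> i j' * (\<zeta> k j * \<zeta> k j'))))"
    unfolding box_def W_def power2_eq_square sum_product
    by (simp add: sum_distrib_left mult_ac)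
  also have "\<dots> = (\<Sum>j\<in>J. \<Sum>i\<in>I. \<Sum>j'\<in>J. \<Sum>k\<in>I. h j * h j' * (g i * g k * (\<zeta> i j * \<zeta> i j' * (\<zeta> k j * \<zeta> k j'))))"
    by (intro sum.cong refl) (rule sum.swap)
  also have "\<dots> = (\<Sum>j\<in>J. \<Sum>i\<in>I. \<Sum>k\<in>I. \<Sum>j'\<in>J. h j * h j' * (g i * g k * (\<zeta> i j * \<zeta> i j' * (\<zeta> k j * \<zeta> k j'))))"
    by (intro sum.cong refl) (rule sum.swap)
  also have "\<dots> = (\<Sum>i\<in>I. \<Sum>j\<in>J. \<Sum>k\<in>I. \<Sum>j'\<in>J. h j * h j' * (g i * g k * (\<zeta> i j * \<zeta> i j' * (\<zeta> k j * \<zeta> k j'))))"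
    by (rule sum.swap)
  also have "\<dots> = (\<Sum>i\<in>I. \<Sum>k\<in>I. \<Sum>j\<in>J. \<Sum>j'\<in>J. h j * h j' * (g i * g k * (\<zeta> i j * \<zeta> i j' * (\<zeta> k j * \<zeta> k j'))))"
    by (intro sum.cong refl) (rule sum.swap)
  also have "\<dots> = (\<Sum>i\<in>I. \<Sum>k\<in>I. g i * g k * (\<Sum>j\<in>J. h j * (\<zeta> i j * \<zeta> k j))\<^sup>2)"
    unfolding power2_eq_square sum_product
    by (intro sum.cong refl) (simp add: sum_distrib_left mult_ac)
  finally show ?thesis .
qed

lemma T_sum:
  "(\<Sum>j\<in>J. e j * T g h j) = 32 * Q g h * (\<Sum>j\<in>J. e j * (V g j)\<^sup>2)
     + (\<Sum>i\<in>I. \<Sum>k\<in>I. g i * g k * (\<Sum>j\<in>J. h j * (\<zeta> i j * \<zeta> k j)) * (\<Sum>j\<in>J. e j * (\<zeta> i j * \<zeta> k j))) / 16"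
proof -
  have 1: "(\<Sum>j\<in>J. e j * (\<Sum>i\<in>I. \<Sum>k\<in>I. g i * g k * (\<Sum>j'\<in>J. h j' * (\<zeta> i j' * \<zeta> k j')) * (\<zeta> i j * \<zeta> k j)))
    = (\<Sum>i\<in>I. \<Sum>k\<in>I. g i * g k * (\<Sum>j\<in>J. h j * (\<zeta> i j * \<zeta> k j)) * (\<Sum>j\<in>J. e j * (\<zeta> i j * \<zeta> k j)))"
    unfolding sum_distrib_left[of "e _"]
    by (subst sum_rotate3, intro sum.cong refl, subst (2) sum_distrib_left) (simp add: mult_ac)
  have "(\<Sum>j\<in>J. e j * T g h j) = 32 * Q g h * (\<Sum>j\<in>J. e j * (V g j)\<^sup>2)
    + (\<Sum>j\<in>J. e j * (\<Sum>i\<in>I. \<Sum>k\<in>I. g i * g k * (\<Sum>j'\<in>J. h j' * (\<zeta> i j' * \<zeta> k j')) * (\<zeta> i j * \<zeta> k j))) / 16"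
    unfolding T_def using sum_mult_linear[of e "\<lambda>_. 0" "\<lambda>_. 0" "32 * Q g h"] by simp
  then show ?thesis unfolding 1 .
qed

text \<open>\<open>Q\<close> is linear in \<open>h\<close>, and \<open>box_altdef\<close> writes
  \<open>box\<close> as a nonnegative combination of squares of linear functions of
  \<open>h\<close>. So both correctors lie above their tangents, while \<open>\<Phi>\<^sub>1\<close>
  enters with its exact increment.\<close>

lemma \<Phi>_step_h:
  assumes g: "\<And>i. i \<in> I \<Longrightarrow> 0 \<le> g i"
  shows "\<Phi> g h + (\<Phi>\<^sub>1 g (\<lambda>j. h j + e j) - \<Phi>\<^sub>1 g h) + (\<Sum>j\<in>J. e j * T g h j) \<le> \<Phi> g (\<lambda>j. h j + e j)"
proof -
  let ?h = "\<lambda>j. h j + e j"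
  have "Q g ?h = Q g h + (\<Sum>j\<in>J. e j * (V g j)\<^sup>2)"
    by (simp add: Q_def distrib_right sum.distrib)
  then have c: "(Q g h)\<^sup>2 + 2 * Q g h * (\<Sum>j\<in>J. e j * (V g j)\<^sup>2) \<le> (Q g ?h)\<^sup>2"
    by (simp add: power2_sum)
  define E where "E = (\<Sum>i\<in>I. \<Sum>k\<in>I. g i * g k * (\<Sum>j\<in>J. h j * (\<zeta> i j * \<zeta> k j)) * (\<Sum>j\<in>J. e j * (\<zeta> i j * \<zeta> k j)))"
  have "2 * E = (\<Sum>i\<in>I. \<Sum>k\<in>I. g i * g k * (2 * (\<Sum>j\<in>J. h j * (\<zeta> i j * \<zeta> k j)) * (\<Sum>j\<in>J. e j * (\<zeta> i j * \<zeta> k j))))"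
    unfolding E_def by (simp only: sum_distrib_left[of 2 _ I]) (simp only: mult_ac)
  then have "box g h + 2 * E
     = (\<Sum>i\<in>I. \<Sum>k\<in>I. g i * g k * ((\<Sum>j\<in>J. h j * (\<zeta> i j * \<zeta> k j))\<^sup>2
        + 2 * (\<Sum>j\<in>J. h j * (\<zeta> i j * \<zeta> k j)) * (\<Sum>j\<in>J. e j * (\<zeta> i j * \<zeta> k j))))"
    unfolding box_altdef by (simp only: distrib_left sum.distrib)
  also have "\<dots> \<le> box g ?h"
    unfolding box_altdef distrib_right sum.distrib
    by (intro sum_mono mult_left_mono) (simp_all add: g power2_sum)
  finally show ?thesis
    unfolding T_sum E_def[symmetric] \<Phi>_def using c by linarith
qed

text \<open>Jensen's inequality in each coordinate, then Young's. With \<open>x\<close> and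
  \<open>z\<close> as in the proof, the three parts of \<open>\<Phi>\<close> contribute
  \<open>8 * x + z / 32\<close>, \<open>16 * x\<close> and \<open>z / 32\<close>.\<close>

lemma \<Phi>_bound:
  assumes g: "\<And>i. i \<in> I \<Longrightarrow> 0 \<le> g i" and h: "\<And>j. j \<in> J \<Longrightarrow> 0 \<le> h j"
    and g1: "(\<Sum>i\<in>I. g i) = 1" and h1: "(\<Sum>j\<in>J. h j) = 1"
  shows "\<Phi> g h \<le> (\<Sum>i\<in>I. \<Sum>j\<in>J. g i * h j * (24 * \<xi> i j ^ 4 + \<zeta> i j ^ 4 / 16))"
proof -
  define x where "x = (\<Sum>i\<in>I. \<Sum>j\<in>J. g i * h j * \<xi> i j ^ 4)"
  define z where "z = (\<Sum>i\<in>I. \<Sum>j\<in>J. g i * h j * \<zeta> i j ^ 4)"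
  have V4: "(\<Sum>j\<in>J. h j * V g j ^ 4) \<le> x"
  proof -
    have "(\<Sum>j\<in>J. h j * V g j ^ 4) \<le> (\<Sum>j\<in>J. h j * (\<Sum>i\<in>I. g i * \<xi> i j ^ 4))"
      unfolding V_def
      by (intro sum_mono mult_left_mono convex_combination_power fin g g1 h) auto
    also have "\<dots> = x"
      unfolding x_def sum_distrib_left by (subst sum.swap) (simp add: mult_ac)
    finally show ?thesis .
  qed
  have "\<Phi>\<^sub>1 g h \<le> (\<Sum>i\<in>I. g i * (\<Sum>j\<in>J. h j * (\<zeta> i j * V g j)\<^sup>2))"
    unfolding \<Phi>\<^sub>1_def L_def
    by (intro sum_mono mult_left_mono convex_combination_power fin g h h1) auto
  also have "\<dots> \<le> (\<Sum>i\<in>I. g i * (\<Sum>j\<in>J. h j * (\<zeta> i j ^ 4 / 32 + 8 * V g j ^ 4)))"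
  proof (intro sum_mono mult_left_mono g h)
    fix i j
    \<comment> \<open>The split a b \<le> a^2 / \<lambda> + \<lambda> b^2 / 4 for the two squared
      factors, again with \<lambda> = 32.\<close>
    have "0 \<le> ((\<zeta> i j)\<^sup>2 - 16 * (V g j)\<^sup>2)\<^sup>2" by simp
    then show "(\<zeta> i j * V g j)\<^sup>2 \<le> \<zeta> i j ^ 4 / 32 + 8 * V g j ^ 4"
      by (simp add: power2_diff power_mult_distrib)
  qed auto
  also have "\<dots> = z / 32 + 8 * ((\<Sum>i\<in>I. g i) * (\<Sum>j\<in>J. h j * V g j ^ 4))"
    unfolding z_def sum_product
    by (simp add: sum_divide_distrib sum_distrib_left sum.distrib[symmetric] algebra_simps)
  also have "\<dots> \<le> z / 32 + 8 * x" using V4 g1 by simp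
  finally have a: "\<Phi>\<^sub>1 g h \<le> z / 32 + 8 * x" .
  have "(Q g h)\<^sup>2 \<le> (\<Sum>j\<in>J. h j * ((V g j)\<^sup>2)\<^sup>2)"
    unfolding Q_def by (intro convex_combination_power fin h h1) auto
  then have c: "(Q g h)\<^sup>2 \<le> x" using V4 by simp
  have "box g h \<le> (\<Sum>j\<in>J. \<Sum>j'\<in>J. h j * h j' * (\<Sum>i\<in>I. g i * (\<zeta> i j * \<zeta> i j')\<^sup>2))"
    unfolding box_def W_def
    by (intro sum_mono mult_left_mono convex_combination_power fin g g1) (auto simp: h)
  also have "\<dots> \<le> (\<Sum>j\<in>J. \<Sum>j'\<in>J. h j * h j' * (\<Sum>i\<in>I. g i * ((\<zeta> i j ^ 4 + \<zeta> i j' ^ 4) / 2)))"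
  proof (intro sum_mono mult_left_mono g)
    fix i j j'
    have "0 \<le> ((\<zeta> i j)\<^sup>2 - (\<zeta> i j')\<^sup>2)\<^sup>2" by simp
    then show "(\<zeta> i j * \<zeta> i j')\<^sup>2 \<le> (\<zeta> i j ^ 4 + \<zeta> i j' ^ 4) / 2"
      by (simp add: power2_diff power_mult_distrib)
  qed (auto simp: h)
  also have "\<dots> = (\<Sum>j\<in>J. h j * (\<Sum>i\<in>I. g i * \<zeta> i j ^ 4)) * (\<Sum>j\<in>J. h j) / 2
       + (\<Sum>j\<in>J. h j) * (\<Sum>j\<in>J. h j * (\<Sum>i\<in>I. g i * \<zeta> i j ^ 4)) / 2"
  proof -
    define S where "S j = (\<Sum>i\<in>I. g i * \<zeta> i j ^ 4)" for j
    have S: "(\<Sum>i\<in>I. g i * ((\<zeta> i j ^ 4 + \<zeta> i j' ^ 4) / 2)) = (S j + S j') / 2" for j j'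
      unfolding S_def by (simp add: distrib_left sum.distrib add_divide_distrib sum_divide_distrib)
    show ?thesis
      unfolding S S_def[symmetric] sum_product
      by (simp add: distrib_left sum.distrib add_divide_distrib sum_divide_distrib mult_ac)
  qed
  also have "(\<Sum>j\<in>J. h j * (\<Sum>i\<in>I. g i * \<zeta> i j ^ 4)) = z"
    unfolding z_def sum_distrib_left by (subst sum.swap) (simp add: mult_ac)
  finally have b: "box g h \<le> z" using h1 by simp
  have "(\<Sum>i\<in>I. \<Sum>j\<in>J. g i * h j * (24 * \<xi> i j ^ 4 + \<zeta> i j ^ 4 / 16)) = 24 * x + z / 16"
    unfolding x_def z_def sum_divide_distrib sum_distrib_left sum.distrib[symmetric]
    by (intro sum.cong refl) (simp add: algebra_simps)
  then show ?thesis
    unfolding \<Phi>_def using a b c by linarith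
qed

end

section \<open>Conditional distributions\<close>

text \<open>For finitely valued labels all quantities are polynomials in bounded functions. Carrying
  a pointwise bound along with measurability makes their integrability automatic over every
  sub-sigma-algebra.\<close>

definition bounded_measurable :: "'a measure \<Rightarrow> ('a \<Rightarrow> real) \<Rightarrow> bool" where
  "bounded_measurable N f \<longleftrightarrow> f \<in> borel_measurable N \<and> (\<exists>C. \<forall>\<omega>\<in>space N. \<bar>f \<omega>\<bar> \<le> C)"

lemma bounded_measurableI:
  "f \<in> borel_measurable N \<Longrightarrow> (\<And>\<omega>. \<omega> \<in> space N \<Longrightarrow> \<bar>f \<omega>\<bar> \<le> C) \<Longrightarrow> bounded_measurable N f"
  by (auto simp: bounded_measurable_def)

lemma bounded_measurable_cong:
  "bounded_measurable N f \<Longrightarrow> (\<And>\<omega>. \<omega> \<in> space N \<Longrightarrow> f \<omega> = f' \<omega>) \<Longrightarrow> bounded_measurable N f'"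
  unfolding bounded_measurable_def by (auto simp: measurable_cong[of N f f'])

lemma bounded_measurable_measurable: "bounded_measurable N f \<Longrightarrow> f \<in> borel_measurable N"
  by (simp add: bounded_measurable_def)

named_theorems bounded_intros

lemma bounded_measurable_const [bounded_intros]: "bounded_measurable N (\<lambda>_. c)"
  by (rule bounded_measurableI[of _ _ "\<bar>c\<bar>"]) auto

lemma bounded_measurable_add [bounded_intros]:
  assumes "bounded_measurable N f" "bounded_measurable N g"
  shows "bounded_measurable N (\<lambda>\<omega>. f \<omega> + g \<omega>)"
proof -
  obtain C D where "\<forall>\<omega>\<in>space N. \<bar>f \<omega>\<bar> \<le> C" "\<forall>\<omega>\<in>space N. \<bar>g \<omega>\<bar> \<le> D"
    and [measurable]: "f \<in> borel_measurable N" "g \<in> borel_measurable N"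
    using assms by (auto simp: bounded_measurable_def)
  then show ?thesis
    by (intro bounded_measurableI[of _ _ "C + D"]) (auto intro: order_trans[OF abs_triangle_ineq] add_mono)
qed

lemma bounded_measurable_mult [bounded_intros]:
  assumes "bounded_measurable N f" "bounded_measurable N g"
  shows "bounded_measurable N (\<lambda>\<omega>. f \<omega> * g \<omega>)"
proof -
  obtain C D where CD: "\<forall>\<omega>\<in>space N. \<bar>f \<omega>\<bar> \<le> C" "\<forall>\<omega>\<in>space N. \<bar>g \<omega>\<bar> \<le> D"
    and [measurable]: "f \<in> borel_measurable N" "g \<in> borel_measurable N"
    using assms by (auto simp: bounded_measurable_def)
  show ?thesis
  proof (rule bounded_measurableI[of _ _ "C * D"])
    fix \<omega> assume "\<omega> \<in> space N"
    with CD have "\<bar>f \<omega>\<bar> \<le> C" "\<bar>g \<omega>\<bar> \<le> D" by auto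
    then show "\<bar>f \<omega> * g \<omega>\<bar> \<le> C * D"
      unfolding abs_mult by (intro mult_mono) auto
  qed measurable
qed

lemma bounded_measurable_power [bounded_intros]:
  "bounded_measurable N f \<Longrightarrow> bounded_measurable N (\<lambda>\<omega>. f \<omega> ^ m)"
  by (induction m) (auto intro: bounded_intros)

lemma bounded_measurable_diff [bounded_intros]:
  assumes "bounded_measurable N f" "bounded_measurable N g"
  shows "bounded_measurable N (\<lambda>\<omega>. f \<omega> - g \<omega>)"
  using bounded_measurable_add[OF assms(1) bounded_measurable_mult[OF bounded_measurable_const[of _ "-1"] assms(2)]]
  by simp

lemma bounded_measurable_divide [bounded_intros]:
  assumes "bounded_measurable N f"
  shows "bounded_measurable N (\<lambda>\<omega>. f \<omega> / c)"
  using bounded_measurable_mult[OF assms bounded_measurable_const[of _ "1 / c"]] by simp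

lemma bounded_measurable_sum [bounded_intros]:
  assumes "\<And>i. i \<in> S \<Longrightarrow> bounded_measurable N (f i)"
  shows "bounded_measurable N (\<lambda>\<omega>. \<Sum>i\<in>S. f i \<omega>)"
  using assms by (induction S rule: infinite_finite_induct) (auto intro: bounded_intros)

lemma bounded_measurable_subalgebra:
  "subalgebra N' N \<Longrightarrow> bounded_measurable N f \<Longrightarrow> bounded_measurable N' f"
  by (auto simp: bounded_measurable_def subalgebra_def intro: measurable_from_subalg[unfolded subalgebra_def])

context bellman
begin

lemma
  assumes g: "\<And>i. i \<in> I \<Longrightarrow> bounded_measurable N (\<lambda>\<omega>. g \<omega> i)"
  shows bounded_measurable_V: "bounded_measurable N (\<lambda>\<omega>. V (g \<omega>) j)"
    and bounded_measurable_W: "bounded_measurable N (\<lambda>\<omega>. W (g \<omega>) j j')"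
  unfolding V_def W_def by (intro bounded_intros g; assumption)+

context
  fixes N :: "'a measure" and g :: "'a \<Rightarrow> 'i \<Rightarrow> real" and h :: "'a \<Rightarrow> 'j \<Rightarrow> real"
  assumes g: "\<And>i. i \<in> I \<Longrightarrow> bounded_measurable N (\<lambda>\<omega>. g \<omega> i)"
    and h: "\<And>j. j \<in> J \<Longrightarrow> bounded_measurable N (\<lambda>\<omega>. h \<omega> j)"
begin

lemma bounded_measurable_L: "bounded_measurable N (\<lambda>\<omega>. L (g \<omega>) (h \<omega>) i)"
  unfolding L_def by (intro bounded_intros bounded_measurable_V g h)

lemma bounded_measurable_Q: "bounded_measurable N (\<lambda>\<omega>. Q (g \<omega>) (h \<omega>))"
  unfolding Q_def by (intro bounded_intros bounded_measurable_V g h)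

lemma bounded_measurable_\<Phi>\<^sub>1: "bounded_measurable N (\<lambda>\<omega>. \<Phi>\<^sub>1 (g \<omega>) (h \<omega>))"
  unfolding \<Phi>\<^sub>1_def by (intro bounded_intros bounded_measurable_L g)

lemma bounded_measurable_\<Phi>: "bounded_measurable N (\<lambda>\<omega>. \<Phi> (g \<omega>) (h \<omega>))"
  unfolding \<Phi>_def box_def
  by (intro bounded_intros bounded_measurable_\<Phi>\<^sub>1 bounded_measurable_Q bounded_measurable_W g h)

lemma bounded_measurable_R: "bounded_measurable N (\<lambda>\<omega>. R (g \<omega>) (h \<omega>) i)"
  unfolding R_def
  by (intro bounded_intros bounded_measurable_L bounded_measurable_Q bounded_measurable_V
      bounded_measurable_W g h)

lemma bounded_measurable_T: "bounded_measurable N (\<lambda>\<omega>. T (g \<omega>) (h \<omega>) j)"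
  unfolding T_def by (intro bounded_intros bounded_measurable_Q bounded_measurable_V g h)

end

end

text \<open>The inequality of arithmetic and geometric means, which stands in for Hoelder's
  inequality with four exponents 4.\<close>

lemma abs_prod4_le:
  fixes a b c d :: real
  shows "\<bar>a * b * c * d\<bar> \<le> (a ^ 4 + b ^ 4 + c ^ 4 + d ^ 4) / 4"
proof -
  have 1: "\<bar>u * v\<bar> \<le> (u\<^sup>2 + v\<^sup>2) / 2" for u v :: real
  proof -
    have "0 \<le> (\<bar>u\<bar> - \<bar>v\<bar>)\<^sup>2" by simp
    then show ?thesis by (simp add: power2_diff abs_mult)
  qed
  have 2: "(u * v)\<^sup>2 \<le> (u ^ 4 + v ^ 4) / 2" for u v :: real
    using 1[of "u\<^sup>2" "v\<^sup>2"] by (simp add: power_mult_distrib)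
  show ?thesis
    using 1[of "a * b" "c * d"] 2[of a b] 2[of c d] by (simp add: mult.assoc)
qed

section \<open>Fourth moments and versions of conditional expectations\<close>

context prob_space
begin

lemma bounded_measurable_integrable:
  assumes "bounded_measurable M f"
  shows "integrable M f"
proof -
  obtain C where "\<forall>\<omega>\<in>space M. \<bar>f \<omega>\<bar> \<le> C" "f \<in> borel_measurable M"
    using assms by (auto simp: bounded_measurable_def)
  then show ?thesis
    by (intro integrable_const_bound[of _ C]) auto
qed

lemma integrable_bounded_mult:
  assumes "bounded_measurable M f" and g: "integrable M g"
  shows "integrable M (\<lambda>\<omega>. f \<omega> * g \<omega>)"
proof -
  obtain C where C: "\<And>\<omega>. \<omega> \<in> space M \<Longrightarrow> \<bar>f \<omega>\<bar> \<le> C" and [measurable]: "f \<in> borel_measurable M"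
    using assms by (auto simp: bounded_measurable_def)
  have "integrable M (\<lambda>\<omega>. C * g \<omega>)" using g by simp
  then show ?thesis
  proof (rule Bochner_Integration.integrable_bound)
    show "AE \<omega> in M. norm (f \<omega> * g \<omega>) \<le> norm (C * g \<omega>)"
      using C by (intro AE_I2) (auto simp: abs_mult intro!: mult_right_mono order_trans[OF C abs_ge_self])
  qed (use g in measurable)
qed

lemma integrable_prod4:
  assumes [measurable]: "a \<in> borel_measurable M" "b \<in> borel_measurable M"
    "c \<in> borel_measurable M" "d \<in> borel_measurable M"
    and "integrable M (\<lambda>\<omega>. a \<omega> ^ 4)" "integrable M (\<lambda>\<omega>. b \<omega> ^ 4)"
    "integrable M (\<lambda>\<omega>. c \<omega> ^ 4)" "integrable M (\<lambda>\<omega>. d \<omega> ^ 4)"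
  shows "integrable M (\<lambda>\<omega>. a \<omega> * b \<omega> * c \<omega> * d \<omega> :: real)"
proof (rule Bochner_Integration.integrable_bound)
  show "integrable M (\<lambda>\<omega>. (a \<omega> ^ 4 + b \<omega> ^ 4 + c \<omega> ^ 4 + d \<omega> ^ 4) / 4)"
    using assms by auto
  show "AE \<omega> in M. norm (a \<omega> * b \<omega> * c \<omega> * d \<omega>) \<le> norm ((a \<omega> ^ 4 + b \<omega> ^ 4 + c \<omega> ^ 4 + d \<omega> ^ 4) / 4)"
    using abs_prod4_le by (intro AE_I2) (auto intro: order_trans[OF _ abs_ge_self])
qed measurable

lemma
  assumes "f \<in> borel_measurable M" "integrable M (\<lambda>\<omega>. f \<omega> ^ 4 :: real)"
  shows integrable_power4: "integrable M f"
    and integrable_power4_square: "integrable M (\<lambda>\<omega>. (f \<omega>)\<^sup>2)"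
  using integrable_prod4[of f "\<lambda>_. 1" "\<lambda>_. 1" "\<lambda>_. 1"] integrable_prod4[of f f "\<lambda>_. 1" "\<lambda>_. 1"] assms
  by (simp_all add: power2_eq_square)

lemma subalgebra_sigma_finite:
  assumes "subalgebra M N"
  shows "sigma_finite_subalgebra M N"
proof -
  interpret finite_measure_subalgebra M N by standard (rule assms)
  show ?thesis by standard
qed

text \<open>Conditional Jensen for the fourth power. An arbitrary version \<open>X'\<close> is
  allowed because the values of a martingale agree with conditional expectations only almost
  everywhere.\<close>

lemma cond_exp_power4:
  assumes "subalgebra M N" and [measurable]: "X \<in> borel_measurable M" "X' \<in> borel_measurable M"
    and X4: "integrable M (\<lambda>\<omega>. X \<omega> ^ 4)" and ae: "AE \<omega> in M. real_cond_exp M N X \<omega> = X' \<omega>"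
  shows "integrable M (\<lambda>\<omega>. X' \<omega> ^ 4)" and "(\<integral>\<omega>. X' \<omega> ^ 4 \<partial>M) \<le> (\<integral>\<omega>. X \<omega> ^ 4 \<partial>M)"
proof -
  interpret sigma_finite_subalgebra M N by (rule subalgebra_sigma_finite) fact
  have X: "integrable M X" using X4 by (rule integrable_power4[rotated]) simp
  have "convex_on UNIV (\<lambda>x::real. x ^ 4)" by (rule convex_power_even) simp
  note J = real_cond_exp_jensens_inequality(2)[OF X _ _ X4 this]
  have le: "AE \<omega> in M. X' \<omega> ^ 4 \<le> real_cond_exp M N (\<lambda>\<omega>. X \<omega> ^ 4) \<omega>"
    using J ae by auto
  have i: "integrable M (real_cond_exp M N (\<lambda>\<omega>. X \<omega> ^ 4))"
    using X4 by (rule real_cond_exp_int)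
  show "integrable M (\<lambda>\<omega>. X' \<omega> ^ 4)"
    using i by (rule Bochner_Integration.integrable_bound) (use le in \<open>auto intro: order_trans[OF _ abs_ge_self]\<close>)
  then have "(\<integral>\<omega>. X' \<omega> ^ 4 \<partial>M) \<le> (\<integral>\<omega>. real_cond_exp M N (\<lambda>\<omega>. X \<omega> ^ 4) \<omega> \<partial>M)"
    using i le by (rule integral_mono_AE)
  also have "\<dots> = (\<integral>\<omega>. X \<omega> ^ 4 \<partial>M)"
    using X4 by (rule real_cond_exp_int)
  finally show "(\<integral>\<omega>. X' \<omega> ^ 4 \<partial>M) \<le> (\<integral>\<omega>. X \<omega> ^ 4 \<partial>M)" .
qed

text \<open>Integrability is asked of the product, so that the test function \<open>D\<close> may be
  unbounded, for instance a value of the martingale itself.\<close>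

lemma cond_exp_pairing:
  assumes "subalgebra M N" and [measurable]: "X \<in> borel_measurable M" "X' \<in> borel_measurable M"
    and D: "D \<in> borel_measurable N" "integrable M (\<lambda>\<omega>. D \<omega> * X \<omega>)"
    and ae: "AE \<omega> in M. real_cond_exp M N X \<omega> = X' \<omega>"
  shows "(\<integral>\<omega>. D \<omega> * X' \<omega> \<partial>M) = (\<integral>\<omega>. D \<omega> * X \<omega> \<partial>M)"
proof -
  interpret sigma_finite_subalgebra M N by (rule subalgebra_sigma_finite) fact
  have [measurable]: "D \<in> borel_measurable M"
    using assms(1) D(1) by (rule measurable_from_subalg)
  have "(\<integral>\<omega>. D \<omega> * X' \<omega> \<partial>M) = (\<integral>\<omega>. D \<omega> * real_cond_exp M N X \<omega> \<partial>M)"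
    using ae by (intro integral_cong_AE) auto
  then show ?thesis
    using real_cond_exp_intg(2)[OF D(2) D(1)] by simp
qed

text \<open>\<open>N\<close> is the sigma-algebra of the conditioning, and \<open>N\<^sub>0\<close>
  that of the coordinate carrying \<open>\<phi>\<close>. Measurability for \<open>N\<^sub>0\<close>
  is what makes the conditional law known to the whole other filtration. Probability vectors at
  every point, not almost everywhere, let the pointwise inequalities for \<open>\<Phi>\<close> apply
  directly.\<close>

definition conditional_distribution ::
  "'a measure \<Rightarrow> 'a measure \<Rightarrow> ('a \<Rightarrow> nat) \<Rightarrow> ('a \<Rightarrow> nat \<Rightarrow> real) \<Rightarrow> bool" where
  "conditional_distribution N\<^sub>0 N \<phi> g \<longleftrightarrow>
     (\<forall>i. (\<lambda>\<omega>. g \<omega> i) \<in> borel_measurable N\<^sub>0 \<and> (\<lambda>\<omega>. g \<omega> i) \<in> borel_measurable N) \<and>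
     (\<forall>\<omega>\<in>space M. (\<forall>i\<in>\<phi> ` space M. 0 \<le> g \<omega> i) \<and> (\<Sum>i\<in>\<phi> ` space M. g \<omega> i) = 1) \<and>
     (\<forall>i\<in>\<phi> ` space M. \<forall>D. D \<in> borel_measurable N \<longrightarrow> integrable M D \<longrightarrow>
        (\<integral>\<omega>. D \<omega> * g \<omega> i \<partial>M) = (\<integral>\<omega>. D \<omega> * of_bool (\<phi> \<omega> = i) \<partial>M))"

text \<open>Changing versions of the conditional probabilities on a null set makes them a probability
  vector everywhere.\<close>

lemma finite_conditional_distribution:
  fixes \<phi> :: "'a \<Rightarrow> nat"
  assumes N: "subalgebra M N" and N0: "subalgebra M N\<^sub>0"
    and [measurable]: "\<phi> \<in> N\<^sub>0 \<rightarrow>\<^sub>M count_space UNIV" and fin: "finite (\<phi> ` space M)"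
    and ver: "\<And>E. E \<in> sets N\<^sub>0 \<Longrightarrow> \<exists>g. g \<in> borel_measurable N\<^sub>0 \<and> g \<in> borel_measurable N \<and>
      (AE \<omega> in M. real_cond_exp M N (indicator E) \<omega> = g \<omega>)"
  shows "\<exists>g. conditional_distribution N\<^sub>0 N \<phi> g"
proof -
  interpret sigma_finite_subalgebra M N by (rule subalgebra_sigma_finite) fact
  have sp: "space N\<^sub>0 = space M" "space N = space M"
    using N N0 by (auto simp: subalgebra_def)
  define I where "I = \<phi> ` space M"
  define a :: "nat \<Rightarrow> 'a \<Rightarrow> real" where "a i \<omega> = of_bool (\<phi> \<omega> = i)" for i \<omega>
  have a0[measurable]: "a i \<in> borel_measurable N\<^sub>0" for i
    unfolding a_def by measurable
  have aM[measurable]: "a i \<in> borel_measurable M" for i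
    using N0 a0 by (rule measurable_from_subalg)
  have ai: "integrable M (a i)" for i
    by (rule integrable_const_bound[of _ 1]) (auto simp: a_def)
  have "\<exists>g. g \<in> borel_measurable N\<^sub>0 \<and> g \<in> borel_measurable N \<and> (AE \<omega> in M. real_cond_exp M N (a i) \<omega> = g \<omega>)" for i
  proof -
    let ?E = "{\<omega>\<in>space N\<^sub>0. \<phi> \<omega> = i}"
    have E: "?E \<in> sets N\<^sub>0" by measurable
    have "?E \<in> sets M" using E N0 unfolding subalgebra_def by blast
    then have "AE \<omega> in M. real_cond_exp M N (a i) \<omega> = real_cond_exp M N (indicator ?E) \<omega>"
      by (intro real_cond_exp_cong AE_I2) (auto simp: a_def sp indicator_def)
    with ver[OF E] show ?thesis by fastforce
  qed
  then obtain g where g0[measurable]: "\<And>i. g i \<in> borel_measurable N\<^sub>0" "\<And>i. g i \<in> borel_measurable N"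
    and gae: "\<And>i. AE \<omega> in M. real_cond_exp M N (a i) \<omega> = g i \<omega>"
    by metis
  obtain i0 where i0: "i0 \<in> I" using not_empty by (auto simp: I_def)
  \<comment> \<open>\<open>good\<close> is expressed through the versions \<open>g i\<close> alone
    and is thus measurable for both \<open>N\<^sub>0\<close> and \<open>N\<close>; replacing the bad
    values by the point mass at \<open>i0\<close> keeps both measurabilities.\<close>
  define good where "good \<omega> \<longleftrightarrow> (\<forall>i\<in>I. 0 \<le> g i \<omega>) \<and> (\<Sum>i\<in>I. g i \<omega>) = 1" for \<omega>
  have "AE \<omega> in M. \<forall>i\<in>I. 0 \<le> g i \<omega>"
  proof (rule AE_finite_allI)
    show "finite I" using fin by (simp add: I_def)
    fix i
    have "AE \<omega> in M. 0 \<le> real_cond_exp M N (a i) \<omega>"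
      by (rule real_cond_exp_pos) (auto simp: a_def)
    with gae[of i] show "AE \<omega> in M. 0 \<le> g i \<omega>" by auto
  qed
  moreover have "AE \<omega> in M. (\<Sum>i\<in>I. g i \<omega>) = 1"
  proof -
    have "AE \<omega> in M. real_cond_exp M N (\<lambda>\<omega>. \<Sum>i\<in>I. a i \<omega>) \<omega> = (\<Sum>i\<in>I. real_cond_exp M N (a i) \<omega>)"
      by (rule real_cond_exp_sum) (rule ai)
    moreover have "AE \<omega> in M. real_cond_exp M N (\<lambda>\<omega>. \<Sum>i\<in>I. a i \<omega>) \<omega> = real_cond_exp M N (\<lambda>_. 1) \<omega>"
    proof (rule real_cond_exp_cong)
      show "AE \<omega> in M. (\<Sum>i\<in>I. a i \<omega>) = 1"
        using fin by (intro AE_I2) (auto simp: a_def I_def of_bool_def)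
    qed auto
    moreover have "AE \<omega> in M. real_cond_exp M N (\<lambda>_. 1) \<omega> = 1"
      by (rule real_cond_exp_F_meas) auto
    moreover have "AE \<omega> in M. \<forall>i\<in>I. real_cond_exp M N (a i) \<omega> = g i \<omega>"
      using fin gae by (intro AE_finite_allI) (auto simp: I_def)
    ultimately show ?thesis by eventually_elim auto
  qed
  ultimately have good: "AE \<omega> in M. good \<omega>" by (auto simp: good_def)
  define g' where "g' \<omega> i = (if good \<omega> then g i \<omega> else of_bool (i = i0))" for \<omega> i
  have [measurable]: "Measurable.pred N\<^sub>0 good" "Measurable.pred N good"
    using fin unfolding good_def I_def[symmetric] by measurable
  have m[measurable]: "(\<lambda>\<omega>. g' \<omega> i) \<in> borel_measurable N\<^sub>0" "(\<lambda>\<omega>. g' \<omega> i) \<in> borel_measurable N" for i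
    unfolding g'_def by measurable
  have mM[measurable]: "(\<lambda>\<omega>. g' \<omega> i) \<in> borel_measurable M" for i
    using N m(2) by (rule measurable_from_subalg)
  show ?thesis
    unfolding conditional_distribution_def I_def[symmetric]
  proof (intro exI[of _ g'] conjI allI ballI impI)
    fix i D assume D: "D \<in> borel_measurable N" "integrable M (D :: 'a \<Rightarrow> real)"
    have "bounded_measurable M (a i)" 
      by (rule bounded_measurableI[of _ _ 1]) (auto simp: a_def)
    then have "integrable M (\<lambda>\<omega>. a i \<omega> * D \<omega>)"
      using D(2) by (rule integrable_bounded_mult)
    then have i: "integrable M (\<lambda>\<omega>. D \<omega> * a i \<omega>)"
      by (simp add: mult.commute)
    have "AE \<omega> in M. real_cond_exp M N (a i) \<omega> = g' \<omega> i"
      using gae[of i] good by eventually_elim (simp add: g'_def)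
    from cond_exp_pairing[OF N aM mM D(1) i this]
    show "(\<integral>\<omega>. D \<omega> * g' \<omega> i \<partial>M) = (\<integral>\<omega>. D \<omega> * of_bool (\<phi> \<omega> = i) \<partial>M)"
      by (simp add: a_def)
  next
    fix \<omega> i assume "i \<in> I"
    then show "0 \<le> g' \<omega> i" by (auto simp: g'_def good_def)
  next
    fix \<omega>
    show "(\<Sum>i\<in>I. g' \<omega> i) = 1"
    proof (cases "good \<omega>")
      case False
      then show ?thesis using fin i0 by (simp add: g'_def I_def of_bool_def)
    qed (simp add: g'_def good_def)
  qed (use m in auto)
qed

end

section \<open>Two filtrations\<close>

text \<open>\<open>A\<close> and \<open>B\<close> are the sigma-algebras of the first and the second coordinate. The only trace of
  the product structure is that conditioning an \<open>A\<close>-measurable event on \<open>F k\<close> gives an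
  \<open>A\<close>-measurable function, and likewise for \<open>B\<close> and \<open>G k\<close>. This makes the two coordinates
  interchangeable.\<close>

locale two_filtrations = prob_space M for M :: "'a measure" +
  fixes F G :: "nat \<Rightarrow> 'a measure" and A B :: "'a measure"
  assumes F: "\<And>k. subalgebra M (F k)" and F_mono: "\<And>k. subalgebra (F (Suc k)) (F k)"
    and G: "\<And>k. subalgebra M (G k)" and G_mono: "\<And>k. subalgebra (G (Suc k)) (G k)"
    and A_G: "\<And>k. subalgebra (G k) A" and B_F: "\<And>k. subalgebra (F k) B"
    and cond_A: "\<And>k E. E \<in> sets A \<Longrightarrow> \<exists>g. g \<in> borel_measurable A \<and> g \<in> borel_measurable (F k) \<and>
      (AE \<omega> in M. real_cond_exp M (F k) (indicator E) \<omega> = g \<omega>)"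
    and cond_B: "\<And>k E. E \<in> sets B \<Longrightarrow> \<exists>h. h \<in> borel_measurable B \<and> h \<in> borel_measurable (G k) \<and>
      (AE \<omega> in M. real_cond_exp M (G k) (indicator E) \<omega> = h \<omega>)"
    and generates: "sets M = sigma_sets (space M) {E \<inter> E' | E E'. E \<in> sets A \<and> E' \<in> sets B}"
begin

lemma A: "subalgebra M A" and B: "subalgebra M B"
  using A_G[of 0] G[of 0] B_F[of 0] F[of 0] by (auto simp: subalgebra_def)

lemma space_eq: "space A = space M" "space B = space M" "space (F k) = space M" "space (G k) = space M"
  using A B F[of k] G[of k] by (auto simp: subalgebra_def)

end

section \<open>Conditional laws of labels as martingales, and the expected Bellman function\<close>

locale labelled = two_filtrations M F G A B + bellman "\<phi> ` space M" "\<psi> ` space M" \<xi> \<zeta>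
  for M :: "'a measure" and F G :: "nat \<Rightarrow> 'a measure" and A B :: "'a measure"
    and \<phi> \<psi> :: "'a \<Rightarrow> nat" and \<xi> \<zeta> :: "nat \<Rightarrow> nat \<Rightarrow> real" +
  fixes g h :: "nat \<Rightarrow> 'a \<Rightarrow> nat \<Rightarrow> real"
  assumes \<phi>[measurable]: "\<phi> \<in> A \<rightarrow>\<^sub>M count_space UNIV" and \<psi>[measurable]: "\<psi> \<in> B \<rightarrow>\<^sub>M count_space UNIV"
    and g: "\<And>k. conditional_distribution A (F k) \<phi> (g k)"
    and h: "\<And>k. conditional_distribution B (G k) \<psi> (h k)"
begin

abbreviation I where "I \<equiv> \<phi> ` space M"
abbreviation J where "J \<equiv> \<psi> ` space M"

lemma g_meas: "(\<lambda>\<omega>. g k \<omega> i) \<in> borel_measurable A" "(\<lambda>\<omega>. g k \<omega> i) \<in> borel_measurable (F k)"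
  and g_nonneg: "\<omega> \<in> space M \<Longrightarrow> i \<in> I \<Longrightarrow> 0 \<le> g k \<omega> i"
  and g_sum: "\<omega> \<in> space M \<Longrightarrow> (\<Sum>i\<in>I. g k \<omega> i) = 1"
  and g_cond: "i \<in> I \<Longrightarrow> D \<in> borel_measurable (F k) \<Longrightarrow> integrable M D \<Longrightarrow>
      (\<integral>\<omega>. D \<omega> * g k \<omega> i \<partial>M) = (\<integral>\<omega>. D \<omega> * of_bool (\<phi> \<omega> = i) \<partial>M)"
  using g[of k] unfolding conditional_distribution_def by blast+

lemma h_meas: "(\<lambda>\<omega>. h k \<omega> j) \<in> borel_measurable B" "(\<lambda>\<omega>. h k \<omega> j) \<in> borel_measurable (G k)"
  and h_nonneg: "\<omega> \<in> space M \<Longrightarrow> j \<in> J \<Longrightarrow> 0 \<le> h k \<omega> j"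
  and h_sum: "\<omega> \<in> space M \<Longrightarrow> (\<Sum>j\<in>J. h k \<omega> j) = 1"
  and h_cond: "j \<in> J \<Longrightarrow> D \<in> borel_measurable (G k) \<Longrightarrow> integrable M D \<Longrightarrow>
      (\<integral>\<omega>. D \<omega> * h k \<omega> j \<partial>M) = (\<integral>\<omega>. D \<omega> * of_bool (\<psi> \<omega> = j) \<partial>M)"
  using h[of k] unfolding conditional_distribution_def by blast+

lemma bounded_g:
  assumes "i \<in> I"
  shows "bounded_measurable A (\<lambda>\<omega>. g k \<omega> i)" "bounded_measurable (F k) (\<lambda>\<omega>. g k \<omega> i)"
proof -
  have "\<bar>g k \<omega> i\<bar> \<le> 1" if "\<omega> \<in> space M" for \<omega>
    using member_le_sum[of i I "g k \<omega>"] g_nonneg[OF that] g_sum[OF that, of k] fin(1) assms by auto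
  then show "bounded_measurable A (\<lambda>\<omega>. g k \<omega> i)" "bounded_measurable (F k) (\<lambda>\<omega>. g k \<omega> i)"
    by (auto intro!: bounded_measurableI[of _ _ 1] g_meas simp: space_eq)
qed

lemma bounded_h:
  assumes "j \<in> J"
  shows "bounded_measurable B (\<lambda>\<omega>. h k \<omega> j)" "bounded_measurable (G k) (\<lambda>\<omega>. h k \<omega> j)"
proof -
  have "\<bar>h k \<omega> j\<bar> \<le> 1" if "\<omega> \<in> space M" for \<omega>
    using member_le_sum[of j J "h k \<omega>"] h_nonneg[OF that] h_sum[OF that, of k] fin(2) assms by auto
  then show "bounded_measurable B (\<lambda>\<omega>. h k \<omega> j)" "bounded_measurable (G k) (\<lambda>\<omega>. h k \<omega> j)"
    by (auto intro!: bounded_measurableI[of _ _ 1] h_meas simp: space_eq)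
qed

text \<open>Here the time indices decouple: \<open>g k\<close> is \<open>A\<close>-measurable, hence
  known to \<open>G l\<close> for every \<open>l\<close>, and \<open>h k\<close> is likewise known
  to every \<open>F l\<close>.\<close>

lemma bounded_gh_G: "i \<in> I \<Longrightarrow> bounded_measurable (G l) (\<lambda>\<omega>. g k \<omega> i)"
    "j \<in> J \<Longrightarrow> bounded_measurable (F l) (\<lambda>\<omega>. h k \<omega> j)"
  using bounded_g(1) bounded_h(1) A_G B_F bounded_measurable_subalgebra by blast+

lemma bounded_gh_M: "i \<in> I \<Longrightarrow> bounded_measurable M (\<lambda>\<omega>. g k \<omega> i)"
    "j \<in> J \<Longrightarrow> bounded_measurable M (\<lambda>\<omega>. h k \<omega> j)"
  using bounded_g(1) bounded_h(1) A B bounded_measurable_subalgebra by blast+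

lemma bounded_of_bool:
  "bounded_measurable A (\<lambda>\<omega>. of_bool (\<phi> \<omega> = i))" "bounded_measurable (G l) (\<lambda>\<omega>. of_bool (\<phi> \<omega> = i))"
  "bounded_measurable M (\<lambda>\<omega>. of_bool (\<phi> \<omega> = i))"
  "bounded_measurable B (\<lambda>\<omega>. of_bool (\<psi> \<omega> = j))" "bounded_measurable (F l) (\<lambda>\<omega>. of_bool (\<psi> \<omega> = j))"
  "bounded_measurable M (\<lambda>\<omega>. of_bool (\<psi> \<omega> = j))"
proof -
  show 1: "bounded_measurable A (\<lambda>\<omega>. of_bool (\<phi> \<omega> = i))"
    by (rule bounded_measurableI[of _ _ 1]) auto
  show 2: "bounded_measurable B (\<lambda>\<omega>. of_bool (\<psi> \<omega> = j))"
    by (rule bounded_measurableI[of _ _ 1]) auto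
  show "bounded_measurable (G l) (\<lambda>\<omega>. of_bool (\<phi> \<omega> = i))" "bounded_measurable M (\<lambda>\<omega>. of_bool (\<phi> \<omega> = i))"
    "bounded_measurable (F l) (\<lambda>\<omega>. of_bool (\<psi> \<omega> = j))" "bounded_measurable M (\<lambda>\<omega>. of_bool (\<psi> \<omega> = j))"
    using 1 2 A_G B_F A B bounded_measurable_subalgebra by blast+
qed

lemma bounded_measurable_label:
  "bounded_measurable M (\<lambda>\<omega>. f (\<phi> \<omega>) (\<psi> \<omega>))"
proof -
  have [measurable]: "\<phi> \<in> M \<rightarrow>\<^sub>M count_space UNIV" "\<psi> \<in> M \<rightarrow>\<^sub>M count_space UNIV"
    using measurable_from_subalg[OF A \<phi>] measurable_from_subalg[OF B \<psi>] by auto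
  have "finite ((\<lambda>(i, j). \<bar>f i j\<bar>) ` (I \<times> J))" using fin by simp
  then show ?thesis
    by (intro bounded_measurableI[of _ _ "Max ((\<lambda>(i, j). \<bar>f i j\<bar>) ` (I \<times> J))"] Max_ge) auto
qed

lemma sum_of_bool:
  "\<omega> \<in> space M \<Longrightarrow> (\<Sum>i\<in>I. of_bool (\<phi> \<omega> = i) * f i) = (f (\<phi> \<omega>) :: real)"
  "\<omega> \<in> space M \<Longrightarrow> (\<Sum>j\<in>J. of_bool (\<psi> \<omega> = j) * f j) = (f (\<psi> \<omega>) :: real)"
  using fin by (simp_all add: of_bool_def if_distrib[where f = "\<lambda>x. x * _"] cong: if_cong)

text \<open>\<open>D i\<close> is measurable for \<open>F k\<close> and for
  \<open>F (Suc k)\<close>, so \<open>g k\<close> and \<open>g (Suc k)\<close> can both be exchanged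
  for the same indicator. This disposes of the first-order term of
  \<open>\<Phi>_step_g\<close>.\<close>

lemma integral_step_g:
  assumes D: "\<And>i. i \<in> I \<Longrightarrow> bounded_measurable (F k) (D i)"
  shows "(\<integral>\<omega>. (\<Sum>i\<in>I. (g (Suc k) \<omega> i - g k \<omega> i) * D i \<omega>) \<partial>M) = 0"
proof -
  have i: "integrable M (\<lambda>\<omega>. D i \<omega> * g l \<omega> i)" if "i \<in> I" for i l
    using bounded_measurable_subalgebra[OF F D[OF that]] bounded_gh_M(1)[OF that]
    by (intro bounded_measurable_integrable bounded_intros)
  have "(\<integral>\<omega>. D i \<omega> * g (Suc k) \<omega> i \<partial>M) = (\<integral>\<omega>. D i \<omega> * g k \<omega> i \<partial>M)" if "i \<in> I" for i
    using g_cond[OF that, of "D i" k] g_cond[OF that, of "D i" "Suc k"]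
      bounded_measurable_measurable[OF D[OF that]]
      bounded_measurable_measurable[OF bounded_measurable_subalgebra[OF F_mono D[OF that]]]
      bounded_measurable_integrable[OF bounded_measurable_subalgebra[OF F D[OF that]]]
    by simp
  then have "(\<integral>\<omega>. (g (Suc k) \<omega> i - g k \<omega> i) * D i \<omega> \<partial>M) = 0" if "i \<in> I" for i
    using i that by (simp add: algebra_simps)
  then show ?thesis
    using i by (subst Bochner_Integration.integral_sum) (auto simp: algebra_simps)
qed

lemma integral_step_h:
  assumes D: "\<And>j. j \<in> J \<Longrightarrow> bounded_measurable (G k) (D j)"
  shows "(\<integral>\<omega>. (\<Sum>j\<in>J. (h (Suc k) \<omega> j - h k \<omega> j) * D j \<omega>) \<partial>M) = 0"
proof -
  have i: "integrable M (\<lambda>\<omega>. D j \<omega> * h l \<omega> j)" if "j \<in> J" for j l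
    using bounded_measurable_subalgebra[OF G D[OF that]] bounded_gh_M(2)[OF that]
    by (intro bounded_measurable_integrable bounded_intros)
  have "(\<integral>\<omega>. D j \<omega> * h (Suc k) \<omega> j \<partial>M) = (\<integral>\<omega>. D j \<omega> * h k \<omega> j \<partial>M)" if "j \<in> J" for j
    using h_cond[OF that, of "D j" k] h_cond[OF that, of "D j" "Suc k"]
      bounded_measurable_measurable[OF D[OF that]]
      bounded_measurable_measurable[OF bounded_measurable_subalgebra[OF G_mono D[OF that]]]
      bounded_measurable_integrable[OF bounded_measurable_subalgebra[OF G D[OF that]]]
    by simp
  then have "(\<integral>\<omega>. (h (Suc k) \<omega> j - h k \<omega> j) * D j \<omega> \<partial>M) = 0" if "j \<in> J" for j
    using i that by (simp add: algebra_simps)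
  then show ?thesis
    using i by (subst Bochner_Integration.integral_sum) (auto simp: algebra_simps)
qed

lemma integrable_\<Phi>: "integrable M (\<lambda>\<omega>. \<Phi> (g k \<omega>) (h l \<omega>))"
  and integrable_\<Phi>\<^sub>1: "integrable M (\<lambda>\<omega>. \<Phi>\<^sub>1 (g k \<omega>) (h l \<omega>))"
  by (intro bounded_measurable_integrable bounded_measurable_\<Phi> bounded_measurable_\<Phi>\<^sub>1 bounded_gh_M; assumption)+

lemma integral_\<Phi>_step_g:
  "(\<integral>\<omega>. \<Phi> (g k \<omega>) (h l \<omega>) \<partial>M) \<le> (\<integral>\<omega>. \<Phi> (g (Suc k) \<omega>) (h l \<omega>) \<partial>M)"
proof -
  \<comment> \<open>The derivative is taken at \<open>g k\<close> and \<open>h l\<close>, both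
    \<open>F k\<close>-measurable, so its term has mean zero.\<close>
  have R: "bounded_measurable (F k) (\<lambda>\<omega>. R (g k \<omega>) (h l \<omega>) i)" for i
    by (intro bounded_measurable_R bounded_g(2) bounded_gh_G(2))
  have "integrable M (\<lambda>\<omega>. \<Sum>i\<in>I. (g (Suc k) \<omega> i - g k \<omega> i) * R (g k \<omega>) (h l \<omega>) i)"
    by (intro bounded_measurable_integrable bounded_intros bounded_gh_M bounded_measurable_subalgebra[OF F R])
  then have i: "integrable M (\<lambda>\<omega>. \<Phi> (g k \<omega>) (h l \<omega>) + (\<Sum>i\<in>I. (g (Suc k) \<omega> i - g k \<omega> i) * R (g k \<omega>) (h l \<omega>) i))"
    using integrable_\<Phi> by (intro Bochner_Integration.integrable_add)
  have "(\<integral>\<omega>. \<Phi> (g k \<omega>) (h l \<omega>) \<partial>M) = (\<integral>\<omega>. \<Phi> (g k \<omega>) (h l \<omega>) + (\<Sum>i\<in>I. (g (Suc k) \<omega> i - g k \<omega> i) * R (g k \<omega>) (h l \<omega>) i) \<partial>M)"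
    using integral_step_g[OF R] integrable_\<Phi> \<open>integrable M (\<lambda>\<omega>. \<Sum>i\<in>I. _ i \<omega>)\<close> by simp
  also have "\<dots> \<le> (\<integral>\<omega>. \<Phi> (g (Suc k) \<omega>) (h l \<omega>) \<partial>M)"
    using i integrable_\<Phi>
  proof (rule integral_mono)
    fix \<omega> assume "\<omega> \<in> space M"
    then show "\<Phi> (g k \<omega>) (h l \<omega>) + (\<Sum>i\<in>I. (g (Suc k) \<omega> i - g k \<omega> i) * R (g k \<omega>) (h l \<omega>) i) \<le> \<Phi> (g (Suc k) \<omega>) (h l \<omega>)"
      using \<Phi>_step_g[of "g k \<omega>" "\<lambda>i. g (Suc k) \<omega> i - g k \<omega> i" "h l \<omega>"] g_nonneg h_nonneg by simp
  qed
  finally show ?thesis .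
qed

lemma integral_\<Phi>_step_h:
  "(\<integral>\<omega>. \<Phi> (g k \<omega>) (h l \<omega>) \<partial>M) + (\<integral>\<omega>. \<Phi>\<^sub>1 (g k \<omega>) (h (Suc l) \<omega>) - \<Phi>\<^sub>1 (g k \<omega>) (h l \<omega>) \<partial>M)
    \<le> (\<integral>\<omega>. \<Phi> (g k \<omega>) (h (Suc l) \<omega>) \<partial>M)"
proof -
  have T: "bounded_measurable (G l) (\<lambda>\<omega>. T (g k \<omega>) (h l \<omega>) j)" for j
    by (intro bounded_measurable_T bounded_h(2) bounded_gh_G(1))
  have iT: "integrable M (\<lambda>\<omega>. \<Sum>j\<in>J. (h (Suc l) \<omega> j - h l \<omega> j) * T (g k \<omega>) (h l \<omega>) j)"
    by (intro bounded_measurable_integrable bounded_intros bounded_gh_M bounded_measurable_subalgebra[OF G T])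
  have "(\<integral>\<omega>. \<Phi> (g k \<omega>) (h l \<omega>) \<partial>M) + (\<integral>\<omega>. \<Phi>\<^sub>1 (g k \<omega>) (h (Suc l) \<omega>) - \<Phi>\<^sub>1 (g k \<omega>) (h l \<omega>) \<partial>M)
     = (\<integral>\<omega>. \<Phi> (g k \<omega>) (h l \<omega>) + (\<Phi>\<^sub>1 (g k \<omega>) (h (Suc l) \<omega>) - \<Phi>\<^sub>1 (g k \<omega>) (h l \<omega>))
       + (\<Sum>j\<in>J. (h (Suc l) \<omega> j - h l \<omega> j) * T (g k \<omega>) (h l \<omega>) j) \<partial>M)"
    using integral_step_h[OF T] integrable_\<Phi> integrable_\<Phi>\<^sub>1 iT by simp
  also have "\<dots> \<le> (\<integral>\<omega>. \<Phi> (g k \<omega>) (h (Suc l) \<omega>) \<partial>M)"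
  proof (rule integral_mono)
    fix \<omega> assume "\<omega> \<in> space M"
    then show "\<Phi> (g k \<omega>) (h l \<omega>) + (\<Phi>\<^sub>1 (g k \<omega>) (h (Suc l) \<omega>) - \<Phi>\<^sub>1 (g k \<omega>) (h l \<omega>))
       + (\<Sum>j\<in>J. (h (Suc l) \<omega> j - h l \<omega> j) * T (g k \<omega>) (h l \<omega>) j) \<le> \<Phi> (g k \<omega>) (h (Suc l) \<omega>)"
      using \<Phi>_step_h[of "g k \<omega>" "h l \<omega>" "\<lambda>j. h (Suc l) \<omega> j - h l \<omega> j"] g_nonneg by simp
  qed (use integrable_\<Phi> integrable_\<Phi>\<^sub>1 iT in auto)
  finally show ?thesis .
qed

text \<open>The bound of \<open>\<Phi>_bound\<close> is bilinear in \<open>g\<close> and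
  \<open>h\<close>, and the conditionings are undone one after the other: \<open>h l\<close> is
  \<open>F k\<close>-measurable, so \<open>g k\<close> turns into the indicator of the first label;
  that indicator is \<open>G l\<close>-measurable, so \<open>h l\<close> turns into the indicator of
  the second.\<close>

lemma integral_\<Phi>_bound:
  "(\<integral>\<omega>. \<Phi> (g k \<omega>) (h l \<omega>) \<partial>M)
    \<le> 24 * (\<integral>\<omega>. \<xi> (\<phi> \<omega>) (\<psi> \<omega>) ^ 4 \<partial>M) + (\<integral>\<omega>. \<zeta> (\<phi> \<omega>) (\<psi> \<omega>) ^ 4 \<partial>M) / 16"
proof -
  define c where "c i j = 24 * \<xi> i j ^ 4 + \<zeta> i j ^ 4 / 16" for i j
  have i: "integrable M (\<lambda>\<omega>. g k \<omega> i * h l \<omega> j * c i j)" if "i \<in> I" "j \<in> J" for i j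
    using that by (intro bounded_measurable_integrable bounded_intros bounded_gh_M)
  have i2: "integrable M (\<lambda>\<omega>. of_bool (\<phi> \<omega> = i) * of_bool (\<psi> \<omega> = j) * c i j)" for i j
    by (intro bounded_measurable_integrable bounded_intros bounded_of_bool)
  have eq: "(\<integral>\<omega>. g k \<omega> i * h l \<omega> j * c i j \<partial>M) = (\<integral>\<omega>. of_bool (\<phi> \<omega> = i) * of_bool (\<psi> \<omega> = j) * c i j \<partial>M)"
    if "i \<in> I" "j \<in> J" for i j
  proof -
    have "(\<integral>\<omega>. h l \<omega> j * g k \<omega> i \<partial>M) = (\<integral>\<omega>. h l \<omega> j * of_bool (\<phi> \<omega> = i) \<partial>M)"
      using that bounded_measurable_measurable[OF bounded_gh_G(2)] bounded_measurable_integrable[OF bounded_gh_M(2)]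
      by (intro g_cond) auto
    also have "\<dots> = (\<integral>\<omega>. of_bool (\<phi> \<omega> = i) * h l \<omega> j \<partial>M)"
      by (simp add: mult.commute)
    also have "\<dots> = (\<integral>\<omega>. of_bool (\<phi> \<omega> = i) * of_bool (\<psi> \<omega> = j) \<partial>M)"
      using that bounded_measurable_measurable[OF bounded_of_bool(2)] bounded_measurable_integrable[OF bounded_of_bool(3)]
      by (intro h_cond) auto
    finally show ?thesis by (simp add: mult.commute)
  qed
  have "(\<integral>\<omega>. \<Phi> (g k \<omega>) (h l \<omega>) \<partial>M) \<le> (\<integral>\<omega>. (\<Sum>i\<in>I. \<Sum>j\<in>J. g k \<omega> i * h l \<omega> j * c i j) \<partial>M)"
    using i unfolding c_def
    by (intro integral_mono integrable_\<Phi> Bochner_Integration.integrable_sum \<Phi>_bound g_nonneg h_nonneg g_sum h_sum)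
  also have "\<dots> = (\<Sum>i\<in>I. \<Sum>j\<in>J. \<integral>\<omega>. g k \<omega> i * h l \<omega> j * c i j \<partial>M)"
    using i by (simp add: Bochner_Integration.integral_sum Bochner_Integration.integrable_sum)
  also have "\<dots> = (\<Sum>i\<in>I. \<Sum>j\<in>J. \<integral>\<omega>. of_bool (\<phi> \<omega> = i) * of_bool (\<psi> \<omega> = j) * c i j \<partial>M)"
    by (intro sum.cong refl eq)
  also have "\<dots> = (\<integral>\<omega>. (\<Sum>i\<in>I. \<Sum>j\<in>J. of_bool (\<phi> \<omega> = i) * of_bool (\<psi> \<omega> = j) * c i j) \<partial>M)"
    using i2 by (simp add: Bochner_Integration.integral_sum Bochner_Integration.integrable_sum)
  also have "\<dots> = (\<integral>\<omega>. c (\<phi> \<omega>) (\<psi> \<omega>) \<partial>M)"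
    by (intro Bochner_Integration.integral_cong)
       (simp_all add: mult.assoc sum_distrib_left[symmetric] sum_of_bool)
  also have "\<dots> = 24 * (\<integral>\<omega>. \<xi> (\<phi> \<omega>) (\<psi> \<omega>) ^ 4 \<partial>M) + (\<integral>\<omega>. \<zeta> (\<phi> \<omega>) (\<psi> \<omega>) ^ 4 \<partial>M) / 16"
    using bounded_measurable_integrable[OF bounded_measurable_label[of "\<lambda>i j. \<xi> i j ^ 4"]]
      bounded_measurable_integrable[OF bounded_measurable_label[of "\<lambda>i j. \<zeta> i j ^ 4"]]
    by (simp add: c_def)
  finally show ?thesis .
qed

text \<open>A staircase from \<open>(n, n)\<close> to \<open>(Suc n, Suc n)\<close>: first
  \<open>h\<close> advances at fixed \<open>g\<close>, and the mean of \<open>\<Phi>\<close> gains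
  at least the increment of \<open>\<Phi>\<^sub>1\<close>; then \<open>g\<close> advances, and the
  mean does not drop. The starting value is nonnegative.\<close>

lemma sum_\<Phi>\<^sub>1_increments:
  "(\<Sum>k<n. \<integral>\<omega>. \<Phi>\<^sub>1 (g k \<omega>) (h (Suc k) \<omega>) - \<Phi>\<^sub>1 (g k \<omega>) (h k \<omega>) \<partial>M) \<le> (\<integral>\<omega>. \<Phi> (g n \<omega>) (h n \<omega>) \<partial>M)"
proof (induction n)
  case 0
  have "0 \<le> \<Phi> (g 0 \<omega>) (h 0 \<omega>)" if "\<omega> \<in> space M" for \<omega>
    unfolding \<Phi>_def \<Phi>\<^sub>1_def box_def
    by (intro add_nonneg_nonneg sum_nonneg mult_nonneg_nonneg divide_nonneg_nonneg zero_le_power2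
        g_nonneg h_nonneg that) auto
  then show ?case by (auto intro: integral_nonneg_AE)
next
  case (Suc n)
  then show ?case
    using integral_\<Phi>_step_h[of n n] integral_\<Phi>_step_g[of n "Suc n"] by simp
qed

text \<open>A version of E(X' Z | G l) with X' = E(X | F k): the label \<open>\<phi>\<close> and the
  vector \<open>g k\<close> are known to \<open>G l\<close>, so only the second label is
  averaged.\<close>

definition U where "U k l \<omega> = L (g k \<omega>) (h l \<omega>) (\<phi> \<omega>)"

lemma U_altdef: "\<omega> \<in> space M \<Longrightarrow> U k l \<omega> = (\<Sum>i\<in>I. of_bool (\<phi> \<omega> = i) * L (g k \<omega>) (h l \<omega>) i)"
  by (simp add: U_def sum_of_bool)

lemma bounded_U: "bounded_measurable (G l) (U k l)" "bounded_measurable M (U k l)"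
proof -
  have "bounded_measurable (G l) (\<lambda>\<omega>. \<Sum>i\<in>I. of_bool (\<phi> \<omega> = i) * L (g k \<omega>) (h l \<omega>) i)"
    by (intro bounded_intros bounded_measurable_L bounded_h(2) bounded_gh_G(1) bounded_of_bool)
  then show "bounded_measurable (G l) (U k l)"
    by (rule bounded_measurable_cong) (simp add: U_altdef space_eq)
  then show "bounded_measurable M (U k l)"
    using G bounded_measurable_subalgebra by blast
qed

text \<open>For fixed \<open>k\<close>, \<open>U k l\<close> is a martingale in \<open>l\<close>,
  because it is linear in \<open>h l\<close>.\<close>

lemma U_increment_orth: 
  assumes D: "bounded_measurable (G l) D"
  shows "(\<integral>\<omega>. D \<omega> * (U k (Suc l) \<omega> - U k l \<omega>) \<partial>M) = 0"
proof -
  have "(\<integral>\<omega>. D \<omega> * (U k (Suc l) \<omega> - U k l \<omega>) \<partial>M)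
    = (\<integral>\<omega>. (\<Sum>j\<in>J. (h (Suc l) \<omega> j - h l \<omega> j) * (\<Sum>i\<in>I. D \<omega> * of_bool (\<phi> \<omega> = i) * (\<zeta> i j * V (g k \<omega>) j))) \<partial>M)"
  proof (rule Bochner_Integration.integral_cong[OF refl])
    fix \<omega> assume \<omega>: "\<omega> \<in> space M"
    have "(\<Sum>i\<in>I. D \<omega> * of_bool (\<phi> \<omega> = i) * (\<zeta> i j * V (g k \<omega>) j)) = D \<omega> * (\<zeta> (\<phi> \<omega>) j * V (g k \<omega>) j)" for j
      using sum_of_bool(1)[OF \<omega>, of "\<lambda>i. \<zeta> i j * V (g k \<omega>) j"]
      by (simp add: sum_distrib_left[symmetric] mult.assoc)
    then show "D \<omega> * (U k (Suc l) \<omega> - U k l \<omega>)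
      = (\<Sum>j\<in>J. (h (Suc l) \<omega> j - h l \<omega> j) * (\<Sum>i\<in>I. D \<omega> * of_bool (\<phi> \<omega> = i) * (\<zeta> i j * V (g k \<omega>) j)))"
      by (simp add: U_def L_def sum_subtractf[symmetric] sum_distrib_left algebra_simps)
  qed
  also have "\<dots> = 0"
    by (intro integral_step_h bounded_intros D bounded_of_bool bounded_measurable_V bounded_gh_G)
  finally show ?thesis .
qed

text \<open>The passage to the Bellman function: \<open>L (g k \<omega>) (h l \<omega>) i\<close> is
  \<open>F k\<close>-measurable, so the indicator of the first label may be replaced by
  \<open>g k \<omega> i\<close>.\<close>

lemma U_square: "(\<integral>\<omega>. (U k l \<omega>)\<^sup>2 \<partial>M) = (\<integral>\<omega>. \<Phi>\<^sub>1 (g k \<omega>) (h l \<omega>) \<partial>M)"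
proof -
  have D: "bounded_measurable (F k) (\<lambda>\<omega>. (L (g k \<omega>) (h l \<omega>) i)\<^sup>2)" for i
    by (intro bounded_intros bounded_measurable_L bounded_g(2) bounded_gh_G(2))
  note DM = bounded_measurable_subalgebra[OF F D]
  have "(\<integral>\<omega>. (U k l \<omega>)\<^sup>2 \<partial>M) = (\<integral>\<omega>. (\<Sum>i\<in>I. (L (g k \<omega>) (h l \<omega>) i)\<^sup>2 * of_bool (\<phi> \<omega> = i)) \<partial>M)"
    by (rule Bochner_Integration.integral_cong) (simp_all add: U_def sum_of_bool mult.commute)
  also have "\<dots> = (\<Sum>i\<in>I. \<integral>\<omega>. (L (g k \<omega>) (h l \<omega>) i)\<^sup>2 * of_bool (\<phi> \<omega> = i) \<partial>M)"
    by (intro Bochner_Integration.integral_sum bounded_measurable_integrable bounded_measurable_mult bounded_of_bool DM)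
  also have "\<dots> = (\<Sum>i\<in>I. \<integral>\<omega>. (L (g k \<omega>) (h l \<omega>) i)\<^sup>2 * g k \<omega> i \<partial>M)"
    by (intro sum.cong refl g_cond[symmetric] bounded_measurable_measurable[OF D] bounded_measurable_integrable DM)
  also have "\<dots> = (\<integral>\<omega>. \<Phi>\<^sub>1 (g k \<omega>) (h l \<omega>) \<partial>M)"
    unfolding \<Phi>\<^sub>1_def
    by (subst Bochner_Integration.integral_sum)
       (auto simp: mult.commute intro!: bounded_measurable_integrable bounded_measurable_mult bounded_gh_M DM)
  finally show ?thesis .
qed

lemma U_increment_square:
  "(\<integral>\<omega>. (U k (Suc l) \<omega> - U k l \<omega>)\<^sup>2 \<partial>M) = (\<integral>\<omega>. \<Phi>\<^sub>1 (g k \<omega>) (h (Suc l) \<omega>) - \<Phi>\<^sub>1 (g k \<omega>) (h l \<omega>) \<partial>M)"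
proof -
  have i: "integrable M (\<lambda>\<omega>. (U k l \<omega>)\<^sup>2)" "integrable M (\<lambda>\<omega>. U k l \<omega> * (U k (Suc l) \<omega> - U k l \<omega>))" for l
    by (intro bounded_measurable_integrable bounded_intros bounded_U)+
  have "(\<integral>\<omega>. (U k (Suc l) \<omega> - U k l \<omega>)\<^sup>2 \<partial>M)
    = (\<integral>\<omega>. (U k (Suc l) \<omega>)\<^sup>2 - (U k l \<omega>)\<^sup>2 - 2 * (U k l \<omega> * (U k (Suc l) \<omega> - U k l \<omega>)) \<partial>M)"
    by (simp add: power2_eq_square algebra_simps)
  also have "\<dots> = (\<integral>\<omega>. (U k (Suc l) \<omega>)\<^sup>2 \<partial>M) - (\<integral>\<omega>. (U k l \<omega>)\<^sup>2 \<partial>M)"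
    using i U_increment_orth[OF bounded_U(1)] by simp
  also have "\<dots> = (\<integral>\<omega>. \<Phi>\<^sub>1 (g k \<omega>) (h (Suc l) \<omega>) - \<Phi>\<^sub>1 (g k \<omega>) (h l \<omega>) \<partial>M)"
    using integrable_\<Phi>\<^sub>1 by (simp add: U_square)
  finally show ?thesis .
qed

lemma U_sum_bound:
  "(\<Sum>k<n. \<integral>\<omega>. (U k (Suc k) \<omega> - U k k \<omega>)\<^sup>2 \<partial>M)
    \<le> 24 * (\<integral>\<omega>. \<xi> (\<phi> \<omega>) (\<psi> \<omega>) ^ 4 \<partial>M) + (\<integral>\<omega>. \<zeta> (\<phi> \<omega>) (\<psi> \<omega>) ^ 4 \<partial>M) / 16"
  unfolding U_increment_square using sum_\<Phi>\<^sub>1_increments integral_\<Phi>_bound by (rule order_trans)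

end

section \<open>Conditional expectations of label functions and their pairing with increments\<close>

context labelled
begin

lemma bounded_label_G: "bounded_measurable (G k) (\<lambda>\<omega>. f (\<phi> \<omega>))"
  and bounded_label_F: "bounded_measurable (F k) (\<lambda>\<omega>. f (\<psi> \<omega>))"
proof -
  have "bounded_measurable A (\<lambda>\<omega>. f (\<phi> \<omega>))"
    using fin by (intro bounded_measurableI[of _ _ "Max ((\<lambda>i. \<bar>f i\<bar>) ` I)"] Max_ge) (auto simp: space_eq)
  then show "bounded_measurable (G k) (\<lambda>\<omega>. f (\<phi> \<omega>))"
    using A_G bounded_measurable_subalgebra by blast
  have "bounded_measurable B (\<lambda>\<omega>. f (\<psi> \<omega>))"
    using fin by (intro bounded_measurableI[of _ _ "Max ((\<lambda>i. \<bar>f i\<bar>) ` J)"] Max_ge) (auto simp: space_eq)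
  then show "bounded_measurable (F k) (\<lambda>\<omega>. f (\<psi> \<omega>))"
    using B_F bounded_measurable_subalgebra by blast
qed

lemma bounded_V_label: "bounded_measurable (F k) (\<lambda>\<omega>. V (g k \<omega>) (\<psi> \<omega>))"
  unfolding V_def by (intro bounded_intros bounded_g(2) bounded_label_F)

text \<open>The second label is \<open>F k\<close>-measurable since \<open>B\<close> is contained in
  \<open>F k\<close>; conditioning averages the first label only.\<close>

lemma cond_exp_label:
  "AE \<omega> in M. real_cond_exp M (F k) (\<lambda>\<omega>. \<xi> (\<phi> \<omega>) (\<psi> \<omega>)) \<omega> = V (g k \<omega>) (\<psi> \<omega>)"
proof -
  interpret Fk: sigma_finite_subalgebra M "F k" by (rule subalgebra_sigma_finite[OF F])
  show ?thesis
  proof (rule Fk.real_cond_exp_charact)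
    fix E assume E: "E \<in> sets (F k)"
    define D where "D i \<omega> = indicator E \<omega> * \<xi> i (\<psi> \<omega>)" for i \<omega>
    have D: "bounded_measurable (F k) (D i)" for i
    proof -
      have "bounded_measurable (F k) (indicator E :: 'a \<Rightarrow> real)"
        using E by (intro bounded_measurableI[of _ _ 1]) auto
      then show ?thesis
        unfolding D_def by (intro bounded_measurable_mult bounded_label_F)
    qed
    note DM = bounded_measurable_subalgebra[OF F D]
    have "(LINT \<omega>:E|M. \<xi> (\<phi> \<omega>) (\<psi> \<omega>)) = (\<integral>\<omega>. (\<Sum>i\<in>I. D i \<omega> * of_bool (\<phi> \<omega> = i)) \<partial>M)"
      unfolding set_lebesgue_integral_def
      by (rule Bochner_Integration.integral_cong[OF refl])
         (simp add: D_def mult.assoc sum_distrib_left[symmetric] mult.commute[of _ "of_bool _"] sum_of_bool)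
    also have "\<dots> = (\<Sum>i\<in>I. \<integral>\<omega>. D i \<omega> * of_bool (\<phi> \<omega> = i) \<partial>M)"
      by (intro Bochner_Integration.integral_sum bounded_measurable_integrable bounded_measurable_mult DM bounded_of_bool)
    also have "\<dots> = (\<Sum>i\<in>I. \<integral>\<omega>. D i \<omega> * g k \<omega> i \<partial>M)"
      by (intro sum.cong refl g_cond[symmetric] bounded_measurable_measurable[OF D] bounded_measurable_integrable DM)
    also have "\<dots> = (\<integral>\<omega>. (\<Sum>i\<in>I. D i \<omega> * g k \<omega> i) \<partial>M)"
      by (intro Bochner_Integration.integral_sum[symmetric] bounded_measurable_integrable bounded_measurable_mult DM bounded_gh_M)
    also have "\<dots> = (LINT \<omega>:E|M. V (g k \<omega>) (\<psi> \<omega>))"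
      unfolding set_lebesgue_integral_def
      by (rule Bochner_Integration.integral_cong[OF refl])
         (simp add: D_def V_def sum_distrib_left mult_ac)
    finally show "(LINT \<omega>:E|M. \<xi> (\<phi> \<omega>) (\<psi> \<omega>)) = (LINT \<omega>:E|M. V (g k \<omega>) (\<psi> \<omega>))" .
  qed (intro bounded_measurable_integrable bounded_measurable_label bounded_measurable_subalgebra[OF F bounded_V_label]
      bounded_measurable_measurable[OF bounded_V_label])+
qed

text \<open>All factors but the indicators of the second label are
  \<open>G (Suc k)\<close>-measurable, so these indicators become \<open>h (Suc k)\<close> and
  produce \<open>U k (Suc k)\<close>. Subtracting \<open>U k k\<close> is free: its product with
  \<open>K\<close> is \<open>G k\<close>-measurable and hence orthogonal to
  \<open>y\<close>.\<close>

lemma pairing_eq: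
  assumes K: "bounded_measurable (G k) K"
    and y: "y \<in> borel_measurable (G (Suc k))" and yi: "integrable M y"
    and y0: "\<And>D. bounded_measurable (G k) D \<Longrightarrow> (\<integral>\<omega>. D \<omega> * y \<omega> \<partial>M) = 0"
  shows "(\<integral>\<omega>. K \<omega> * V (g k \<omega>) (\<psi> \<omega>) * y \<omega> * \<zeta> (\<phi> \<omega>) (\<psi> \<omega>) \<partial>M)
    = (\<integral>\<omega>. K \<omega> * y \<omega> * (U k (Suc k) \<omega> - U k k \<omega>) \<partial>M)"
proof -
  define C where "C j \<omega> = K \<omega> * \<zeta> (\<phi> \<omega>) j * V (g k \<omega>) j" for j \<omega>
  have C: "bounded_measurable (G (Suc k)) (C j)" for j
    unfolding C_def
    by (intro bounded_intros bounded_measurable_subalgebra[OF G_mono K] bounded_label_G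
        bounded_measurable_V bounded_gh_G)
  note CM = bounded_measurable_subalgebra[OF G C]
  have Cy: "(\<lambda>\<omega>. C j \<omega> * y \<omega>) \<in> borel_measurable (G (Suc k))" "integrable M (\<lambda>\<omega>. C j \<omega> * y \<omega>)" for j
    using bounded_measurable_measurable[OF C] y integrable_bounded_mult[OF CM yi] by auto
  have 1: "integrable M (\<lambda>\<omega>. of_bool (\<psi> \<omega> = j) * (C j \<omega> * y \<omega>))" for j
    by (intro integrable_bounded_mult Cy bounded_of_bool)
  have 2: "integrable M (\<lambda>\<omega>. h (Suc k) \<omega> j * (C j \<omega> * y \<omega>))" if "j \<in> J" for j
    by (intro integrable_bounded_mult Cy bounded_gh_M that)
  have KU: "bounded_measurable (G k) (\<lambda>\<omega>. K \<omega> * U k k \<omega>)"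
    by (intro bounded_intros K bounded_U)
  have "(\<integral>\<omega>. K \<omega> * V (g k \<omega>) (\<psi> \<omega>) * y \<omega> * \<zeta> (\<phi> \<omega>) (\<psi> \<omega>) \<partial>M)
    = (\<integral>\<omega>. (\<Sum>j\<in>J. of_bool (\<psi> \<omega> = j) * (C j \<omega> * y \<omega>)) \<partial>M)"
    by (rule Bochner_Integration.integral_cong[OF refl]) (simp only: sum_of_bool, simp add: C_def mult_ac)
  also have "\<dots> = (\<Sum>j\<in>J. \<integral>\<omega>. C j \<omega> * y \<omega> * of_bool (\<psi> \<omega> = j) \<partial>M)"
    using 1 by (subst Bochner_Integration.integral_sum) (auto simp: mult.commute)
  also have "\<dots> = (\<Sum>j\<in>J. \<integral>\<omega>. C j \<omega> * y \<omega> * h (Suc k) \<omega> j \<partial>M)"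
    by (intro sum.cong refl h_cond[symmetric] Cy)
  also have "\<dots> = (\<integral>\<omega>. (\<Sum>j\<in>J. h (Suc k) \<omega> j * (C j \<omega> * y \<omega>)) \<partial>M)"
    using 2 by (subst Bochner_Integration.integral_sum) (auto simp: mult.commute)
  also have "\<dots> = (\<integral>\<omega>. K \<omega> * U k (Suc k) \<omega> * y \<omega> \<partial>M)"
    by (rule Bochner_Integration.integral_cong[OF refl])
       (simp add: U_def L_def C_def sum_distrib_left mult_ac)
  also have "\<dots> = (\<integral>\<omega>. K \<omega> * U k (Suc k) \<omega> * y \<omega> \<partial>M) - (\<integral>\<omega>. K \<omega> * U k k \<omega> * y \<omega> \<partial>M)"
    using y0[OF KU] by simp
  also have "\<dots> = (\<integral>\<omega>. K \<omega> * U k (Suc k) \<omega> * y \<omega> - K \<omega> * U k k \<omega> * y \<omega> \<partial>M)"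
    by (intro Bochner_Integration.integral_diff[symmetric] integrable_bounded_mult yi bounded_measurable_mult
        bounded_U bounded_measurable_subalgebra[OF G K])
  finally show ?thesis by (simp add: algebra_simps)
qed

end

section \<open>Transforms of the martingale closed by \<open>Y\<close>\<close>

locale square_integrands = two_filtrations +
  fixes Y :: "'a \<Rightarrow> real" and Y\<^sub>G K :: "nat \<Rightarrow> 'a \<Rightarrow> real"
  assumes Y[measurable]: "Y \<in> borel_measurable M" and Y4: "integrable M (\<lambda>\<omega>. Y \<omega> ^ 4)"
    and Y\<^sub>G: "\<And>k. Y\<^sub>G k \<in> borel_measurable (G k)"
    and Y\<^sub>G_cond: "\<And>k. AE \<omega> in M. real_cond_exp M (G k) Y \<omega> = Y\<^sub>G k \<omega>"
    and K: "\<And>k. K k \<in> borel_measurable (G k)" and K_le: "\<And>k \<omega>. \<omega> \<in> space M \<Longrightarrow> \<bar>K k \<omega>\<bar> \<le> 1"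
begin

lemma Y\<^sub>G_M[measurable]: "Y\<^sub>G k \<in> borel_measurable M" and K_M[measurable]: "K k \<in> borel_measurable M"
  using measurable_from_subalg[OF G Y\<^sub>G] measurable_from_subalg[OF G K] by auto

lemma Y\<^sub>G4: "integrable M (\<lambda>\<omega>. Y\<^sub>G k \<omega> ^ 4)" "(\<integral>\<omega>. Y\<^sub>G k \<omega> ^ 4 \<partial>M) \<le> (\<integral>\<omega>. Y \<omega> ^ 4 \<partial>M)"
  using cond_exp_power4[OF G Y Y\<^sub>G_M Y4 Y\<^sub>G_cond] .

lemma Y\<^sub>G_pairing:
  "D \<in> borel_measurable (G k) \<Longrightarrow> integrable M (\<lambda>\<omega>. D \<omega> * Y \<omega>) \<Longrightarrow>
    (\<integral>\<omega>. D \<omega> * Y\<^sub>G k \<omega> \<partial>M) = (\<integral>\<omega>. D \<omega> * Y \<omega> \<partial>M)"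
  by (rule cond_exp_pairing[OF G Y Y\<^sub>G_M _ _ Y\<^sub>G_cond])

lemma Y\<^sub>G_increment_orth:
  assumes D: "D \<in> borel_measurable (G k)" "integrable M (\<lambda>\<omega>. D \<omega> * Y \<omega>)"
    and i: "\<And>l. integrable M (\<lambda>\<omega>. D \<omega> * Y\<^sub>G l \<omega>)"
  shows "(\<integral>\<omega>. D \<omega> * (Y\<^sub>G (Suc k) \<omega> - Y\<^sub>G k \<omega>) \<partial>M) = 0"
  using Y\<^sub>G_pairing[OF D] Y\<^sub>G_pairing[OF measurable_from_subalg[OF G_mono D(1)] D(2)] i
  by (simp add: right_diff_distrib)

text \<open>Increments are orthogonal to the past, so their second moments telescope; a^2 \<le> 1 +
  a^4 then passes to the fourth moment.\<close>

lemma sum_Y\<^sub>G_increments: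
  "(\<Sum>k<n. \<integral>\<omega>. (Y\<^sub>G (Suc k) \<omega> - Y\<^sub>G k \<omega>)\<^sup>2 \<partial>M) \<le> 1 + (\<integral>\<omega>. Y \<omega> ^ 4 \<partial>M)"
proof -
  have sq: "integrable M (\<lambda>\<omega>. (Y\<^sub>G k \<omega>)\<^sup>2)" for k
    by (intro integrable_power4_square Y\<^sub>G4) measurable
  have p: "integrable M (\<lambda>\<omega>. Y\<^sub>G k \<omega> * Z \<omega>)"
    if "Z \<in> borel_measurable M" "integrable M (\<lambda>\<omega>. Z \<omega> ^ 4)" for k Z
    using integrable_prod4[of "Y\<^sub>G k" Z "\<lambda>_. 1" "\<lambda>_. 1"] that Y\<^sub>G4 by simp
  have "(\<integral>\<omega>. (Y\<^sub>G (Suc k) \<omega> - Y\<^sub>G k \<omega>)\<^sup>2 \<partial>M) = (\<integral>\<omega>. (Y\<^sub>G (Suc k) \<omega>)\<^sup>2 \<partial>M) - (\<integral>\<omega>. (Y\<^sub>G k \<omega>)\<^sup>2 \<partial>M)" for k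
  proof -
    have "(\<integral>\<omega>. (Y\<^sub>G (Suc k) \<omega> - Y\<^sub>G k \<omega>)\<^sup>2 \<partial>M)
      = (\<integral>\<omega>. (Y\<^sub>G (Suc k) \<omega>)\<^sup>2 - (Y\<^sub>G k \<omega>)\<^sup>2 - 2 * (Y\<^sub>G k \<omega> * (Y\<^sub>G (Suc k) \<omega> - Y\<^sub>G k \<omega>)) \<partial>M)"
      by (simp add: power2_eq_square algebra_simps)
    also have "\<dots> = (\<integral>\<omega>. (Y\<^sub>G (Suc k) \<omega>)\<^sup>2 \<partial>M) - (\<integral>\<omega>. (Y\<^sub>G k \<omega>)\<^sup>2 \<partial>M)
        - 2 * (\<integral>\<omega>. Y\<^sub>G k \<omega> * (Y\<^sub>G (Suc k) \<omega> - Y\<^sub>G k \<omega>) \<partial>M)"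
      using sq p[OF Y\<^sub>G_M Y\<^sub>G4(1)] by (simp add: right_diff_distrib)
    also have "(\<integral>\<omega>. Y\<^sub>G k \<omega> * (Y\<^sub>G (Suc k) \<omega> - Y\<^sub>G k \<omega>) \<partial>M) = 0"
      by (intro Y\<^sub>G_increment_orth p Y\<^sub>G Y Y4 Y\<^sub>G_M Y\<^sub>G4)
    finally show ?thesis by simp
  qed
  then have "(\<Sum>k<n. \<integral>\<omega>. (Y\<^sub>G (Suc k) \<omega> - Y\<^sub>G k \<omega>)\<^sup>2 \<partial>M) = (\<integral>\<omega>. (Y\<^sub>G n \<omega>)\<^sup>2 \<partial>M) - (\<integral>\<omega>. (Y\<^sub>G 0 \<omega>)\<^sup>2 \<partial>M)"
    by (simp add: sum_lessThan_telescope[where f = "\<lambda>k. \<integral>\<omega>. (Y\<^sub>G k \<omega>)\<^sup>2 \<partial>M"])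
  also have "\<dots> \<le> (\<integral>\<omega>. (Y\<^sub>G n \<omega>)\<^sup>2 \<partial>M)" by simp
  also have "\<dots> \<le> (\<integral>\<omega>. 1 + Y\<^sub>G n \<omega> ^ 4 \<partial>M)"
  proof (rule integral_mono)
    show "(Y\<^sub>G n \<omega>)\<^sup>2 \<le> 1 + Y\<^sub>G n \<omega> ^ 4" for \<omega>
    proof -
      have "0 \<le> ((Y\<^sub>G n \<omega>)\<^sup>2 - 1)\<^sup>2" by simp
      then have "2 * (Y\<^sub>G n \<omega>)\<^sup>2 \<le> 1 + Y\<^sub>G n \<omega> ^ 4" unfolding power2_diff by simp
      then show ?thesis using zero_le_power2[of "Y\<^sub>G n \<omega>"] by linarith
    qed
  qed (use sq Y\<^sub>G4 in auto)
  also have "\<dots> \<le> 1 + (\<integral>\<omega>. Y \<omega> ^ 4 \<partial>M)"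
    using Y\<^sub>G4 by (simp add: prob_space)
  finally show ?thesis .
qed

lemma bounded_K: "bounded_measurable (G k) (K k)" "bounded_measurable M (K k)"
  by (auto intro!: bounded_measurableI[of _ _ 1] K K_le simp: space_eq)

text \<open>The predicate \<open>labelled\<close> constrains the labels and their conditional laws
  but neither \<open>\<xi>\<close> nor \<open>\<zeta>\<close>, so one choice of laws serves all
  functions of the labels. Cauchy-Schwarz in the form a b \<le> a^2 / 2 + b^2 / 2 halves the
  constants 24 and 1/16 of \<open>U_sum_bound\<close>.\<close>

lemma labelled_estimate:
  assumes "labelled M F G A B \<phi> \<psi> g h"
  shows "(\<Sum>k<n. \<integral>\<omega>. K k \<omega> * bellman.V (\<phi> ` space M) \<xi> (g k \<omega>) (\<psi> \<omega>)
        * (Y\<^sub>G (Suc k) \<omega> - Y\<^sub>G k \<omega>) * \<zeta> (\<phi> \<omega>) (\<psi> \<omega>) \<partial>M)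
    \<le> (1 + (\<integral>\<omega>. Y \<omega> ^ 4 \<partial>M)) / 2
      + 12 * (\<integral>\<omega>. \<xi> (\<phi> \<omega>) (\<psi> \<omega>) ^ 4 \<partial>M) + (\<integral>\<omega>. \<zeta> (\<phi> \<omega>) (\<psi> \<omega>) ^ 4 \<partial>M) / 32"
proof -
  interpret labelled M F G A B \<phi> \<psi> \<xi> \<zeta> g h by fact
  define y where "y k \<omega> = Y\<^sub>G (Suc k) \<omega> - Y\<^sub>G k \<omega>" for k \<omega>
  have yM: "y k \<in> borel_measurable (G (Suc k))" for k
    unfolding y_def using Y\<^sub>G measurable_from_subalg[OF G_mono Y\<^sub>G] by measurable
  have iY: "integrable M Y" "integrable M (Y\<^sub>G k)" for k
    using integrable_power4[OF Y Y4] integrable_power4[OF Y\<^sub>G_M Y\<^sub>G4(1)] by auto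
  have y4: "integrable M (\<lambda>\<omega>. (y k \<omega>)\<^sup>2)" for k
  proof -
    have "integrable M (\<lambda>\<omega>. Y\<^sub>G k \<omega> * Y\<^sub>G l \<omega>)" for k l
      using integrable_prod4[of "Y\<^sub>G k" "Y\<^sub>G l" "\<lambda>_. 1" "\<lambda>_. 1"] Y\<^sub>G4 by simp
    then have "integrable M (\<lambda>\<omega>. Y\<^sub>G (Suc k) \<omega> * Y\<^sub>G (Suc k) \<omega> + Y\<^sub>G k \<omega> * Y\<^sub>G k \<omega> - 2 * (Y\<^sub>G (Suc k) \<omega> * Y\<^sub>G k \<omega>))"
      by (intro Bochner_Integration.integrable_diff Bochner_Integration.integrable_add integrable_mult_right)
    then show ?thesis unfolding y_def power2_diff by (simp add: power2_eq_square mult.assoc)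
  qed
  have y: "integrable M (y k)" for k
    using iY by (simp add: y_def[abs_def])
  have y0: "(\<integral>\<omega>. D \<omega> * y k \<omega> \<partial>M) = 0" if D: "bounded_measurable (G k) D" for D k
    unfolding y_def
    by (intro Y\<^sub>G_increment_orth integrable_bounded_mult bounded_measurable_subalgebra[OF G D] iY
        bounded_measurable_measurable[OF D])
  have "(\<integral>\<omega>. K k \<omega> * V (g k \<omega>) (\<psi> \<omega>) * y k \<omega> * \<zeta> (\<phi> \<omega>) (\<psi> \<omega>) \<partial>M)
    \<le> (\<integral>\<omega>. (y k \<omega>)\<^sup>2 \<partial>M) / 2 + (\<integral>\<omega>. (U k (Suc k) \<omega> - U k k \<omega>)\<^sup>2 \<partial>M) / 2" for k
  proof -
    define u where "u \<omega> = U k (Suc k) \<omega> - U k k \<omega>" for \<omega>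
    have u: "bounded_measurable M u"
      unfolding u_def by (intro bounded_intros bounded_U)
    have u2: "integrable M (\<lambda>\<omega>. (u \<omega>)\<^sup>2)"
      by (intro bounded_measurable_integrable bounded_intros u)
    have "(\<integral>\<omega>. K k \<omega> * y k \<omega> * u \<omega> \<partial>M) \<le> (\<integral>\<omega>. (y k \<omega>)\<^sup>2 / 2 + (u \<omega>)\<^sup>2 / 2 \<partial>M)"
    proof (rule integral_mono)
      show "integrable M (\<lambda>\<omega>. K k \<omega> * y k \<omega> * u \<omega>)"
        using integrable_bounded_mult[OF bounded_measurable_mult[OF bounded_K(2) u] y]
        by (simp add: mult_ac)
      show "K k \<omega> * y k \<omega> * u \<omega> \<le> (y k \<omega>)\<^sup>2 / 2 + (u \<omega>)\<^sup>2 / 2" if "\<omega> \<in> space M" for \<omega>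
      proof -
        have "K k \<omega> * y k \<omega> * u \<omega> \<le> \<bar>K k \<omega>\<bar> * (\<bar>y k \<omega>\<bar> * \<bar>u \<omega>\<bar>)"
          by (simp add: abs_mult[symmetric] mult_ac)
        also have "\<dots> \<le> 1 * (\<bar>y k \<omega>\<bar> * \<bar>u \<omega>\<bar>)"
          by (intro mult_right_mono K_le that) auto
        also have "\<dots> \<le> (y k \<omega>)\<^sup>2 / 2 + (u \<omega>)\<^sup>2 / 2"
          using zero_le_power2[of "\<bar>y k \<omega>\<bar> - \<bar>u \<omega>\<bar>"] by (simp add: power2_diff)
        finally show ?thesis .
      qed
    qed (use y4 u2 in auto)
    then show ?thesis
      using y4 u2 by (simp add: pairing_eq[OF bounded_K(1) yM y y0] u_def)
  qed
  then have "(\<Sum>k<n. \<integral>\<omega>. K k \<omega> * V (g k \<omega>) (\<psi> \<omega>) * y k \<omega> * \<zeta> (\<phi> \<omega>) (\<psi> \<omega>) \<partial>M)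
    \<le> (\<Sum>k<n. (\<integral>\<omega>. (y k \<omega>)\<^sup>2 \<partial>M) / 2 + (\<integral>\<omega>. (U k (Suc k) \<omega> - U k k \<omega>)\<^sup>2 \<partial>M) / 2)"
    by (rule sum_mono)
  also have "\<dots> = (\<Sum>k<n. \<integral>\<omega>. (y k \<omega>)\<^sup>2 \<partial>M) / 2 + (\<Sum>k<n. \<integral>\<omega>. (U k (Suc k) \<omega> - U k k \<omega>)\<^sup>2 \<partial>M) / 2"
    by (simp add: sum.distrib sum_divide_distrib)
  also have "\<dots> \<le> (1 + (\<integral>\<omega>. Y \<omega> ^ 4 \<partial>M)) / 2
      + (24 * (\<integral>\<omega>. \<xi> (\<phi> \<omega>) (\<psi> \<omega>) ^ 4 \<partial>M) + (\<integral>\<omega>. \<zeta> (\<phi> \<omega>) (\<psi> \<omega>) ^ 4 \<partial>M) / 16) / 2"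
    unfolding y_def by (intro add_mono divide_right_mono sum_Y\<^sub>G_increments U_sum_bound) auto
  finally show ?thesis
    by (simp add: y_def add_divide_distrib)
qed

end

context two_filtrations
begin

lemma labelled_exists:
  assumes \<phi>: "\<phi> \<in> A \<rightarrow>\<^sub>M count_space UNIV" "finite (\<phi> ` space M)"
    and \<psi>: "\<psi> \<in> B \<rightarrow>\<^sub>M count_space UNIV" "finite (\<psi> ` space M)"
  shows "\<exists>g h. labelled M F G A B \<phi> \<psi> g h"
proof -
  obtain g where g: "\<And>k. conditional_distribution A (F k) \<phi> (g k)"
    using finite_conditional_distribution[OF F A \<phi> cond_A] by metis
  obtain h where h: "\<And>k. conditional_distribution B (G k) \<psi> (h k)"
    using finite_conditional_distribution[OF G B \<psi> cond_B] by metis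
  have "labelled M F G A B \<phi> \<psi> g h"
    using assms g h by unfold_locales
  then show ?thesis by blast
qed

end

section \<open>Step functions are dense in \<open>L\<^sup>4\<close>\<close>

lemma power4_add_le: "(a + b) ^ 4 \<le> 8 * (a ^ 4 + b ^ 4)" for a b :: real
proof -
  have *: "(u + v)\<^sup>2 \<le> 2 * (u\<^sup>2 + v\<^sup>2)" for u v :: real
    using zero_le_power2[of "u - v"] by (simp add: power2_sum power2_diff)
  have "(a + b) ^ 4 = ((a + b)\<^sup>2)\<^sup>2" by simp
  also have "\<dots> \<le> (2 * (a\<^sup>2 + b\<^sup>2))\<^sup>2"
    by (intro power_mono *) simp
  also have "\<dots> \<le> 4 * (2 * ((a\<^sup>2)\<^sup>2 + (b\<^sup>2)\<^sup>2))"
    unfolding power_mult_distrib using *[of "a\<^sup>2" "b\<^sup>2"] by simp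
  finally show ?thesis by simp
qed

context prob_space
begin

lemma
  assumes [measurable]: "f \<in> borel_measurable M" "g \<in> borel_measurable M"
    and i: "integrable M (\<lambda>\<omega>. f \<omega> ^ 4 :: real)" "integrable M (\<lambda>\<omega>. g \<omega> ^ 4)"
  shows integrable_power4_add: "integrable M (\<lambda>\<omega>. (f \<omega> + g \<omega>) ^ 4)"
    and integral_power4_add: "(\<integral>\<omega>. (f \<omega> + g \<omega>) ^ 4 \<partial>M) \<le> 8 * ((\<integral>\<omega>. f \<omega> ^ 4 \<partial>M) + (\<integral>\<omega>. g \<omega> ^ 4 \<partial>M))"
proof -
  have "integrable M (\<lambda>\<omega>. 8 * (f \<omega> ^ 4 + g \<omega> ^ 4))"
    using i by simp
  then show *: "integrable M (\<lambda>\<omega>. (f \<omega> + g \<omega>) ^ 4)"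
    by (rule Bochner_Integration.integrable_bound)
       (use power4_add_le in \<open>auto intro!: AE_I2 simp del: distrib_left_numeral\<close>)
  have "(\<integral>\<omega>. (f \<omega> + g \<omega>) ^ 4 \<partial>M) \<le> (\<integral>\<omega>. 8 * (f \<omega> ^ 4 + g \<omega> ^ 4) \<partial>M)"
    using * i by (intro integral_mono power4_add_le) auto
  then show "(\<integral>\<omega>. (f \<omega> + g \<omega>) ^ 4 \<partial>M) \<le> 8 * ((\<integral>\<omega>. f \<omega> ^ 4 \<partial>M) + (\<integral>\<omega>. g \<omega> ^ 4 \<partial>M))"
    using i by simp
qed

lemma integrable_power4_diff:
  assumes "f \<in> borel_measurable M" "g \<in> borel_measurable M"
    and "integrable M (\<lambda>\<omega>. f \<omega> ^ 4 :: real)" "integrable M (\<lambda>\<omega>. g \<omega> ^ 4)"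
  shows "integrable M (\<lambda>\<omega>. (f \<omega> - g \<omega>) ^ 4)"
  using integrable_power4_add[of f "\<lambda>\<omega>. - g \<omega>"] assms by simp

text \<open>Continuity of a trilinear form in L4, with a rate in \<open>\<eta>\<close>. The exponent
  16 is chosen so that division by \<open>\<eta> ^ 12\<close> still leaves
  \<open>\<eta> ^ 4\<close>, which is at most \<open>\<eta>\<close>.\<close>

lemma integral_perturbation_le:
  fixes K a q c :: "'a \<Rightarrow> real"
  assumes [measurable]: "K \<in> borel_measurable M" "a \<in> borel_measurable M" "q \<in> borel_measurable M" "c \<in> borel_measurable M"
    and K: "\<And>\<omega>. \<omega> \<in> space M \<Longrightarrow> \<bar>K \<omega>\<bar> \<le> 1"
    and i: "integrable M (\<lambda>\<omega>. a \<omega> ^ 4)" "integrable M (\<lambda>\<omega>. q \<omega> ^ 4)" "integrable M (\<lambda>\<omega>. c \<omega> ^ 4)"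
    and \<eta>: "0 < \<eta>" "\<eta> \<le> 1" and a: "(\<integral>\<omega>. a \<omega> ^ 4 \<partial>M) \<le> \<eta> ^ 16"
  shows "\<bar>\<integral>\<omega>. K \<omega> * (a \<omega> * q \<omega> * c \<omega>) \<partial>M\<bar> \<le> \<eta> * (2 + (\<integral>\<omega>. q \<omega> ^ 4 \<partial>M) + (\<integral>\<omega>. c \<omega> ^ 4 \<partial>M)) / 4"
proof -
  have e: "\<eta> ^ 4 \<le> \<eta>" using power_decreasing[of 1 4 \<eta>] \<eta> by simp
  have i2: "integrable M (\<lambda>\<omega>. (a \<omega> ^ 4 / \<eta> ^ 12 + \<eta> * q \<omega> ^ 4 + \<eta> * c \<omega> ^ 4 + \<eta>) / 4)"
    using i by simp
  have le: "\<bar>K \<omega> * (a \<omega> * q \<omega> * c \<omega>)\<bar> \<le> (a \<omega> ^ 4 / \<eta> ^ 12 + \<eta> * q \<omega> ^ 4 + \<eta> * c \<omega> ^ 4 + \<eta>) / 4"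
    if "\<omega> \<in> space M" for \<omega>
  proof -
    have "\<bar>K \<omega> * (a \<omega> * q \<omega> * c \<omega>)\<bar> \<le> 1 * \<bar>a \<omega> * q \<omega> * c \<omega>\<bar>"
      unfolding abs_mult[of "K \<omega>"] by (intro mult_right_mono K that) simp
    \<comment> \<open>the scaling puts all the weight on the small factor \<open>a\<close>\<close>
    also have "1 * \<bar>a \<omega> * q \<omega> * c \<omega>\<bar> = \<bar>a \<omega> / \<eta> ^ 3 * (\<eta> * q \<omega>) * (\<eta> * c \<omega>) * \<eta>\<bar>"
      using \<eta> by (simp add: field_simps power3_eq_cube)
    also have "\<dots> \<le> ((a \<omega> / \<eta> ^ 3) ^ 4 + (\<eta> * q \<omega>) ^ 4 + (\<eta> * c \<omega>) ^ 4 + \<eta> ^ 4) / 4"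
      by (rule abs_prod4_le)
    also have "\<dots> \<le> (a \<omega> ^ 4 / \<eta> ^ 12 + \<eta> * q \<omega> ^ 4 + \<eta> * c \<omega> ^ 4 + \<eta>) / 4"
      unfolding power_divide power_mult_distrib power_mult[symmetric]
      by (intro divide_right_mono add_mono mult_right_mono e) auto
    finally show ?thesis .
  qed
  have "\<bar>\<integral>\<omega>. K \<omega> * (a \<omega> * q \<omega> * c \<omega>) \<partial>M\<bar> \<le> (\<integral>\<omega>. (a \<omega> ^ 4 / \<eta> ^ 12 + \<eta> * q \<omega> ^ 4 + \<eta> * c \<omega> ^ 4 + \<eta>) / 4 \<partial>M)"
  proof (rule integral_abs_bound[THEN order_trans])
    show "(\<integral>\<omega>. \<bar>K \<omega> * (a \<omega> * q \<omega> * c \<omega>)\<bar> \<partial>M) \<le> (\<integral>\<omega>. (a \<omega> ^ 4 / \<eta> ^ 12 + \<eta> * q \<omega> ^ 4 + \<eta> * c \<omega> ^ 4 + \<eta>) / 4 \<partial>M)"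
      using le by (intro integral_mono i2 Bochner_Integration.integrable_bound[OF i2] AE_I2)
        (auto intro: order_trans[OF _ abs_ge_self])
  qed
  also have "\<dots> = ((\<integral>\<omega>. a \<omega> ^ 4 \<partial>M) / \<eta> ^ 12 + \<eta> * (\<integral>\<omega>. q \<omega> ^ 4 \<partial>M) + \<eta> * (\<integral>\<omega>. c \<omega> ^ 4 \<partial>M) + \<eta>) / 4"
    using i by (simp add: prob_space)
  also have "(\<integral>\<omega>. a \<omega> ^ 4 \<partial>M) / \<eta> ^ 12 \<le> \<eta> ^ 16 / \<eta> ^ 12"
    using a \<eta> by (intro divide_right_mono) auto
  also have "\<eta> ^ 16 / \<eta> ^ 12 \<le> \<eta>"
    using e \<eta> by (simp add: power_diff[symmetric])
  finally show ?thesis by (simp add: algebra_simps)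
qed

end

context two_filtrations
begin

text \<open>Finite combinations of indicators of rectangles, encoded by labels because the locale
  \<open>labelled\<close> is stated in terms of them.\<close>

definition step_function :: "('a \<Rightarrow> real) \<Rightarrow> bool" where
  "step_function f \<longleftrightarrow> (\<exists>\<phi> \<psi> \<xi>. \<phi> \<in> A \<rightarrow>\<^sub>M count_space UNIV \<and> finite (\<phi> ` space M) \<and>
     \<psi> \<in> B \<rightarrow>\<^sub>M count_space UNIV \<and> finite (\<psi> ` space M) \<and>
     (\<forall>\<omega>\<in>space M. f \<omega> = \<xi> (\<phi> \<omega> :: nat) (\<psi> \<omega> :: nat)))"

text \<open>A common refinement: the two labels of each coordinate are merged by
  \<open>prod_encode\<close>. It is needed because \<open>X\<close> and \<open>Z\<close> have to
  share one pair of labels.\<close>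

lemma step_function_common:
  assumes "step_function f" "step_function f'"
  shows "\<exists>\<phi> \<psi> \<xi> \<zeta>. \<phi> \<in> A \<rightarrow>\<^sub>M count_space UNIV \<and> finite (\<phi> ` space M) \<and>
     \<psi> \<in> B \<rightarrow>\<^sub>M count_space UNIV \<and> finite (\<psi> ` space M) \<and>
     (\<forall>\<omega>\<in>space M. f \<omega> = \<xi> (\<phi> \<omega> :: nat) (\<psi> \<omega> :: nat) \<and> f' \<omega> = \<zeta> (\<phi> \<omega>) (\<psi> \<omega>))"
proof -
  obtain \<phi> \<psi> :: "'a \<Rightarrow> nat" and \<xi> where 1[measurable]: "\<phi> \<in> A \<rightarrow>\<^sub>M count_space UNIV" "\<psi> \<in> B \<rightarrow>\<^sub>M count_space UNIV"
    and 2: "finite (\<phi> ` space M)" "finite (\<psi> ` space M)" "\<forall>\<omega>\<in>space M. f \<omega> = \<xi> (\<phi> \<omega>) (\<psi> \<omega>)"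
    using assms(1) unfolding step_function_def by auto
  obtain \<phi>' \<psi>' :: "'a \<Rightarrow> nat" and \<zeta> where 3[measurable]: "\<phi>' \<in> A \<rightarrow>\<^sub>M count_space UNIV" "\<psi>' \<in> B \<rightarrow>\<^sub>M count_space UNIV"
    and 4: "finite (\<phi>' ` space M)" "finite (\<psi>' ` space M)" "\<forall>\<omega>\<in>space M. f' \<omega> = \<zeta> (\<phi>' \<omega>) (\<psi>' \<omega>)"
    using assms(2) unfolding step_function_def by auto
  have fin: "finite ((\<lambda>\<omega>. prod_encode (\<alpha> \<omega>, \<beta> \<omega>)) ` space M)"
    if "finite (\<alpha> ` space M)" "finite (\<beta> ` space M)" for \<alpha> \<beta>
    by (rule finite_subset[of _ "prod_encode ` (\<alpha> ` space M \<times> \<beta> ` space M)"]) (use that in auto)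
  show ?thesis
    by (intro exI[of _ "\<lambda>\<omega>. prod_encode (\<phi> \<omega>, \<phi>' \<omega>)"] exI[of _ "\<lambda>\<omega>. prod_encode (\<psi> \<omega>, \<psi>' \<omega>)"]
          exI[of _ "\<lambda>i j. \<xi> (fst (prod_decode i)) (fst (prod_decode j))"]
          exI[of _ "\<lambda>i j. \<zeta> (snd (prod_decode i)) (snd (prod_decode j))"] conjI)
       (use 2 4 fin in auto)
qed

lemma step_function_combine:
  assumes "step_function f" "step_function f'"
  shows "step_function (\<lambda>\<omega>. c (f \<omega>) (f' \<omega>))"
proof -
  obtain \<phi> \<psi> :: "'a \<Rightarrow> nat" and \<xi> \<zeta> where *: "\<phi> \<in> A \<rightarrow>\<^sub>M count_space UNIV" "finite (\<phi> ` space M)"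
    "\<psi> \<in> B \<rightarrow>\<^sub>M count_space UNIV" "finite (\<psi> ` space M)"
    "\<forall>\<omega>\<in>space M. f \<omega> = \<xi> (\<phi> \<omega>) (\<psi> \<omega>) \<and> f' \<omega> = \<zeta> (\<phi> \<omega>) (\<psi> \<omega>)"
    using step_function_common[OF assms] by auto
  show ?thesis
    unfolding step_function_def
    by (intro exI[of _ \<phi>] exI[of _ \<psi>] exI[of _ "\<lambda>i j. c (\<xi> i j) (\<zeta> i j)"]) (use * in auto)
qed

lemma step_function_rectangle:
  assumes [measurable]: "E \<in> sets A" "E' \<in> sets B"
  shows "step_function (indicator (E \<inter> E'))"
  unfolding step_function_def
proof (intro exI conjI ballI)
  show "(\<lambda>\<omega>. if \<omega> \<in> E then 1 else 0 :: nat) \<in> A \<rightarrow>\<^sub>M count_space UNIV"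
    "(\<lambda>\<omega>. if \<omega> \<in> E' then 1 else 0 :: nat) \<in> B \<rightarrow>\<^sub>M count_space UNIV" by measurable
  show "finite ((\<lambda>\<omega>. if \<omega> \<in> E then 1 else 0 :: nat) ` space M)" "finite ((\<lambda>\<omega>. if \<omega> \<in> E' then 1 else 0 :: nat) ` space M)"
    by (rule finite_subset[of _ "{0, 1}"]; auto)+
  show "indicator (E \<inter> E') \<omega> = (\<lambda>i j. real (i * j)) (if \<omega> \<in> E then 1 else 0) (if \<omega> \<in> E' then 1 else 0)" for \<omega>
    by auto
qed

lemma step_function_const: "step_function (\<lambda>_. c)"
  unfolding step_function_def
  by (intro exI[of _ "\<lambda>_. 0"] exI[of _ "\<lambda>_ _. c"]) (auto intro: finite_subset[of _ "{0}"])

lemma step_function_bounded: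
  assumes "step_function f"
  shows "bounded_measurable M f"
proof -
  obtain \<phi> \<psi> :: "'a \<Rightarrow> nat" and \<xi> where 1: "\<phi> \<in> A \<rightarrow>\<^sub>M count_space UNIV" "\<psi> \<in> B \<rightarrow>\<^sub>M count_space UNIV"
    and 2: "finite (\<phi> ` space M)" "finite (\<psi> ` space M)" "\<forall>\<omega>\<in>space M. f \<omega> = \<xi> (\<phi> \<omega>) (\<psi> \<omega>)"
    using assms unfolding step_function_def by auto
  obtain g h where "labelled M F G A B \<phi> \<psi> g h"
    using labelled_exists[OF 1(1) 2(1) 1(2) 2(2)] by blast
  then interpret labelled M F G A B \<phi> \<psi> \<xi> \<xi> g h .
  show ?thesis
    by (rule bounded_measurable_cong[OF bounded_measurable_label]) (use 2 in simp)
qed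

lemma step_function_power4:
  assumes "step_function f"
  shows "f \<in> borel_measurable M" "integrable M (\<lambda>\<omega>. f \<omega> ^ 4)"
  using step_function_bounded[OF assms]
  by (auto intro: bounded_measurable_measurable bounded_measurable_integrable bounded_intros)

definition approximable :: "('a \<Rightarrow> real) \<Rightarrow> bool" where
  "approximable f \<longleftrightarrow> f \<in> borel_measurable M \<and> integrable M (\<lambda>\<omega>. f \<omega> ^ 4) \<and>
     (\<forall>\<epsilon>>0. \<exists>s. step_function s \<and> (\<integral>\<omega>. (f \<omega> - s \<omega>) ^ 4 \<partial>M) < \<epsilon>)"

lemma approximable_cong:
  assumes "approximable f" "\<And>\<omega>. \<omega> \<in> space M \<Longrightarrow> f \<omega> = g \<omega>"
  shows "approximable g"
proof -
  have "(\<integral>\<omega>. (g \<omega> - s \<omega>) ^ 4 \<partial>M) = (\<integral>\<omega>. (f \<omega> - s \<omega>) ^ 4 \<partial>M)" for s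
    using assms(2) by (intro Bochner_Integration.integral_cong) auto
  moreover have "integrable M (\<lambda>\<omega>. g \<omega> ^ 4) \<longleftrightarrow> integrable M (\<lambda>\<omega>. f \<omega> ^ 4)"
    using assms(2) by (intro Bochner_Integration.integrable_cong) auto
  moreover have "g \<in> borel_measurable M \<longleftrightarrow> f \<in> borel_measurable M"
    using assms(2) by (intro measurable_cong) auto
  ultimately show ?thesis using assms(1) by (simp add: approximable_def)
qed

lemma approximable_step: "step_function f \<Longrightarrow> approximable f"
  unfolding approximable_def by (auto dest: step_function_power4)

lemma approximable_close:
  assumes f: "f \<in> borel_measurable M" "integrable M (\<lambda>\<omega>. f \<omega> ^ 4)"
    and ex: "\<And>\<epsilon>. 0 < \<epsilon> \<Longrightarrow> \<exists>g. approximable g \<and> (\<integral>\<omega>. (f \<omega> - g \<omega>) ^ 4 \<partial>M) < \<epsilon>"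
  shows "approximable f"
  unfolding approximable_def
proof (intro conjI allI impI f)
  fix \<epsilon> :: real assume "0 < \<epsilon>"
  \<comment> \<open>Two errors below \<epsilon> / 16, multiplied by the factor 8 of
    \<open>integral_power4_add\<close>, add up to less than \<epsilon>.\<close>
  then have \<epsilon>: "0 < \<epsilon> / 16" by simp
  obtain g where g: "approximable g" "(\<integral>\<omega>. (f \<omega> - g \<omega>) ^ 4 \<partial>M) < \<epsilon> / 16"
    using ex[OF \<epsilon>] by blast
  then obtain s where s: "step_function s" "(\<integral>\<omega>. (g \<omega> - s \<omega>) ^ 4 \<partial>M) < \<epsilon> / 16"
    unfolding approximable_def using \<epsilon> by blast
  note [measurable] = f(1) step_function_power4(1)[OF s(1)]
  have [measurable]: "g \<in> borel_measurable M" and g4: "integrable M (\<lambda>\<omega>. g \<omega> ^ 4)"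
    using g(1) by (auto simp: approximable_def)
  have "(\<integral>\<omega>. (f \<omega> - s \<omega>) ^ 4 \<partial>M) = (\<integral>\<omega>. ((f \<omega> - g \<omega>) + (g \<omega> - s \<omega>)) ^ 4 \<partial>M)"
    by simp
  also have "\<dots> \<le> 8 * ((\<integral>\<omega>. (f \<omega> - g \<omega>) ^ 4 \<partial>M) + (\<integral>\<omega>. (g \<omega> - s \<omega>) ^ 4 \<partial>M))"
    using f g4 step_function_power4(2)[OF s(1)] by (intro integral_power4_add integrable_power4_diff) measurable
  also have "\<dots> < \<epsilon>" using g(2) s(2) by simp
  finally show "\<exists>s. step_function s \<and> (\<integral>\<omega>. (f \<omega> - s \<omega>) ^ 4 \<partial>M) < \<epsilon>"
    using s(1) by blast
qed

lemma approximable_add: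
  assumes "approximable f" "approximable g"
  shows "approximable (\<lambda>\<omega>. f \<omega> + g \<omega>)"
proof -
  have [measurable]: "f \<in> borel_measurable M" "g \<in> borel_measurable M"
    and i: "integrable M (\<lambda>\<omega>. f \<omega> ^ 4)" "integrable M (\<lambda>\<omega>. g \<omega> ^ 4)"
    using assms by (auto simp: approximable_def)
  show ?thesis
  proof (rule approximable_close)
    fix \<epsilon> :: real assume "0 < \<epsilon>"
    then have \<epsilon>: "0 < \<epsilon> / 16" by simp
    obtain s r where s: "step_function s" "(\<integral>\<omega>. (f \<omega> - s \<omega>) ^ 4 \<partial>M) < \<epsilon> / 16"
      and r: "step_function r" "(\<integral>\<omega>. (g \<omega> - r \<omega>) ^ 4 \<partial>M) < \<epsilon> / 16"
      using assms \<epsilon> unfolding approximable_def by meson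
    note [measurable] = step_function_power4(1)[OF s(1)] step_function_power4(1)[OF r(1)]
    have "(\<integral>\<omega>. (f \<omega> + g \<omega> - (s \<omega> + r \<omega>)) ^ 4 \<partial>M) = (\<integral>\<omega>. ((f \<omega> - s \<omega>) + (g \<omega> - r \<omega>)) ^ 4 \<partial>M)"
      by (simp add: algebra_simps)
    also have "\<dots> \<le> 8 * ((\<integral>\<omega>. (f \<omega> - s \<omega>) ^ 4 \<partial>M) + (\<integral>\<omega>. (g \<omega> - r \<omega>) ^ 4 \<partial>M))"
      using i step_function_power4(2)[OF s(1)] step_function_power4(2)[OF r(1)]
      by (intro integral_power4_add integrable_power4_diff) measurable
    also have "\<dots> < \<epsilon>" using s(2) r(2) by simp
    finally show "\<exists>u. approximable u \<and> (\<integral>\<omega>. (f \<omega> + g \<omega> - u \<omega>) ^ 4 \<partial>M) < \<epsilon>"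
      using approximable_step[OF step_function_combine[OF s(1) r(1), of "(+)"]] by blast
  qed (use integrable_power4_add i in auto)
qed

lemma approximable_cmult:
  assumes "approximable f"
  shows "approximable (\<lambda>\<omega>. c * f \<omega>)"
proof (cases "c = 0")
  case True
  then show ?thesis using approximable_step[OF step_function_const[of 0]] by simp
next
  case False
  have [measurable]: "f \<in> borel_measurable M" and i: "integrable M (\<lambda>\<omega>. f \<omega> ^ 4)"
    using assms by (auto simp: approximable_def)
  show ?thesis
  proof (rule approximable_close)
    fix \<epsilon> :: real assume "0 < \<epsilon>"
    with False have \<epsilon>: "0 < \<epsilon> / c ^ 4" by simp
    then obtain s where s: "step_function s" "(\<integral>\<omega>. (f \<omega> - s \<omega>) ^ 4 \<partial>M) < \<epsilon> / c ^ 4"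
      using assms unfolding approximable_def by meson
    have "(\<integral>\<omega>. (c * f \<omega> - c * s \<omega>) ^ 4 \<partial>M) = c ^ 4 * (\<integral>\<omega>. (f \<omega> - s \<omega>) ^ 4 \<partial>M)"
      by (simp add: right_diff_distrib[symmetric] power_mult_distrib)
    also have "\<dots> < \<epsilon>" using s(2) False by (simp add: field_simps)
    finally show "\<exists>u. approximable u \<and> (\<integral>\<omega>. (c * f \<omega> - u \<omega>) ^ 4 \<partial>M) < \<epsilon>"
      using approximable_step[OF step_function_combine[OF s(1) s(1), of "\<lambda>x _. c * x"]] by blast
  qed (use i in \<open>auto simp: power_mult_distrib\<close>)
qed

text \<open>Dominated convergence: the error \<open>f \<omega> - U n \<omega>\<close> lies between 0
  and \<open>f \<omega>\<close>, so its fourth power is dominated by that of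
  \<open>f\<close>.\<close>

lemma approximable_seq:
  assumes [measurable]: "f \<in> borel_measurable M" and f4: "integrable M (\<lambda>\<omega>. f \<omega> ^ 4)"
    and U: "\<And>n. approximable (U n)" and le: "\<And>n \<omega>. \<omega> \<in> space M \<Longrightarrow> 0 \<le> U n \<omega> \<and> U n \<omega> \<le> f \<omega>"
    and lim: "\<And>\<omega>. \<omega> \<in> space M \<Longrightarrow> (\<lambda>n. U n \<omega>) \<longlonglongrightarrow> f \<omega>"
  shows "approximable f"
proof (rule approximable_close)
  fix \<epsilon> :: real assume \<epsilon>: "0 < \<epsilon>"
  have [measurable]: "U n \<in> borel_measurable M" for n
    using U by (auto simp: approximable_def)
  have "(\<lambda>n. \<integral>\<omega>. (f \<omega> - U n \<omega>) ^ 4 \<partial>M) \<longlonglongrightarrow> (\<integral>\<omega>. 0 \<partial>M)"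
  proof (rule integral_dominated_convergence[where w = "\<lambda>\<omega>. f \<omega> ^ 4"])
    show "AE \<omega> in M. (\<lambda>n. (f \<omega> - U n \<omega>) ^ 4) \<longlonglongrightarrow> 0"
      using lim by (intro AE_I2) (auto intro!: tendsto_eq_intros)
    show "AE \<omega> in M. norm ((f \<omega> - U n \<omega>) ^ 4) \<le> f \<omega> ^ 4" for n
    proof (rule AE_I2)
      fix \<omega> assume "\<omega> \<in> space M"
      with le[of \<omega> n] have "(f \<omega> - U n \<omega>) ^ 4 \<le> f \<omega> ^ 4"
        by (intro power_mono) auto
      then show "norm ((f \<omega> - U n \<omega>) ^ 4) \<le> f \<omega> ^ 4" by simp
    qed
  qed (use f4 in auto)
  then have "eventually (\<lambda>n. (\<integral>\<omega>. (f \<omega> - U n \<omega>) ^ 4 \<partial>M) < \<epsilon>) sequentially"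
    using \<epsilon> by (intro order_tendstoD(2)) auto
  then obtain n where "(\<integral>\<omega>. (f \<omega> - U n \<omega>) ^ 4 \<partial>M) < \<epsilon>"
    by (auto simp: eventually_sequentially)
  then show "\<exists>u. approximable u \<and> (\<integral>\<omega>. (f \<omega> - u \<omega>) ^ 4 \<partial>M) < \<epsilon>"
    using U by blast
qed (use assms in auto)

text \<open>Dynkin's argument from the rectangles in \<open>generates\<close>. They are stable under
  intersection, and approximability passes to complements and to countable disjoint unions, whose
  indicators are increasing limits of finite sums.\<close>

lemma approximable_indicator:
  assumes "E \<in> sets M"
  shows "approximable (indicator E)"
proof -
  let ?R = "{E \<inter> E' | E E'. E \<in> sets A \<and> E' \<in> sets B}"
  have "Int_stable ?R"
  proof (rule Int_stableI, safe)
    fix a b a' b' assume "a \<in> sets A" "b \<in> sets B" "a' \<in> sets A" "b' \<in> sets B"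
    then show "\<exists>E E'. a \<inter> b \<inter> (a' \<inter> b') = E \<inter> E' \<and> E \<in> sets A \<and> E' \<in> sets B"
      by (intro exI[of _ "a \<inter> a'"] exI[of _ "b \<inter> b'"]) auto
  qed
  moreover have "?R \<subseteq> Pow (space M)"
    using sets.sets_into_space[of _ A] by (auto simp: space_eq)
  ultimately show ?thesis
    using assms[unfolded generates]
  proof (induction rule: sigma_sets_induct_disjoint)
    case (basic E)
    then show ?case by (auto intro: approximable_step step_function_rectangle)
  next
    case empty
    then show ?case using approximable_step[OF step_function_const[of 0]] by (simp add: indicator_def[abs_def])
  next
    case (compl E)
    have "approximable (\<lambda>\<omega>. 1 + -1 * indicator E \<omega>)"
      by (intro approximable_add approximable_cmult compl approximable_step[OF step_function_const])
    then show ?case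
      by (rule approximable_cong) (auto split: split_indicator)
  next
    case (union E)
    have [measurable]: "E i \<in> sets M" for i
      using union(2) generates by auto
    have s: "(\<Sum>i<n. indicator (E i) \<omega>) = (indicator (\<Union>i<n. E i) \<omega> :: real)" for n \<omega>
      using union(1) by (subst indicator_UN_disjoint) (auto simp: disjoint_family_on_def)
    have a: "approximable (\<lambda>\<omega>. \<Sum>i<n. indicator (E i) \<omega>)" for n
      by (induction n) (auto intro!: approximable_add union(3) approximable_step[OF step_function_const])
    show ?case
    proof (rule approximable_seq[OF _ _ a])
      show "integrable M (\<lambda>\<omega>. indicator (\<Union> (range E)) \<omega> ^ 4 :: real)"
        by (intro integrable_const_bound[of _ 1]) (auto split: split_indicator)
      show "(\<lambda>n. \<Sum>i<n. indicator (E i) \<omega>) \<longlonglongrightarrow> (indicator (\<Union> (range E)) \<omega> :: real)" for \<omega>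
        unfolding s by (rule LIMSEQ_indicator_UN)
    qed (auto simp: s split: split_indicator)
  qed
qed

end

context two_filtrations
begin

lemma approximable_nonneg:
  assumes f: "f \<in> borel_measurable M" "\<And>\<omega>. 0 \<le> f \<omega>" and f4: "integrable M (\<lambda>\<omega>. f \<omega> ^ 4)"
  shows "approximable f"
  using f f4
proof (induction rule: borel_measurable_induct_real)
  case (set E)
  then show ?case by (intro approximable_indicator)
next
  case (mult u c)
  show ?case
  proof (cases "c = 0")
    case True
    then show ?thesis using approximable_step[OF step_function_const[of 0]] by simp
  next
    case False
    then show ?thesis
      using mult by (intro approximable_cmult) (simp add: power_mult_distrib)
  qed
next
  case (add u v)
  have "integrable M (\<lambda>\<omega>. u \<omega> ^ 4)" "integrable M (\<lambda>\<omega>. v \<omega> ^ 4)"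
    by (rule Bochner_Integration.integrable_bound[OF add.prems]; use add.hyps in \<open>auto intro!: AE_I2 power_mono\<close>)+
  then show ?case using add by (intro approximable_add)
next
  case (seq U)
  have le: "U n \<omega> \<le> f \<omega>" if "\<omega> \<in> space M" for n \<omega>
    using seq.hyps(3,4) that by (intro incseq_le[of "\<lambda>n. U n \<omega>"]) (auto simp: incseq_def le_fun_def)
  have U4: "integrable M (\<lambda>\<omega>. U n \<omega> ^ 4)" for n
  proof (rule Bochner_Integration.integrable_bound[OF seq.prems])
    show "AE \<omega> in M. norm (U n \<omega> ^ 4) \<le> norm (f \<omega> ^ 4)"
      using le seq.hyps(2) by (intro AE_I2) (auto intro!: power_mono)
  qed (use seq.hyps(1) in auto)
  show ?case
    using seq.hyps(2,4) le seq.IH U4 f(1) seq.prems by (intro approximable_seq[of f U]) auto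
qed

lemma approximable_power4:
  assumes f: "f \<in> borel_measurable M" and f4: "integrable M (\<lambda>\<omega>. f \<omega> ^ 4)"
  shows "approximable f"
proof -
  have *: "approximable (\<lambda>\<omega>. max (u \<omega>) 0)"
    if [measurable]: "u \<in> borel_measurable M" and u4: "integrable M (\<lambda>\<omega>. u \<omega> ^ 4)" for u
  proof (rule approximable_nonneg)
    have "\<bar>max (u \<omega>) 0\<bar> ^ 4 \<le> \<bar>u \<omega>\<bar> ^ 4" for \<omega>
      by (rule power_mono) auto
    then show "integrable M (\<lambda>\<omega>. max (u \<omega>) 0 ^ 4)"
      by (intro Bochner_Integration.integrable_bound[OF u4] AE_I2) (auto simp: power_abs)
  qed auto
  have "approximable (\<lambda>\<omega>. max (f \<omega>) 0)" "approximable (\<lambda>\<omega>. max (- f \<omega>) 0)"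
    using f f4 by (auto intro!: *)
  then have "approximable (\<lambda>\<omega>. max (f \<omega>) 0 + -1 * max (- f \<omega>) 0)"
    by (intro approximable_add approximable_cmult)
  then show ?thesis by (rule approximable_cong) (simp add: max_def)
qed

lemma power4_approximation:
  assumes "f \<in> borel_measurable M" "integrable M (\<lambda>\<omega>. f \<omega> ^ 4)" "0 < \<epsilon>"
  obtains s where "step_function s" "(\<integral>\<omega>. (f \<omega> - s \<omega>) ^ 4 \<partial>M) < \<epsilon>"
  using approximable_power4[OF assms(1,2)] assms(3) by (auto simp: approximable_def)

end

section \<open>From step functions to general \<open>X\<close> and \<open>Z\<close>\<close>

context square_integrands
begin

text \<open>For fixed \<open>n\<close>, \<open>Y\<close> and \<open>K\<close>, the left side is
  continuous in \<open>X\<close> and \<open>Z\<close> for the L4 norm, so both are approximated by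
  step functions. Comparing fourth moments with those of the approximants costs a factor 8, which
  turns 12 into 96 and 1/32 into 1/4.\<close>

lemma transform_estimate:
  assumes [measurable]: "X \<in> borel_measurable M" and X4: "integrable M (\<lambda>\<omega>. X \<omega> ^ 4)"
    and X\<^sub>F: "\<And>k. X\<^sub>F k \<in> borel_measurable (F k)"
    and X\<^sub>F_cond: "\<And>k. AE \<omega> in M. real_cond_exp M (F k) X \<omega> = X\<^sub>F k \<omega>"
    and [measurable]: "Z \<in> borel_measurable M" and Z4: "integrable M (\<lambda>\<omega>. Z \<omega> ^ 4)"
  shows "(\<Sum>k<n. \<integral>\<omega>. K k \<omega> * X\<^sub>F k \<omega> * (Y\<^sub>G (Suc k) \<omega> - Y\<^sub>G k \<omega>) * Z \<omega> \<partial>M)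
    \<le> (1 + (\<integral>\<omega>. Y \<omega> ^ 4 \<partial>M)) / 2 + 96 * (\<integral>\<omega>. X \<omega> ^ 4 \<partial>M) + (\<integral>\<omega>. Z \<omega> ^ 4 \<partial>M) / 4"
proof -
  have [measurable]: "X\<^sub>F k \<in> borel_measurable M" for k
    using measurable_from_subalg[OF F X\<^sub>F] .
  have X\<^sub>F4: "integrable M (\<lambda>\<omega>. X\<^sub>F k \<omega> ^ 4)" for k
    by (rule cond_exp_power4[OF F _ _ X4 X\<^sub>F_cond]) measurable
  define y where "y k \<omega> = Y\<^sub>G (Suc k) \<omega> - Y\<^sub>G k \<omega>" for k \<omega>
  have [measurable]: "y k \<in> borel_measurable M" for k
    unfolding y_def by measurable
  have y4: "integrable M (\<lambda>\<omega>. y k \<omega> ^ 4)" for k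
    unfolding y_def by (intro integrable_power4_diff Y\<^sub>G4) measurable
  \<comment> \<open>\<open>\<eta> * c k\<close> covers the three perturbation errors
    \<open>e1\<close>, \<open>e2\<close>, \<open>e3\<close> of the k-th summand; the final 1 bounds
    the fourth moment of \<open>w\<close>. The 97 in \<open>C\<close> covers the errors 12 * 8 and 8
    / 32 in the fourth moments of the approximants. Neither depends on \<open>\<eta>\<close>, which
    can then tend to 0.\<close>
  define c where "c k = (6 + 3 * (\<integral>\<omega>. y k \<omega> ^ 4 \<partial>M) + (\<integral>\<omega>. X\<^sub>F k \<omega> ^ 4 \<partial>M) + (\<integral>\<omega>. Z \<omega> ^ 4 \<partial>M) + 1) / 4" for k
  define C where "C = (\<Sum>k<n. c k) + 97"
  have c0: "0 \<le> c k" for k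
    unfolding c_def by (intro divide_nonneg_nonneg add_nonneg_nonneg mult_nonneg_nonneg integral_nonneg_AE) auto
  have C: "0 < C"
    unfolding C_def by (intro add_nonneg_pos sum_nonneg c0) simp
  define S where "S = (\<Sum>k<n. \<integral>\<omega>. K k \<omega> * X\<^sub>F k \<omega> * y k \<omega> * Z \<omega> \<partial>M)"
  define b where "b = (1 + (\<integral>\<omega>. Y \<omega> ^ 4 \<partial>M)) / 2 + 96 * (\<integral>\<omega>. X \<omega> ^ 4 \<partial>M) + (\<integral>\<omega>. Z \<omega> ^ 4 \<partial>M) / 4"
  have main: "S \<le> b + \<eta> * C" if \<eta>: "0 < \<eta>" "\<eta> \<le> 1" for \<eta>
  proof -
    have \<eta>16: "0 < \<eta> ^ 16" "\<eta> ^ 16 \<le> \<eta>"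
      using \<eta> power_decreasing[of 1 16 \<eta>] by auto
    obtain X' where X': "step_function X'" "(\<integral>\<omega>. (X \<omega> - X' \<omega>) ^ 4 \<partial>M) < \<eta> ^ 16"
      using power4_approximation[OF _ X4 \<eta>16(1)] by auto
    obtain Z' where Z': "step_function Z'" "(\<integral>\<omega>. (Z \<omega> - Z' \<omega>) ^ 4 \<partial>M) < \<eta> ^ 16"
      using power4_approximation[OF _ Z4 \<eta>16(1)] by auto
    note [measurable] = step_function_power4(1)[OF X'(1)] step_function_power4(1)[OF Z'(1)]
    note X'4 = step_function_power4(2)[OF X'(1)] and Z'4 = step_function_power4(2)[OF Z'(1)]
    obtain \<phi> \<psi> :: "'a \<Rightarrow> nat" and \<xi> \<zeta> where lab: "\<phi> \<in> A \<rightarrow>\<^sub>M count_space UNIV" "finite (\<phi> ` space M)"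
      "\<psi> \<in> B \<rightarrow>\<^sub>M count_space UNIV" "finite (\<psi> ` space M)"
      and eq: "\<forall>\<omega>\<in>space M. X' \<omega> = \<xi> (\<phi> \<omega>) (\<psi> \<omega>) \<and> Z' \<omega> = \<zeta> (\<phi> \<omega>) (\<psi> \<omega>)"
      using step_function_common[OF X'(1) Z'(1)] by auto
    obtain g h where l: "labelled M F G A B \<phi> \<psi> g h"
      using labelled_exists[OF lab] by blast
    interpret l: labelled M F G A B \<phi> \<psi> \<xi> \<zeta> g h by fact
    define v where "v k \<omega> = l.V (g k \<omega>) (\<psi> \<omega>)" for k \<omega>
    have bv: "bounded_measurable M (v k)" for k
      unfolding v_def using F l.bounded_V_label by (rule bounded_measurable_subalgebra)
    then have [measurable]: "v k \<in> borel_measurable M" and v4: "integrable M (\<lambda>\<omega>. v k \<omega> ^ 4)" for k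
      by (auto intro: bounded_measurable_measurable bounded_measurable_integrable bounded_intros)
    have vc: "AE \<omega> in M. real_cond_exp M (F k) X' \<omega> = v k \<omega>" for k
    proof -
      interpret Fk: sigma_finite_subalgebra M "F k" by (rule subalgebra_sigma_finite[OF F])
      have "AE \<omega> in M. real_cond_exp M (F k) X' \<omega> = real_cond_exp M (F k) (\<lambda>\<omega>. \<xi> (\<phi> \<omega>) (\<psi> \<omega>)) \<omega>"
        using eq bounded_measurable_measurable[OF l.bounded_measurable_label[of \<xi>]]
        by (intro Fk.real_cond_exp_cong AE_I2) auto
      with l.cond_exp_label[of k] show ?thesis
        unfolding v_def by eventually_elim simp
    qed
    define u where "u k \<omega> = X\<^sub>F k \<omega> - v k \<omega>" for k \<omega>
    define w where "w \<omega> = Z \<omega> - Z' \<omega>" for \<omega>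
    have [measurable]: "u k \<in> borel_measurable M" "w \<in> borel_measurable M" for k
      unfolding u_def w_def by measurable
    have w4: "integrable M (\<lambda>\<omega>. w \<omega> ^ 4)" and wle: "(\<integral>\<omega>. w \<omega> ^ 4 \<partial>M) \<le> \<eta> ^ 16"
      unfolding w_def using Z' by (auto intro!: integrable_power4_diff Z4 Z'4)
    have u4: "integrable M (\<lambda>\<omega>. u k \<omega> ^ 4)" and ule: "(\<integral>\<omega>. u k \<omega> ^ 4 \<partial>M) \<le> \<eta> ^ 16" for k
    proof -
      interpret Fk: sigma_finite_subalgebra M "F k" by (rule subalgebra_sigma_finite[OF F])
      have "AE \<omega> in M. real_cond_exp M (F k) (\<lambda>\<omega>. X \<omega> - X' \<omega>) \<omega> = real_cond_exp M (F k) X \<omega> - real_cond_exp M (F k) X' \<omega>"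
        using integrable_power4[OF _ X4] integrable_power4[OF _ X'4] by (intro Fk.real_cond_exp_diff) auto
      then have *: "AE \<omega> in M. real_cond_exp M (F k) (\<lambda>\<omega>. X \<omega> - X' \<omega>) \<omega> = u k \<omega>"
        using X\<^sub>F_cond[of k] vc[of k] unfolding u_def by eventually_elim simp
      have d4: "integrable M (\<lambda>\<omega>. (X \<omega> - X' \<omega>) ^ 4)"
        by (intro integrable_power4_diff X4 X'4) measurable
      show "integrable M (\<lambda>\<omega>. u k \<omega> ^ 4)"
        by (rule cond_exp_power4(1)[OF F _ _ d4 *]) measurable
      have "(\<integral>\<omega>. u k \<omega> ^ 4 \<partial>M) \<le> (\<integral>\<omega>. (X \<omega> - X' \<omega>) ^ 4 \<partial>M)"
        by (rule cond_exp_power4(2)[OF F _ _ d4 *]) measurable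
      then show "(\<integral>\<omega>. u k \<omega> ^ 4 \<partial>M) \<le> \<eta> ^ 16" using X'(2) by simp
    qed
    have step: "(\<integral>\<omega>. K k \<omega> * X\<^sub>F k \<omega> * y k \<omega> * Z \<omega> \<partial>M) \<le> (\<integral>\<omega>. K k \<omega> * v k \<omega> * y k \<omega> * Z' \<omega> \<partial>M) + \<eta> * c k" for k
    proof -
      have i: "integrable M (\<lambda>\<omega>. K k \<omega> * (a \<omega> * b \<omega> * d \<omega>))"
        if "a \<in> borel_measurable M" "b \<in> borel_measurable M" "d \<in> borel_measurable M"
          "integrable M (\<lambda>\<omega>. a \<omega> ^ 4)" "integrable M (\<lambda>\<omega>. b \<omega> ^ 4)" "integrable M (\<lambda>\<omega>. d \<omega> ^ 4)" for a b d
        using that integrable_prod4[of a b d "\<lambda>_. 1"] by (intro integrable_bounded_mult[OF bounded_K(2)]) auto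
      define e1 where "e1 = (\<integral>\<omega>. K k \<omega> * (u k \<omega> * y k \<omega> * Z \<omega>) \<partial>M)"
      define e2 where "e2 = (\<integral>\<omega>. K k \<omega> * (w \<omega> * y k \<omega> * X\<^sub>F k \<omega>) \<partial>M)"
      define e3 where "e3 = (\<integral>\<omega>. K k \<omega> * (u k \<omega> * y k \<omega> * w \<omega>) \<partial>M)"
      \<comment> \<open>Expansion with \<open>X\<^sub>F k = v k + u k\<close> and
        \<open>Z = Z' + w\<close>. The product of both small parts occurs in each of the two
        preceding error terms, hence the subtraction.\<close>
      have "(\<integral>\<omega>. K k \<omega> * X\<^sub>F k \<omega> * y k \<omega> * Z \<omega> \<partial>M)
        = (\<integral>\<omega>. K k \<omega> * (v k \<omega> * y k \<omega> * Z' \<omega>) + K k \<omega> * (u k \<omega> * y k \<omega> * Z \<omega>)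
          + K k \<omega> * (w \<omega> * y k \<omega> * X\<^sub>F k \<omega>) - K k \<omega> * (u k \<omega> * y k \<omega> * w \<omega>) \<partial>M)"
        by (rule Bochner_Integration.integral_cong) (simp_all add: u_def w_def algebra_simps)
      also have "\<dots> = (\<integral>\<omega>. K k \<omega> * (v k \<omega> * y k \<omega> * Z' \<omega>) \<partial>M) + e1 + e2 - e3"
        unfolding e1_def e2_def e3_def
        using i[of "v k" "y k" Z'] i[of "u k" "y k" Z] i[of w "y k" "X\<^sub>F k"] i[of "u k" "y k" w]
          y4 X\<^sub>F4 Z4 u4 w4 v4 Z'4
        by (subst Bochner_Integration.integral_diff Bochner_Integration.integral_add; (intro Bochner_Integration.integrable_add)?; simp)+
      also have "\<dots> \<le> (\<integral>\<omega>. K k \<omega> * (v k \<omega> * y k \<omega> * Z' \<omega>) \<partial>M) + \<eta> * c k"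
      proof -
        have "\<bar>e1\<bar> \<le> \<eta> * (2 + (\<integral>\<omega>. y k \<omega> ^ 4 \<partial>M) + (\<integral>\<omega>. Z \<omega> ^ 4 \<partial>M)) / 4"
          unfolding e1_def using K_le u4 y4 Z4 \<eta> ule by (intro integral_perturbation_le) auto
        moreover have "\<bar>e2\<bar> \<le> \<eta> * (2 + (\<integral>\<omega>. y k \<omega> ^ 4 \<partial>M) + (\<integral>\<omega>. X\<^sub>F k \<omega> ^ 4 \<partial>M)) / 4"
          unfolding e2_def using K_le w4 y4 X\<^sub>F4 \<eta> wle by (intro integral_perturbation_le) auto
        moreover have "\<bar>e3\<bar> \<le> \<eta> * (2 + (\<integral>\<omega>. y k \<omega> ^ 4 \<partial>M) + (\<integral>\<omega>. w \<omega> ^ 4 \<partial>M)) / 4"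
          unfolding e3_def using K_le w4 y4 u4 \<eta> ule by (intro integral_perturbation_le) auto
        moreover have "\<eta> * (2 + (\<integral>\<omega>. y k \<omega> ^ 4 \<partial>M) + (\<integral>\<omega>. w \<omega> ^ 4 \<partial>M)) / 4 \<le> \<eta> * (2 + (\<integral>\<omega>. y k \<omega> ^ 4 \<partial>M) + 1) / 4"
          using wle \<eta>16 \<eta> by (intro divide_right_mono mult_left_mono add_mono) auto
        moreover have "\<eta> * c k = \<eta> * (2 + (\<integral>\<omega>. y k \<omega> ^ 4 \<partial>M) + (\<integral>\<omega>. Z \<omega> ^ 4 \<partial>M)) / 4
            + \<eta> * (2 + (\<integral>\<omega>. y k \<omega> ^ 4 \<partial>M) + (\<integral>\<omega>. X\<^sub>F k \<omega> ^ 4 \<partial>M)) / 4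
            + \<eta> * (2 + (\<integral>\<omega>. y k \<omega> ^ 4 \<partial>M) + 1) / 4"
          unfolding c_def by (simp add: field_simps)
        ultimately show ?thesis by linarith
      qed
      finally show ?thesis by (simp add: mult.assoc)
    qed
    have "S \<le> (\<Sum>k<n. (\<integral>\<omega>. K k \<omega> * v k \<omega> * y k \<omega> * Z' \<omega> \<partial>M) + \<eta> * c k)"
      unfolding S_def by (intro sum_mono step)
    also have "\<dots> = (\<Sum>k<n. \<integral>\<omega>. K k \<omega> * v k \<omega> * y k \<omega> * Z' \<omega> \<partial>M) + \<eta> * (C - 97)"
      by (simp add: sum.distrib sum_distrib_left C_def)
    also have "(\<Sum>k<n. \<integral>\<omega>. K k \<omega> * v k \<omega> * y k \<omega> * Z' \<omega> \<partial>M)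
        = (\<Sum>k<n. \<integral>\<omega>. K k \<omega> * l.V (g k \<omega>) (\<psi> \<omega>) * (Y\<^sub>G (Suc k) \<omega> - Y\<^sub>G k \<omega>) * \<zeta> (\<phi> \<omega>) (\<psi> \<omega>) \<partial>M)"
      using eq by (intro sum.cong Bochner_Integration.integral_cong) (auto simp: v_def y_def)
    also have "\<dots> \<le> (1 + (\<integral>\<omega>. Y \<omega> ^ 4 \<partial>M)) / 2
      + 12 * (\<integral>\<omega>. \<xi> (\<phi> \<omega>) (\<psi> \<omega>) ^ 4 \<partial>M) + (\<integral>\<omega>. \<zeta> (\<phi> \<omega>) (\<psi> \<omega>) ^ 4 \<partial>M) / 32"
      by (rule labelled_estimate[OF l])
    also have "(\<integral>\<omega>. \<xi> (\<phi> \<omega>) (\<psi> \<omega>) ^ 4 \<partial>M) = (\<integral>\<omega>. X' \<omega> ^ 4 \<partial>M)"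
      using eq by (intro Bochner_Integration.integral_cong) auto
    also have "(\<integral>\<omega>. \<zeta> (\<phi> \<omega>) (\<psi> \<omega>) ^ 4 \<partial>M) = (\<integral>\<omega>. Z' \<omega> ^ 4 \<partial>M)"
      using eq by (intro Bochner_Integration.integral_cong) auto
    finally have S: "S \<le> (1 + (\<integral>\<omega>. Y \<omega> ^ 4 \<partial>M)) / 2 + 12 * (\<integral>\<omega>. X' \<omega> ^ 4 \<partial>M) + (\<integral>\<omega>. Z' \<omega> ^ 4 \<partial>M) / 32 + \<eta> * (C - 97)"
      by simp
    have 8: "(\<integral>\<omega>. f' \<omega> ^ 4 \<partial>M) \<le> 8 * ((\<integral>\<omega>. f \<omega> ^ 4 \<partial>M) + \<eta>)"
      if [measurable]: "f \<in> borel_measurable M" "f' \<in> borel_measurable M"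
        and "integrable M (\<lambda>\<omega>. f \<omega> ^ 4)" "integrable M (\<lambda>\<omega>. f' \<omega> ^ 4)"
        and le: "(\<integral>\<omega>. (f \<omega> - f' \<omega>) ^ 4 \<partial>M) < \<eta> ^ 16" for f f'
    proof -
      have "(\<integral>\<omega>. f' \<omega> ^ 4 \<partial>M) = (\<integral>\<omega>. (f \<omega> + (f' \<omega> - f \<omega>)) ^ 4 \<partial>M)" by simp
      also have "\<dots> \<le> 8 * ((\<integral>\<omega>. f \<omega> ^ 4 \<partial>M) + (\<integral>\<omega>. (f' \<omega> - f \<omega>) ^ 4 \<partial>M))"
        using that by (intro integral_power4_add integrable_power4_diff) auto
      also have "(\<integral>\<omega>. (f' \<omega> - f \<omega>) ^ 4 \<partial>M) = (\<integral>\<omega>. (f \<omega> - f' \<omega>) ^ 4 \<partial>M)"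
      proof (rule Bochner_Integration.integral_cong[OF refl])
        show "(f' \<omega> - f \<omega>) ^ 4 = (f \<omega> - f' \<omega>) ^ 4" for \<omega>
          using power_minus_even[of 4 "f \<omega> - f' \<omega>"] by simp
      qed
      also have "8 * ((\<integral>\<omega>. f \<omega> ^ 4 \<partial>M) + \<dots>) \<le> 8 * ((\<integral>\<omega>. f \<omega> ^ 4 \<partial>M) + \<eta>)"
        using le \<eta>16 by simp
      finally show ?thesis .
    qed
    have "(\<integral>\<omega>. X' \<omega> ^ 4 \<partial>M) \<le> 8 * ((\<integral>\<omega>. X \<omega> ^ 4 \<partial>M) + \<eta>)" "(\<integral>\<omega>. Z' \<omega> ^ 4 \<partial>M) \<le> 8 * ((\<integral>\<omega>. Z \<omega> ^ 4 \<partial>M) + \<eta>)"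
      by (intro 8 X4 X'4 X'(2) Z4 Z'4 Z'(2); measurable)+
    then show ?thesis
      using S \<eta> unfolding b_def by (simp add: algebra_simps)
  qed
  have "S \<le> b"
  proof (rule field_le_epsilon)
    fix e :: real assume "0 < e"
    then have "0 < min 1 (e / C)" using C by simp
    from main[OF this] have "S \<le> b + min 1 (e / C) * C" by simp
    also have "min 1 (e / C) * C \<le> e / C * C"
      using C by (intro mult_right_mono) auto
    finally show "S \<le> b + e" using C by simp
  qed
  then show ?thesis unfolding S_def b_def y_def .
qed

end

section \<open>Increments of the product\<close>

context two_filtrations
begin

text \<open>In the second sum \<open>Y\<^sub>G (Suc k)\<close> is the integrand against the
  increments of \<open>X\<^sub>F\<close>. After exchanging the coordinates it has to be adapted to
  the integrand's filtration at index \<open>k\<close>, which is therefore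
  \<open>G (Suc k)\<close>.\<close>

lemma swap_shift: "two_filtrations M (\<lambda>k. G (Suc k)) F B A"
proof -
  have "{E \<inter> E' | E E'. E \<in> sets A \<and> E' \<in> sets B} = {E \<inter> E' | E E'. E \<in> sets B \<and> E' \<in> sets A}"
    by blast
  then show ?thesis
    using F G F_mono G_mono A_G B_F cond_A cond_B generates by unfold_locales auto
qed

text \<open>\<open>Z\<close> is the extremal dual element: the mean of \<open>W * Z\<close> and the
  fourth moment of \<open>Z\<close> both equal the mean of
  \<open>\<bar>W\<bar> powr (4 / 3)\<close>. \<open>K k\<close> has to be known to both filtrations,
  since \<open>G k\<close> is used in the first sum and \<open>F k\<close> in the second.\<close>

lemma product_increments_estimate:
  fixes K X\<^sub>F Y\<^sub>G :: "nat \<Rightarrow> 'a \<Rightarrow> real" and n :: nat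
  assumes X[measurable]: "X \<in> borel_measurable M" and X4: "integrable M (\<lambda>\<omega>. X \<omega> ^ 4)"
    and X\<^sub>F: "\<And>k. X\<^sub>F k \<in> borel_measurable (F k)"
    and X\<^sub>F_cond: "\<And>k. AE \<omega> in M. real_cond_exp M (F k) X \<omega> = X\<^sub>F k \<omega>"
    and Y[measurable]: "Y \<in> borel_measurable M" and Y4: "integrable M (\<lambda>\<omega>. Y \<omega> ^ 4)"
    and Y\<^sub>G: "\<And>k. Y\<^sub>G k \<in> borel_measurable (G k)"
    and Y\<^sub>G_cond: "\<And>k. AE \<omega> in M. real_cond_exp M (G k) Y \<omega> = Y\<^sub>G k \<omega>"
    and KF: "\<And>k. K k \<in> borel_measurable (F k)" and KG: "\<And>k. K k \<in> borel_measurable (G k)"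
    and K_le: "\<And>k \<omega>. \<omega> \<in> space M \<Longrightarrow> \<bar>K k \<omega>\<bar> \<le> 1"
  defines "W \<equiv> \<lambda>\<omega>. \<Sum>k<n. K k \<omega> * (X\<^sub>F (Suc k) \<omega> * Y\<^sub>G (Suc k) \<omega> - X\<^sub>F k \<omega> * Y\<^sub>G k \<omega>)"
  shows "integrable M (\<lambda>\<omega>. \<bar>W \<omega>\<bar> powr (4 / 3))"
    and "(\<integral>\<omega>. \<bar>W \<omega>\<bar> powr (4 / 3) \<partial>M) \<le> 2 + 193 * ((\<integral>\<omega>. X \<omega> ^ 4 \<partial>M) + (\<integral>\<omega>. Y \<omega> ^ 4 \<partial>M))"
proof -
  interpret first: square_integrands M F G A B Y Y\<^sub>G K
    by unfold_locales (fact Y Y4 Y\<^sub>G Y\<^sub>G_cond KG K_le)+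
  interpret swapped: two_filtrations M "\<lambda>k. G (Suc k)" F B A by (rule swap_shift)
  interpret second: square_integrands M "\<lambda>k. G (Suc k)" F B A X X\<^sub>F K
    by unfold_locales (fact X X4 X\<^sub>F X\<^sub>F_cond KF K_le)+
  have [measurable]: "W \<in> borel_measurable M" unfolding W_def by measurable
  have bK: "bounded_measurable M (K k)" for k by (rule first.bounded_K)
  \<comment> \<open>A qualitative bound: the summands are in L2 by the fourth moments of
    \<open>X\<^sub>F\<close> and \<open>Y\<^sub>G\<close>. It makes the mean \<open>E\<close> of
    \<open>\<bar>W\<bar> powr (4 / 3)\<close> finite, without which absorbing \<open>E / 2\<close>
    would mean nothing.\<close>
  have sq: "integrable M (\<lambda>\<omega>. (W \<omega>)\<^sup>2)"
  proof -
    have add: "integrable M (\<lambda>\<omega>. (f \<omega> + g \<omega>)\<^sup>2)"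
      if [measurable]: "f \<in> borel_measurable M" "g \<in> borel_measurable M"
        and "integrable M (\<lambda>\<omega>. (f \<omega>)\<^sup>2)" "integrable M (\<lambda>\<omega>. (g \<omega>)\<^sup>2)" for f g :: "'a \<Rightarrow> real"
    proof (rule Bochner_Integration.integrable_bound)
      show "integrable M (\<lambda>\<omega>. 2 * (f \<omega>)\<^sup>2 + 2 * (g \<omega>)\<^sup>2)" using that by simp
      have "(f \<omega> + g \<omega>)\<^sup>2 \<le> 2 * (f \<omega>)\<^sup>2 + 2 * (g \<omega>)\<^sup>2" for \<omega>
        using zero_le_power2[of "f \<omega> - g \<omega>"] by (simp add: power2_sum power2_diff)
      then show "AE \<omega> in M. norm ((f \<omega> + g \<omega>)\<^sup>2) \<le> norm (2 * (f \<omega>)\<^sup>2 + 2 * (g \<omega>)\<^sup>2)" by simp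
    qed measurable
    have XY: "integrable M (\<lambda>\<omega>. (X\<^sub>F k \<omega> * Y\<^sub>G k \<omega>)\<^sup>2)" for k
      using integrable_prod4[of "X\<^sub>F k" "X\<^sub>F k" "Y\<^sub>G k" "Y\<^sub>G k"] first.Y\<^sub>G4(1) second.Y\<^sub>G4(1)
      by (simp add: power2_eq_square mult_ac)
    have D: "integrable M (\<lambda>\<omega>. (X\<^sub>F (Suc k) \<omega> * Y\<^sub>G (Suc k) \<omega> - X\<^sub>F k \<omega> * Y\<^sub>G k \<omega>)\<^sup>2)" for k
      using add[of "\<lambda>\<omega>. X\<^sub>F (Suc k) \<omega> * Y\<^sub>G (Suc k) \<omega>" "\<lambda>\<omega>. - (X\<^sub>F k \<omega> * Y\<^sub>G k \<omega>)"] XY by simp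
    have KD: "integrable M (\<lambda>\<omega>. (K k \<omega> * (X\<^sub>F (Suc k) \<omega> * Y\<^sub>G (Suc k) \<omega> - X\<^sub>F k \<omega> * Y\<^sub>G k \<omega>))\<^sup>2)" for k
      unfolding power_mult_distrib by (intro integrable_bounded_mult bounded_measurable_power bK D)
    show ?thesis
      unfolding W_def
    proof (induction n)
      case (Suc n)
      then show ?case by (simp, intro add KD) auto
    qed simp
  qed
  show N: "integrable M (\<lambda>\<omega>. \<bar>W \<omega>\<bar> powr (4 / 3))"
  proof (rule Bochner_Integration.integrable_bound)
    show "integrable M (\<lambda>\<omega>. 1 + (W \<omega>)\<^sup>2)" using sq by simp
    have "\<bar>x\<bar> powr (4 / 3) \<le> 1 + x\<^sup>2" for x :: real
    proof (cases "\<bar>x\<bar> \<le> 1")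
      case True
      then have "\<bar>x\<bar> powr (4 / 3) \<le> 1 powr (4 / 3)" by (intro powr_mono2) auto
      also have "\<dots> \<le> 1 + x\<^sup>2" by simp
      finally show ?thesis .
    next
      case False
      then have "\<bar>x\<bar> powr (4 / 3) \<le> \<bar>x\<bar> powr 2" by (intro powr_mono) auto
      then show ?thesis using False by simp
    qed
    then show "AE \<omega> in M. norm (\<bar>W \<omega>\<bar> powr (4 / 3)) \<le> norm (1 + (W \<omega>)\<^sup>2)" by simp
  qed measurable
  define Z where "Z \<omega> = sgn (W \<omega>) * \<bar>W \<omega>\<bar> powr (1 / 3)" for \<omega>
  have [measurable]: "Z \<in> borel_measurable M" unfolding Z_def by measurable
  have Z4: "Z \<omega> ^ 4 = \<bar>W \<omega>\<bar> powr (4 / 3)" for \<omega>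
  proof (cases "W \<omega> = 0")
    case False
    then have "sgn (W \<omega>) ^ 4 = 1" by (simp add: sgn_if)
    moreover have "(\<bar>W \<omega>\<bar> powr (1 / 3)) ^ 4 = \<bar>W \<omega>\<bar> powr (4 / 3)"
      using powr_realpow[of "\<bar>W \<omega>\<bar> powr (1 / 3)" 4] False by (simp add: powr_powr)
    ultimately show ?thesis unfolding Z_def power_mult_distrib by simp
  qed (simp add: Z_def)
  have WZ: "W \<omega> * Z \<omega> = \<bar>W \<omega>\<bar> powr (4 / 3)" for \<omega>
  proof -
    have "W \<omega> * Z \<omega> = \<bar>W \<omega>\<bar> * \<bar>W \<omega>\<bar> powr (1 / 3)"
      unfolding Z_def by (simp add: abs_sgn mult_ac)
    then show ?thesis by (simp add: powr_mult_base)
  qed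
  have Z4i: "integrable M (\<lambda>\<omega>. Z \<omega> ^ 4)" using N by (simp add: Z4)
  have i1: "integrable M (\<lambda>\<omega>. K k \<omega> * X\<^sub>F k \<omega> * (Y\<^sub>G (Suc k) \<omega> - Y\<^sub>G k \<omega>) * Z \<omega>)" for k
    using integrable_bounded_mult[OF bK[of k] integrable_prod4[of "X\<^sub>F k" "\<lambda>\<omega>. Y\<^sub>G (Suc k) \<omega> - Y\<^sub>G k \<omega>" Z "\<lambda>_. 1"]]
      second.Y\<^sub>G4(1) integrable_power4_diff[OF first.Y\<^sub>G_M first.Y\<^sub>G_M first.Y\<^sub>G4(1) first.Y\<^sub>G4(1)] Z4i
    by (simp add: mult.assoc)
  have i2: "integrable M (\<lambda>\<omega>. K k \<omega> * Y\<^sub>G (Suc k) \<omega> * (X\<^sub>F (Suc k) \<omega> - X\<^sub>F k \<omega>) * Z \<omega>)" for k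
    using integrable_bounded_mult[OF bK[of k] integrable_prod4[of "Y\<^sub>G (Suc k)" "\<lambda>\<omega>. X\<^sub>F (Suc k) \<omega> - X\<^sub>F k \<omega>" Z "\<lambda>_. 1"]]
      first.Y\<^sub>G4(1) integrable_power4_diff[OF second.Y\<^sub>G_M second.Y\<^sub>G_M second.Y\<^sub>G4(1) second.Y\<^sub>G4(1)] Z4i
    by (simp add: mult.assoc)
  define E where "E = (\<integral>\<omega>. \<bar>W \<omega>\<bar> powr (4 / 3) \<partial>M)"
  have "E = (\<integral>\<omega>. W \<omega> * Z \<omega> \<partial>M)" by (simp add: E_def WZ)
  also have "\<dots> = (\<integral>\<omega>. (\<Sum>k<n. K k \<omega> * X\<^sub>F k \<omega> * (Y\<^sub>G (Suc k) \<omega> - Y\<^sub>G k \<omega>) * Z \<omega>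
      + K k \<omega> * Y\<^sub>G (Suc k) \<omega> * (X\<^sub>F (Suc k) \<omega> - X\<^sub>F k \<omega>) * Z \<omega>) \<partial>M)"
    unfolding W_def sum_distrib_right
    by (intro Bochner_Integration.integral_cong sum.cong refl) (simp add: algebra_simps)
  also have "\<dots> = (\<Sum>k<n. \<integral>\<omega>. K k \<omega> * X\<^sub>F k \<omega> * (Y\<^sub>G (Suc k) \<omega> - Y\<^sub>G k \<omega>) * Z \<omega> \<partial>M)
      + (\<Sum>k<n. \<integral>\<omega>. K k \<omega> * Y\<^sub>G (Suc k) \<omega> * (X\<^sub>F (Suc k) \<omega> - X\<^sub>F k \<omega>) * Z \<omega> \<partial>M)"
    unfolding sum.distrib[symmetric]
    by (subst Bochner_Integration.integral_sum)
       (intro Bochner_Integration.integrable_add i1 i2 sum.cong refl Bochner_Integration.integral_add)+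
  also have "\<dots> \<le> ((1 + (\<integral>\<omega>. Y \<omega> ^ 4 \<partial>M)) / 2 + 96 * (\<integral>\<omega>. X \<omega> ^ 4 \<partial>M) + (\<integral>\<omega>. Z \<omega> ^ 4 \<partial>M) / 4)
     + ((1 + (\<integral>\<omega>. X \<omega> ^ 4 \<partial>M)) / 2 + 96 * (\<integral>\<omega>. Y \<omega> ^ 4 \<partial>M) + (\<integral>\<omega>. Z \<omega> ^ 4 \<partial>M) / 4)"
    by (intro add_mono first.transform_estimate second.transform_estimate X X4 X\<^sub>F X\<^sub>F_cond Y Y4 Y\<^sub>G Y\<^sub>G_cond Z4i
        \<open>Z \<in> borel_measurable M\<close>)
  also have "(\<integral>\<omega>. Z \<omega> ^ 4 \<partial>M) = E" by (simp add: Z4 E_def)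
  \<comment> \<open>The two quarters of \<open>E\<close> on the right are absorbed; doubling the
    constants 1 and 96 + 1/2 gives 2 and 193.\<close>
  finally show "(\<integral>\<omega>. \<bar>W \<omega>\<bar> powr (4 / 3) \<partial>M) \<le> 2 + 193 * ((\<integral>\<omega>. X \<omega> ^ 4 \<partial>M) + (\<integral>\<omega>. Y \<omega> ^ 4 \<partial>M))"
    unfolding E_def[symmetric] by (simp add: field_simps)
qed

end

section \<open>The product space\<close>

lemma subalgebra_pair:
  assumes "subalgebra M1 N1" "subalgebra M2 N2"
  shows "subalgebra (M1 \<Otimes>\<^sub>M M2) (N1 \<Otimes>\<^sub>M N2)"
proof -
  have "{a \<times> b | a b. a \<in> sets N1 \<and> b \<in> sets N2} \<subseteq> {a \<times> b | a b. a \<in> sets M1 \<and> b \<in> sets M2}"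
    using assms unfolding subalgebra_def by blast
  from sigma_sets_mono'[OF this] show ?thesis
    using assms by (simp add: subalgebra_def space_pair_measure sets_pair_measure)
qed

lemma subalgebra_refl: "subalgebra M M"
  by (simp add: subalgebra_def)

text \<open>Independence of the coordinates: for an event of one coordinate, full knowledge of the
  other one adds nothing to the conditioning. Fubini reduces the claim to sections, on each of which
  the conditional expectation of a single factor applies.\<close>

lemma
  assumes P1: "prob_space P1" and P2: "prob_space P2"
  shows pair_cond_exp_fst: "subalgebra P1 N \<Longrightarrow> a \<in> sets P1 \<Longrightarrow>
      AE \<omega> in P1 \<Otimes>\<^sub>M P2. real_cond_exp (P1 \<Otimes>\<^sub>M P2) (N \<Otimes>\<^sub>M P2) (indicator (a \<times> space P2)) \<omega>
        = real_cond_exp P1 N (indicator a) (fst \<omega>)"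
    and pair_cond_exp_snd: "subalgebra P2 N' \<Longrightarrow> b \<in> sets P2 \<Longrightarrow>
      AE \<omega> in P1 \<Otimes>\<^sub>M P2. real_cond_exp (P1 \<Otimes>\<^sub>M P2) (P1 \<Otimes>\<^sub>M N') (indicator (space P1 \<times> b)) \<omega>
        = real_cond_exp P2 N' (indicator b) (snd \<omega>)"
proof -
  interpret P1: prob_space P1 by fact
  interpret P2: prob_space P2 by fact
  interpret pair_prob_space P1 P2 ..
  let ?M = "P1 \<Otimes>\<^sub>M P2"
  show "AE \<omega> in ?M. real_cond_exp ?M (N \<Otimes>\<^sub>M P2) (indicator (a \<times> space P2)) \<omega>
        = real_cond_exp P1 N (indicator a) (fst \<omega>)"
    if N: "subalgebra P1 N" and a[measurable]: "a \<in> sets P1"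
  proof -
    have sub: "subalgebra ?M (N \<Otimes>\<^sub>M P2)"
      using N by (intro subalgebra_pair subalgebra_refl)
    interpret C: sigma_finite_subalgebra ?M "N \<Otimes>\<^sub>M P2"
      by (rule subalgebra_sigma_finite[OF sub])
    interpret C1: sigma_finite_subalgebra P1 N
      by (rule P1.subalgebra_sigma_finite[OF N])
    define g where "g = real_cond_exp P1 N (indicator a)"
    have [measurable]: "g \<in> borel_measurable N" "g \<in> borel_measurable P1"
      unfolding g_def by auto
    have ga: "integrable P1 (indicator a :: _ \<Rightarrow> real)" "integrable P1 g"
      unfolding g_def by (auto intro!: C1.real_cond_exp_int(1) P1.integrable_const_bound[of _ 1])
    have gi: "integrable ?M (\<lambda>\<omega>. g (fst \<omega>))"
      using ga(2) by (intro Fubini_integrable) auto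
    have ai: "integrable ?M (indicator (a \<times> space P2) :: _ \<Rightarrow> real)"
      by (intro integrable_const_bound[of _ 1]) auto
    show ?thesis
      unfolding g_def[symmetric]
    proof (rule C.real_cond_exp_charact)
      fix D assume D: "D \<in> sets (N \<Otimes>\<^sub>M P2)"
      then have [measurable]: "D \<in> sets ?M" using sub by (auto simp: subalgebra_def)
      have "(LINT \<omega>:D|?M. indicator (a \<times> space P2) \<omega> :: real)
        = (\<integral>y. (\<integral>x. indicator D (x, y) * indicator (a \<times> space P2) (x, y) \<partial>P1) \<partial>P2)"
        unfolding set_lebesgue_integral_def
        using integrable_mult_indicator[OF \<open>D \<in> sets ?M\<close> ai] by (subst integral_snd) (auto simp: case_prod_beta')
      also have "\<dots> = (\<integral>y. (\<integral>x. indicator D (x, y) * g x \<partial>P1) \<partial>P2)"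
      proof (rule Bochner_Integration.integral_cong[OF refl])
        fix y assume y: "y \<in> space P2"
        \<comment> \<open>Sections of sets in the product of \<open>N\<close> and \<open>P2\<close>
          are \<open>N\<close>-measurable, so they are admissible test functions on
          \<open>P1\<close>.\<close>
        have m: "(\<lambda>x. indicator D (x, y) :: real) \<in> borel_measurable N"
          using D y by measurable
        have "integrable P1 (\<lambda>x. indicator D (x, y) * indicator a x :: real)"
          using y by (intro P1.integrable_const_bound[of _ 1]) (auto split: split_indicator)
        from C1.real_cond_exp_intg(2)[OF this m] y
        show "(\<integral>x. indicator D (x, y) * indicator (a \<times> space P2) (x, y) \<partial>P1) = (\<integral>x. indicator D (x, y) * g x \<partial>P1)"
          unfolding g_def by (simp add: indicator_times)
      qed
      also have "\<dots> = (LINT \<omega>:D|?M. g (fst \<omega>))"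
        unfolding set_lebesgue_integral_def
        using integrable_mult_indicator[OF \<open>D \<in> sets ?M\<close> gi] by (subst integral_snd) (auto simp: case_prod_beta')
      finally show "(LINT \<omega>:D|?M. indicator (a \<times> space P2) \<omega>) = (LINT \<omega>:D|?M. g (fst \<omega>))" .
    qed (use ai gi in auto)
  qed
  show "AE \<omega> in ?M. real_cond_exp ?M (P1 \<Otimes>\<^sub>M N') (indicator (space P1 \<times> b)) \<omega>
        = real_cond_exp P2 N' (indicator b) (snd \<omega>)"
    if N: "subalgebra P2 N'" and b[measurable]: "b \<in> sets P2"
  proof -
    have sub: "subalgebra ?M (P1 \<Otimes>\<^sub>M N')"
      using N by (intro subalgebra_pair subalgebra_refl)
    interpret C: sigma_finite_subalgebra ?M "P1 \<Otimes>\<^sub>M N'"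
      by (rule subalgebra_sigma_finite[OF sub])
    interpret C2: sigma_finite_subalgebra P2 N'
      by (rule P2.subalgebra_sigma_finite[OF N])
    define g where "g = real_cond_exp P2 N' (indicator b)"
    have [measurable]: "g \<in> borel_measurable N'" "g \<in> borel_measurable P2"
      unfolding g_def by auto
    have ga: "integrable P2 (indicator b :: _ \<Rightarrow> real)" "integrable P2 g"
      unfolding g_def by (auto intro!: C2.real_cond_exp_int(1) P2.integrable_const_bound[of _ 1])
    have gi: "integrable ?M (\<lambda>\<omega>. g (snd \<omega>))"
      using ga(2) by (intro Fubini_integrable) auto
    have ai: "integrable ?M (indicator (space P1 \<times> b) :: _ \<Rightarrow> real)"
      by (intro integrable_const_bound[of _ 1]) auto
    show ?thesis
      unfolding g_def[symmetric]
    proof (rule C.real_cond_exp_charact)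
      fix D assume D: "D \<in> sets (P1 \<Otimes>\<^sub>M N')"
      then have [measurable]: "D \<in> sets ?M" using sub by (auto simp: subalgebra_def)
      have "(LINT \<omega>:D|?M. indicator (space P1 \<times> b) \<omega> :: real)
        = (\<integral>x. (\<integral>y. indicator D (x, y) * indicator (space P1 \<times> b) (x, y) \<partial>P2) \<partial>P1)"
        unfolding set_lebesgue_integral_def
        using integral_fst'[OF integrable_mult_indicator[OF \<open>D \<in> sets ?M\<close> ai]] by simp
      also have "\<dots> = (\<integral>x. (\<integral>y. indicator D (x, y) * g y \<partial>P2) \<partial>P1)"
      proof (rule Bochner_Integration.integral_cong[OF refl])
        fix x assume x: "x \<in> space P1"
        have m: "(\<lambda>y. indicator D (x, y) :: real) \<in> borel_measurable N'"
          using D x by measurable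
        have "integrable P2 (\<lambda>y. indicator D (x, y) * indicator b y :: real)"
          using x by (intro P2.integrable_const_bound[of _ 1]) (auto split: split_indicator)
        from C2.real_cond_exp_intg(2)[OF this m] x
        show "(\<integral>y. indicator D (x, y) * indicator (space P1 \<times> b) (x, y) \<partial>P2) = (\<integral>y. indicator D (x, y) * g y \<partial>P2)"
          unfolding g_def by (simp add: indicator_times)
      qed
      also have "\<dots> = (LINT \<omega>:D|?M. g (snd \<omega>))"
        unfolding set_lebesgue_integral_def
        using integral_fst'[OF integrable_mult_indicator[OF \<open>D \<in> sets ?M\<close> gi]] by simp
      finally show "(LINT \<omega>:D|?M. indicator (space P1 \<times> b) \<omega>) = (LINT \<omega>:D|?M. g (snd \<omega>))" .
    qed (use ai gi in auto)
  qed
qed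

text \<open>The coordinate sigma-algebras are realised on the product as cylinders. A conditional
  probability on one factor, composed with the projection, is measurable both for the cylinders and
  for the product filtration, which supplies the required versions.\<close>

lemma two_filtrations_pair:
  fixes P1 :: "'a measure" and P2 :: "'b measure"
  assumes P1: "prob_space P1" and P2: "prob_space P2"
    and A: "\<And>k. subalgebra P1 (A k)" "\<And>k. subalgebra (A (Suc k)) (A k)"
    and B: "\<And>k. subalgebra P2 (B k)" "\<And>k. subalgebra (B (Suc k)) (B k)"
  shows "two_filtrations (P1 \<Otimes>\<^sub>M P2) (\<lambda>k. A k \<Otimes>\<^sub>M P2) (\<lambda>k. P1 \<Otimes>\<^sub>M B k)
    (vimage_algebra (space P1 \<times> space P2) fst P1) (vimage_algebra (space P1 \<times> space P2) snd P2)"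
proof -
  interpret P1: prob_space P1 by fact
  interpret P2: prob_space P2 by fact
  interpret pair_prob_space P1 P2 ..
  let ?M = "P1 \<Otimes>\<^sub>M P2"
  let ?A = "vimage_algebra (space P1 \<times> space P2) fst P1" and ?B = "vimage_algebra (space P1 \<times> space P2) snd P2"
  have sp: "space (A k) = space P1" "space (B k) = space P2" for k
    using A(1) B(1) by (auto simp: subalgebra_def)
  have v1: "fst -` a \<inter> (space P1 \<times> space P2) = a \<times> space P2" if "a \<in> sets P1" for a
    using sets.sets_into_space[OF that] by auto
  have v2: "snd -` b \<inter> (space P1 \<times> space P2) = space P1 \<times> b" if "b \<in> sets P2" for b
    using sets.sets_into_space[OF that] by auto
  have sA: "sets ?A = {a \<times> space P2 | a. a \<in> sets P1}"
  proof -
    have "sets ?A = {fst -` E \<inter> (space P1 \<times> space P2) | E. E \<in> sets P1}"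
      by (rule sets_vimage_algebra2) auto
    then show ?thesis by (simp add: Setcompr_eq_image v1 cong: image_cong)
  qed
  have sB: "sets ?B = {space P1 \<times> b | b. b \<in> sets P2}"
  proof -
    have "sets ?B = {snd -` E \<inter> (space P1 \<times> space P2) | E. E \<in> sets P2}"
      by (rule sets_vimage_algebra2) auto
    then show ?thesis by (simp add: Setcompr_eq_image v2 cong: image_cong)
  qed
  show ?thesis
  proof
    show "subalgebra ?M (A k \<Otimes>\<^sub>M P2)" "subalgebra ?M (P1 \<Otimes>\<^sub>M B k)"
      "subalgebra (A (Suc k) \<Otimes>\<^sub>M P2) (A k \<Otimes>\<^sub>M P2)" "subalgebra (P1 \<Otimes>\<^sub>M B (Suc k)) (P1 \<Otimes>\<^sub>M B k)" for k
      by (intro subalgebra_pair subalgebra_refl A B)+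
    have "space P2 \<in> sets (B k)" "space P1 \<in> sets (A k)" for k
      using sets.top[of "A k"] sets.top[of "B k"] by (simp_all add: sp)
    then show "subalgebra (P1 \<Otimes>\<^sub>M B k) ?A" "subalgebra (A k \<Otimes>\<^sub>M P2) ?B" for k
      unfolding subalgebra_def sA sB by (auto simp: space_pair_measure sp)
  next
    fix k E assume "E \<in> sets ?A"
    then obtain a where a: "a \<in> sets P1" "E = a \<times> space P2" by (auto simp: sA)
    define g where "g = real_cond_exp P1 (A k) (indicator a)"
    have [measurable]: "g \<in> borel_measurable (A k)" "g \<in> borel_measurable P1" by (auto simp: g_def)
    show "\<exists>g. g \<in> borel_measurable ?A \<and> g \<in> borel_measurable (A k \<Otimes>\<^sub>M P2) \<and>
        (AE \<omega> in ?M. real_cond_exp ?M (A k \<Otimes>\<^sub>M P2) (indicator E) \<omega> = g \<omega>)"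
    proof (intro exI[of _ "\<lambda>\<omega>. g (fst \<omega>)"] conjI)
      show "(\<lambda>\<omega>. g (fst \<omega>)) \<in> borel_measurable ?A"
        by (rule measurable_compose[OF measurable_vimage_algebra1]) auto
      show "AE \<omega> in ?M. real_cond_exp ?M (A k \<Otimes>\<^sub>M P2) (indicator E) \<omega> = g (fst \<omega>)"
        unfolding g_def a(2) by (rule pair_cond_exp_fst[OF P1 P2 A(1) a(1)])
    qed measurable
  next
    fix k E assume "E \<in> sets ?B"
    then obtain b where b: "b \<in> sets P2" "E = space P1 \<times> b" by (auto simp: sB)
    define g where "g = real_cond_exp P2 (B k) (indicator b)"
    have [measurable]: "g \<in> borel_measurable (B k)" "g \<in> borel_measurable P2" by (auto simp: g_def)
    show "\<exists>g. g \<in> borel_measurable ?B \<and> g \<in> borel_measurable (P1 \<Otimes>\<^sub>M B k) \<and>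
        (AE \<omega> in ?M. real_cond_exp ?M (P1 \<Otimes>\<^sub>M B k) (indicator E) \<omega> = g \<omega>)"
    proof (intro exI[of _ "\<lambda>\<omega>. g (snd \<omega>)"] conjI)
      show "(\<lambda>\<omega>. g (snd \<omega>)) \<in> borel_measurable ?B"
        by (rule measurable_compose[OF measurable_vimage_algebra1]) auto
      show "AE \<omega> in ?M. real_cond_exp ?M (P1 \<Otimes>\<^sub>M B k) (indicator E) \<omega> = g (snd \<omega>)"
        unfolding g_def b(2) by (rule pair_cond_exp_snd[OF P1 P2 B(1) b(1)])
    qed measurable
  next
    \<comment> \<open>Cylinders of the two coordinates intersect in exactly the measurable
      rectangles, which generate the product.\<close>
    have "(a \<times> space P2) \<inter> (space P1 \<times> b) = a \<times> b" if "a \<in> sets P1" "b \<in> sets P2" for a b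
      using sets.sets_into_space[OF that(1)] sets.sets_into_space[OF that(2)] by auto
    then have "{E \<inter> E' | E E'. E \<in> sets ?A \<and> E' \<in> sets ?B} = {a \<times> b | a b. a \<in> sets P1 \<and> b \<in> sets P2}"
      unfolding sA sB by (auto, metis, metis)
    then show "sets ?M = sigma_sets (space ?M) {E \<inter> E' | E E'. E \<in> sets ?A \<and> E' \<in> sets ?B}"
      by (simp add: sets_pair_measure space_pair_measure)
  qed
qed

section \<open>Boundedness in probability, and reduction of the elementary integrals to discrete
  time\<close>

lemma (in prob_space) bounded_in_Lp_imp_bounded_in_probability:
  assumes S: "bounded_in_Lp M p S" and p: "0 < p"
  shows "bounded_in_probability M S"
proof -
  obtain C where C: "\<And>f. f \<in> S \<Longrightarrow> in_Lp M p f" "\<And>f. f \<in> S \<Longrightarrow> Lp_norm M p f \<le> C"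
    using S by (auto simp: bounded_in_Lp_def)
  define c where "c = max C 0 powr p"
  have le: "(\<integral>\<omega>. \<bar>f \<omega>\<bar> powr p \<partial>M) \<le> c" if "f \<in> S" for f
  proof -
    have "(\<integral>\<omega>. \<bar>f \<omega>\<bar> powr p \<partial>M) = Lp_norm M p f powr p"
      unfolding Lp_norm_def using p by (simp add: powr_powr integral_nonneg_AE)
    also have "\<dots> \<le> c"
      unfolding c_def using p C(2)[OF that] by (intro powr_mono2) (auto simp: Lp_norm_def)
    finally show ?thesis .
  qed
  \<comment> \<open>Markov's inequality with a right side that is the same for all \<open>f\<close>
    in \<open>S\<close>, so it survives the supremum.\<close>
  have markov: "emeasure M {\<omega> \<in> space M. \<bar>f \<omega>\<bar> > l} \<le> ennreal (c * l powr (- p))" if f: "f \<in> S" and l: "0 < l" for f l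
  proof -
    have [measurable]: "f \<in> borel_measurable M" and i: "integrable M (\<lambda>\<omega>. \<bar>f \<omega>\<bar> powr p)"
      using C(1)[OF f] by (auto simp: in_Lp_def)
    have "measure M {\<omega> \<in> space M. \<bar>f \<omega>\<bar> > l} \<le> measure M {\<omega> \<in> space M. \<bar>f \<omega>\<bar> powr p \<ge> l powr p}"
      using l p by (intro finite_measure_mono) (auto intro!: powr_mono2)
    also have "\<dots> \<le> (\<integral>\<omega>. \<bar>f \<omega>\<bar> powr p \<partial>M) / l powr p"
      by (rule integral_Markov_inequality_measure[OF i _ AE_I2, of "{}"]) (use l in auto)
    also have "\<dots> \<le> c / l powr p"
      by (intro divide_right_mono le f) auto
    finally show ?thesis
      by (simp add: emeasure_eq_measure powr_minus divide_inverse ennreal_leI)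
  qed
  have "((\<lambda>l::real. c * l powr (- p)) \<longlongrightarrow> c * 0) at_top"
    using p by (intro tendsto_mult tendsto_const tendsto_neg_powr filterlim_ident) auto
  then have 0: "((\<lambda>l. ennreal (c * l powr (- p))) \<longlongrightarrow> 0) at_top"
    using tendsto_ennrealI by fastforce
  have "((\<lambda>l::real. SUP f\<in>S. emeasure M {\<omega> \<in> space M. \<bar>f \<omega>\<bar> > l}) \<longlongrightarrow> 0) at_top"
  proof (rule tendsto_sandwich[OF _ _ tendsto_const 0])
    show "\<forall>\<^sub>F l in at_top. (SUP f\<in>S. emeasure M {\<omega> \<in> space M. \<bar>f \<omega>\<bar> > l}) \<le> ennreal (c * l powr (- p))"
      using eventually_gt_at_top[of 0] by eventually_elim (auto intro!: SUP_least markov)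
  qed auto
  then show ?thesis
    using C(1) by (auto simp: bounded_in_probability_def in_Lp_def)
qed

lemma Linf_norm_le_AE:
  assumes "Linf_norm M f \<le> 1"
  shows "AE \<omega> in M. \<bar>f \<omega>\<bar> \<le> 1"
  using esssup_AE[of "\<lambda>\<omega>. ennreal \<bar>f \<omega>\<bar>" M]
proof eventually_elim
  case (elim \<omega>)
  also have "esssup M (\<lambda>\<omega>. ennreal \<bar>f \<omega>\<bar>) \<le> 1"
    using assms by (simp add: Linf_norm_def)
  finally show ?case by (simp add: ennreal_le_1)
qed

theorem corollary3:
  fixes P1 :: "'a measure" and P2 :: "'b measure"
    and A :: "real \<Rightarrow> 'a measure" and B :: "real \<Rightarrow> 'b measure"
    and M :: "('a \<times> 'b) measure"
    and F G FG :: "real \<Rightarrow> ('a \<times> 'b) measure"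
    and X Y :: "real \<Rightarrow> 'a \<times> 'b \<Rightarrow> real"
    and t :: real
    and S :: "('a \<times> 'b \<Rightarrow> real) set"
  assumes P1: "prob_space P1" and P2: "prob_space P2"
    and A: "filtration_of P1 A" and B: "filtration_of P2 B"
    and M_def: "M = P1 \<Otimes>\<^sub>M P2"
    and F_def: "\<And>s. F s = A s \<Otimes>\<^sub>M P2"
    and G_def: "\<And>s. G s = P1 \<Otimes>\<^sub>M B s"
    and FG_def: "\<And>s. FG s = Int_algebra (F s) (G s)"
    and X: "martingale_wrt M F X" and Y: "martingale_wrt M G Y"
    and t: "t > 0"
    and X4: "in_Lp M 4 (X t)" and Y4: "in_Lp M 4 (Y t)"
    and S_def: "S = {elementary_integral (space M) FG t H (\<lambda>s \<omega>. X s \<omega> * Y s \<omega>) | H.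
      elementary_predictable (space M) FG t H \<and> (SUP s\<in>{0..t}. Linf_norm M (H s)) \<le> 1}"
  shows "bounded_in_Lp M (4 / 3) S \<and> bounded_in_probability M S"
proof -
  interpret P1: prob_space P1 by (rule P1)
  interpret P2: prob_space P2 by (rule P2)
  interpret pair_prob_space P1 P2 ..
  interpret M: prob_space M unfolding M_def by (rule prob_space_axioms)
  define c where "c = 2 + 193 * ((\<integral>\<omega>. X t \<omega> ^ 4 \<partial>M) + (\<integral>\<omega>. Y t \<omega> ^ 4 \<partial>M))"
  have pow: "\<bar>x\<bar> powr 4 = x ^ 4" for x :: real
    using powr_numeral[of "\<bar>x\<bar>" "num.Bit0 (num.Bit0 num.One)"] by (simp add: power_even_abs)
  have X4': "X t \<in> borel_measurable M" "integrable M (\<lambda>\<omega>. X t \<omega> ^ 4)"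
    and Y4': "Y t \<in> borel_measurable M" "integrable M (\<lambda>\<omega>. Y t \<omega> ^ 4)"
    using X4 Y4 by (auto simp: in_Lp_def pow)
  have sub: "subalgebra P1 (A s)" "subalgebra P2 (B s)" if "0 \<le> s" for s
    using A B that by (auto simp: filtration_of_def)
  have mono: "subalgebra (A u) (A s)" "subalgebra (B u) (B s)" if "0 \<le> s" "s \<le> u" for s u
    using A B that unfolding filtration_of_def subalgebra_def by auto
  have space: "space (F s) = space M" "space (G s) = space M" if "0 \<le> s" for s
    using sub[OF that] by (simp_all add: F_def G_def M_def subalgebra_def space_pair_measure)
  \<comment> \<open>Through this, predictability for the intersection makes every \<open>K k\<close>
    adapted to both filtrations.\<close>
  have FG: "subalgebra (F s) (FG s)" "subalgebra (G s) (FG s)" if "0 \<le> s" for s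
    using space[OF that] by (simp_all add: subalgebra_def FG_def sets_Int_algebra space_Int_algebra)
  have "in_Lp M (4 / 3) f \<and> Lp_norm M (4 / 3) f \<le> c powr (3 / 4)" if fS: "f \<in> S" for f
  proof -
    obtain H :: "real \<Rightarrow> 'a \<times> 'b \<Rightarrow> real" where f: "f = elementary_integral (space M) FG t H (\<lambda>s \<omega>. X s \<omega> * Y s \<omega>)"
      and H: "elementary_predictable (space M) FG t H" and H1: "(SUP s\<in>{0..t}. Linf_norm M (H s)) \<le> 1"
      using fS unfolding S_def by blast
    obtain n \<tau> K0 K where repr: "elementary_repr (space M) FG t n \<tau> K0 K H"
      using H unfolding elementary_predictable_def by blast
    have \<tau>: "\<tau> 0 = 0" "\<tau> n = t" "\<And>k. k < n \<Longrightarrow> \<tau> k < \<tau> (Suc k)"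
      and K: "\<And>k. k < n \<Longrightarrow> K k \<in> borel_measurable (FG (\<tau> k))"
      and HK: "\<And>k \<omega>. k < n \<Longrightarrow> \<omega> \<in> space M \<Longrightarrow> H (\<tau> (Suc k)) \<omega> = K k \<omega>"
      using repr unfolding elementary_repr_def by auto
    \<comment> \<open>\<open>two_filtrations\<close> is indexed by all natural numbers, so the
      partition is continued beyond \<open>n\<close> with the constant value
      \<open>t\<close>.\<close>
    define \<sigma> where "\<sigma> k = \<tau> (min k n)" for k
    have \<sigma>_Suc: "\<sigma> k \<le> \<sigma> (Suc k)" for k
      using \<tau>(3)[of k] by (cases "k < n") (auto simp: \<sigma>_def)
    have \<sigma>_ge: "0 \<le> \<sigma> k" for k
    proof -
      have "\<sigma> 0 \<le> \<sigma> k" by (rule lift_Suc_mono_le[of \<sigma>, OF \<sigma>_Suc]) simp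
      then show ?thesis by (simp add: \<sigma>_def[of 0] \<tau>)
    qed
    have \<sigma>_le: "\<sigma> k \<le> t" for k
    proof -
      have "\<sigma> k = \<sigma> (min k n)" by (simp add: \<sigma>_def)
      also have "\<dots> \<le> \<sigma> n" by (rule lift_Suc_mono_le[of \<sigma>, OF \<sigma>_Suc]) simp
      finally show ?thesis by (simp add: \<sigma>_def \<tau>)
    qed
    interpret tf: two_filtrations M "\<lambda>k. F (\<sigma> k)" "\<lambda>k. G (\<sigma> k)"
      "vimage_algebra (space P1 \<times> space P2) fst P1" "vimage_algebra (space P1 \<times> space P2) snd P2"
      unfolding F_def G_def M_def
      by (intro two_filtrations_pair P1 P2 sub mono \<sigma>_ge \<sigma>_Suc)
    \<comment> \<open>The norm bound on \<open>H\<close> controls \<open>K k\<close> only up to null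
      sets, whereas the discrete estimate wants a bound at every point. Truncation preserves
      measurability for both filtrations and alters the integral only on a null set.\<close>
    define K' where "K' k \<omega> = (if k < n then max (-1) (min 1 (K k \<omega>)) else 0)" for k \<omega>
    have KF: "K' k \<in> borel_measurable (F (\<sigma> k))" and KG: "K' k \<in> borel_measurable (G (\<sigma> k))" for k
    proof -
      have "K k \<in> borel_measurable (FG (\<sigma> k))" if "k < n"
        using K[OF that] that by (simp add: \<sigma>_def)
      then have "K k \<in> borel_measurable (F (\<sigma> k))" "K k \<in> borel_measurable (G (\<sigma> k))" if "k < n"
        using that measurable_from_subalg[OF FG(1)[OF \<sigma>_ge]] measurable_from_subalg[OF FG(2)[OF \<sigma>_ge]] by blast+
      then show "K' k \<in> borel_measurable (F (\<sigma> k))" "K' k \<in> borel_measurable (G (\<sigma> k))"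
        unfolding K'_def by (cases "k < n"; simp)+
    qed
    define W where "W \<omega> = (\<Sum>k<n. K' k \<omega> * (X (\<sigma> (Suc k)) \<omega> * Y (\<sigma> (Suc k)) \<omega> - X (\<sigma> k) \<omega> * Y (\<sigma> k) \<omega>))" for \<omega>
    have XF: "X (\<sigma> k) \<in> borel_measurable (F (\<sigma> k))" "AE \<omega> in M. real_cond_exp M (F (\<sigma> k)) (X t) \<omega> = X (\<sigma> k) \<omega>"
      and YG: "Y (\<sigma> k) \<in> borel_measurable (G (\<sigma> k))" "AE \<omega> in M. real_cond_exp M (G (\<sigma> k)) (Y t) \<omega> = Y (\<sigma> k) \<omega>" for k
      using X Y \<sigma>_ge[of k] \<sigma>_le[of k] unfolding martingale_wrt_def by auto
    have K'_le: "\<bar>K' k \<omega>\<bar> \<le> 1" for k \<omega>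
      unfolding K'_def by auto
    have W: "integrable M (\<lambda>\<omega>. \<bar>W \<omega>\<bar> powr (4 / 3))" "(\<integral>\<omega>. \<bar>W \<omega>\<bar> powr (4 / 3) \<partial>M) \<le> c"
      using tf.product_increments_estimate[where X = "X t" and Y = "Y t" and X\<^sub>F = "\<lambda>k. X (\<sigma> k)"
          and Y\<^sub>G = "\<lambda>k. Y (\<sigma> k)" and K = K' and n = n, OF X4' XF Y4' YG KF KG K'_le]
      unfolding W_def c_def .
    have KM[measurable]: "K k \<in> borel_measurable M" if "k < n" for k
    proof -
      have "K k \<in> borel_measurable (F (\<sigma> k))"
        using K[OF that] that by (intro measurable_from_subalg[OF FG(1)[OF \<sigma>_ge]]) (simp add: \<sigma>_def)
      then show ?thesis by (rule measurable_from_subalg[OF tf.F])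
    qed
    have XYM[measurable]: "X (\<sigma> k) \<in> borel_measurable M" "Y (\<sigma> k) \<in> borel_measurable M" for k
      using measurable_from_subalg[OF tf.F XF(1)] measurable_from_subalg[OF tf.G YG(1)] by auto
    have f_eq: "f \<omega> = (\<Sum>k<n. K k \<omega> * (X (\<sigma> (Suc k)) \<omega> * Y (\<sigma> (Suc k)) \<omega> - X (\<sigma> k) \<omega> * Y (\<sigma> k) \<omega>))"
      if "\<omega> \<in> space M" for \<omega>
      unfolding f elementary_integral_eq[OF repr that] elementary_sum_def
      by (intro sum.cong) (auto simp: \<sigma>_def Suc_le_eq min_def)
    have fM: "f \<in> borel_measurable M"
      by (subst measurable_cong[OF f_eq]) (auto intro!: borel_measurable_sum borel_measurable_times
          borel_measurable_diff KM XYM)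
    have WM: "W \<in> borel_measurable M"
      unfolding W_def using measurable_from_subalg[OF tf.F KF]
      by (intro borel_measurable_sum borel_measurable_times borel_measurable_diff XYM)
    have K1: "AE \<omega> in M. \<bar>K k \<omega>\<bar> \<le> 1" if k: "k < n" for k
    proof -
      \<comment> \<open>The value \<open>K k\<close> is read off at the right end point, which
        belongs to the half-open interval on which \<open>H\<close> equals
        \<open>K k\<close>.\<close>
      have "\<tau> (Suc k) \<in> {0..t}"
        using \<sigma>_ge[of "Suc k"] \<sigma>_le[of "Suc k"] k by (simp add: \<sigma>_def Suc_le_eq min_def)
      then have "Linf_norm M (H (\<tau> (Suc k))) \<le> 1"
        using H1 by (auto simp: SUP_le_iff)
      then have "AE \<omega> in M. \<bar>H (\<tau> (Suc k)) \<omega>\<bar> \<le> 1"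
        by (rule Linf_norm_le_AE)
      then show ?thesis
        using AE_space by eventually_elim (simp add: HK k)
    qed
    have "AE \<omega> in M. \<forall>k\<in>{..<n}. \<bar>K k \<omega>\<bar> \<le> 1"
      by (rule AE_finite_allI) (use K1 in auto)
    then have fW: "AE \<omega> in M. f \<omega> = W \<omega>"
      using AE_space
    proof eventually_elim
      case (elim \<omega>)
      then have "K' k \<omega> = K k \<omega>" if "k < n" for k
        using that by (auto simp: K'_def abs_le_iff)
      then show ?case
        unfolding f_eq[OF elim(2)] W_def by (intro sum.cong) auto
    qed
    have "integrable M (\<lambda>\<omega>. \<bar>f \<omega>\<bar> powr (4 / 3)) \<longleftrightarrow> integrable M (\<lambda>\<omega>. \<bar>W \<omega>\<bar> powr (4 / 3))"
      using fW fM WM by (intro integrable_cong_AE) auto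
    moreover have "(\<integral>\<omega>. \<bar>f \<omega>\<bar> powr (4 / 3) \<partial>M) = (\<integral>\<omega>. \<bar>W \<omega>\<bar> powr (4 / 3) \<partial>M)"
      using fW fM WM by (intro integral_cong_AE) auto
    ultimately show ?thesis
      using W fM unfolding in_Lp_def Lp_norm_def by (auto intro!: powr_mono2 integral_nonneg_AE)
  qed
  then have "bounded_in_Lp M (4 / 3) S"
    unfolding bounded_in_Lp_def by blast
  then show ?thesis
    using M.bounded_in_Lp_imp_bounded_in_probability by simp
qed

end
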